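(* Let $n\ge2$, let $E\neq\emptyset$ be a closed porous set in $\mathbb{R}^n$, and let $1\le p\le q\le np/(n-p)<\infty$ and $\beta\in\mathbb{R}$ be such that $$\overline{\dim}_A(E)<\frac{q}{p}(n-p+\beta).$$ In addition, assume that either $\overline{\dim}_A(E)<n-1$ or that $$\beta\le\frac{(p-1)(qp+np-nq)}{qp+p-q}.$$ Then there is a constant $C>0$ such that the inequality $$\biggl(\int_{\mathbb{R}^n} |f(x)|^q \, \delta_E(x)^{(q/p)(n-p+\beta)-n}\,dx\biggr)^{1/q}\le C\biggl(\int_{\mathbb{R}^n} |\nabla f(x)|^p\,\delta_E(x)^\beta\,dx\biggr)^{1/p}$$ holds for every $f\in C^\infty_0(\mathbb{R}^n)$.
   Context: $\delta_E(x)=\operatorname{dist}(x,E)$, $B(x,R)$ is the open ball, $d(E)$ is the diameter of $E$, and $C_0^\infty(\mathbb{R}^n)$ denotes smooth functions with compact support in $\mathbb{R}^n$. The condition $np/(n-p)<\infty$ means in particular that $p<n$. A set $E\subset\mathbb{R}^n$ is porous if there is a constant $0<c<1$ such that for every $x\in E$ and all $0<r<d(E)$ there is a point $y\in\mathbb{R}^n$ with $B(y,cr)\subset B(x,r)\setminus E$. For bounded $A\subset\mathbb{R}^n$ and $r>0$, $N(A,r)$ is the minimal number of open balls of radius $r$ centered at points of $A$ needed to cover $A$. The (upper) Assouad dimension is $\overline{\dim}_A(E)=\inf\{\lambda\ge 0:\ \exists\, C_\lambda>0 \text{ such that } N(E\cap B(x,R),r)\le C_\lambda (r/R)^{-\lambda}\text{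 for all } x\in E,\ 0<r<R<d(E)\}$. *)

theory Defs
  imports "HOL-Analysis.Analysis"
begin

text \<open>
  The library's \<open>diameter\<close> is real-valued and meaningless on unbounded sets,
  so the diameter is taken in \<open>[0, \<infinity>]\<close> here.
\<close>
definition ediameter :: "'a::metric_space set \<Rightarrow> ennreal" where
  "ediameter E = (SUP x\<in>E. SUP y\<in>E. ennreal (dist x y))"

definition porous :: "'a::metric_space set \<Rightarrow> bool" where
  "porous E \<longleftrightarrow>
     (\<exists>c::real. 0 < c \<and> c < 1 \<and>
        (\<forall>x\<in>E. \<forall>r::real. 0 < r \<and> ennreal r < ediameter E \<longrightarrow>
           (\<exists>y. ball y (c * r) \<subseteq> ball x r - E)))"

text \<open>
  Only applied to bounded subsets of Euclidean space and \<open>r > 0\<close>, where a finite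
  cover exists and the minimum is attained.
\<close>
definition covering_number :: "'a::metric_space set \<Rightarrow> real \<Rightarrow> nat" where
  "covering_number A r =
     (LEAST k. \<exists>S. finite S \<and> card S = k \<and> S \<subseteq> A \<and> A \<subseteq> (\<Union>a\<in>S. ball a r))"

text \<open>
  In Euclidean space the set below contains the dimension of the space, so the real-valued
  infimum is over a nonempty set that is bounded below.
\<close>
definition assouad_dim :: "'a::metric_space set \<Rightarrow> real" where
  "assouad_dim E = Inf {s::real. 0 \<le> s \<and>
     (\<exists>C>0. \<forall>x\<in>E. \<forall>r R::real. 0 < r \<and> r < R \<and> ennreal R < ediameter E \<longrightarrow>
        real (covering_number (E \<inter> ball x R) r) \<le> C * (r / R) powr (- s))}"

definition gradient :: "('a::real_inner \<Rightarrow> real) \<Rightarrow> 'a \<Rightarrow> 'a" where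
  "gradient f x = (THE D. GDERIV f x :> D)"

primrec Ck :: "nat \<Rightarrow> ('a::euclidean_space \<Rightarrow> real) \<Rightarrow> bool" where
  "Ck 0 f \<longleftrightarrow> continuous_on UNIV f"
| "Ck (Suc k) f \<longleftrightarrow>
     (\<forall>x. f differentiable (at x)) \<and>
     (\<forall>b\<in>Basis. Ck k (\<lambda>x. frechet_derivative f (at x) b))"

definition test_function :: "('a::euclidean_space \<Rightarrow> real) \<Rightarrow> bool" where
  "test_function f \<longleftrightarrow> (\<forall>k. Ck k f) \<and> compact (closure {x. f x \<noteq> 0})"

text \<open>
  Intended for exponents \<open>a > 0\<close> only.  The integrals raised to such powers carry weights
  \<open>infdist x E powr b\<close>, which the convention \<open>0 powr b = 0\<close> makes vanish on \<open>E\<close> even for \<open>b \<le> 0\<close>.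
  This does not affect the integrals: a closed porous set in dimension at least 1 is Lebesgue null.
\<close>
definition ennreal_powr :: "ennreal \<Rightarrow> real \<Rightarrow> ennreal" where
  "ennreal_powr t a = (if t = \<infinity> then \<infinity> else ennreal (enn2real t powr a))"

end

theory Submission
  imports Defs
begin

text \<open>
  Write \<open>\<delta>\<close> for the distance to \<open>E\<close>, \<open>Q = q / p * (n - p + \<beta>)\<close> and \<open>\<mu>\<close> for the measure with
  density \<open>\<delta> powr (Q - n)\<close>.  The exponent \<open>p > 1\<close> is reduced to an inequality of exponent 1 for a power
  of \<open>\<bar>f\<bar>\<close>, and that inequality is an isoperimetric statement about the sets \<open>{\<bar>f\<bar> > s}\<close> which is
  proved ball by ball.

  Reduction.  Put \<open>\<gamma> = 1 + q * (p - 1) / p\<close>, \<open>q1 = q / \<gamma>\<close> and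
  \<open>\<beta>1 = (Q - n) * (p - 1) / p + \<beta> / p\<close>.  Then \<open>q1 * (n - 1 + \<beta>1) = Q\<close>, so the weight \<open>\<mu>\<close> of exponents
  \<open>(1, q1, \<beta>1)\<close> is the same as that of \<open>(p, q, \<beta>)\<close>; the bounds \<open>p \<le> q \<le> n * p / (n - p)\<close> say exactly that
  \<open>1 \<le> q1 \<le> n / (n - 1)\<close>; and the second alternative of the hypothesis says exactly that \<open>\<beta>1 \<le> 0\<close>
  (\<open>hardy_sobolev_exponents\<close>).  The case of exponent 1, applied to \<open>\<bar>f\<bar> powr \<gamma>\<close>, has the integral of
  \<open>\<bar>f\<bar> powr (\<gamma> - 1) * norm (gradient f) * \<delta> powr \<beta>1\<close> on the right, and Hoelder's inequality bounds it by
  a power of the left side times the desired right side.  The left side is finite because \<open>\<mu>\<close> is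
  locally finite, so it can be cancelled.

  Balls.  Since the Assouad dimension is below some \<open>\<nu> < Q\<close>, the \<open>r\<close>-neighbourhood of \<open>E\<close> fills at most a
  fraction of order \<open>(r / R) powr (n - \<nu>)\<close> of a ball of radius \<open>R\<close>; summing over dyadic layers gives
  \<open>\<mu> (ball x R) \<le> K * R powr Q\<close> for balls close to \<open>E\<close> (\<open>distance_weight_ball\<close>).  On the other side,
  suppose that a fixed part of \<open>ball x r\<close> lies in \<open>{\<bar>f\<bar> \<ge> s + h}\<close> and half of it in \<open>{\<bar>f\<bar> \<le> s}\<close>.  Every segment
  between the two parts crosses the layer \<open>{s < \<bar>f\<bar> < s + h}\<close>, and integrating over all segments
  shows that the layer carries at least \<open>c * r powr (n - 1)\<close> of \<open>norm (gradient f) / h\<close>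
  (\<open>two_set_poincare\<close>).  With the weight one needs \<open>c * r powr (n - 1 + \<beta>1)\<close>.  For \<open>\<beta>1 \<le> 0\<close> this
  holds because \<open>\<delta>\<close> is at most a multiple of \<open>r\<close> on the ball and \<open>E\<close> is a null set by porosity.  For
  \<open>\<nu> < n - 1\<close> one uses that the segments can be made to pay for entering the \<open>\<epsilon> * r\<close>-neighbourhood of
  \<open>E\<close>: that toll costs only a small multiple of \<open>r powr (n - 1)\<close> in total, since \<open>n - 1 - \<nu> > 0\<close>, so most of
  the gradient lies where \<open>\<delta> \<ge> \<epsilon> * r\<close> (\<open>admissible_weighted_near_dim\<close>).  Both cases give
  \<open>\<mu> (ball x (5 * r)) powr (1 / q1) \<le> C * t\<close>, with \<open>t\<close> the weighted integral over \<open>ball x r\<close>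
  (\<open>ball_isoperimetry\<close>).

  Level sets.  Around every point of \<open>{\<bar>f\<bar> \<ge> s + \<sigma>}\<close> there is a ball of that kind, the Vitali covering
  lemma selects disjoint ones, and as \<open>q1 \<ge> 1\<close> the estimates add up to a bound for
  \<open>\<mu> {\<bar>f\<bar> \<ge> s + \<sigma>} powr (1 / q1)\<close> (\<open>level_set_estimate\<close>).  Letting \<open>h\<close> tend to 0 with Fatou's lemma and
  integrating over \<open>s\<close> with Tonelli's theorem replaces the coarea formula
  (\<open>weighted_coarea_bound\<close>), and the layer-cake formula turns the result into the norm of
  \<open>\<bar>f\<bar> powr \<gamma>\<close> (\<open>layer_cake_bound\<close>).
\<close>

section \<open>Hoelder's inequality\<close>

text \<open>
  Hoelder's inequality in the form of log-convexity, from the weighted arithmetic-geometric mean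
  inequality.  This form includes the endpoints \<open>\<alpha> = 0\<close> and \<open>\<beta> = 0\<close>, hence the exponents \<open>p = 1\<close> and
  \<open>q1 = 1\<close> below; the convention \<open>0 powr 0 = 0\<close> is what keeps it true when \<open>A\<close> or \<open>B\<close> vanishes.
\<close>
lemma nn_integral_Holder:
  fixes u v :: "'b \<Rightarrow> real"
  assumes [measurable]: "u \<in> borel_measurable M" "v \<in> borel_measurable M"
    and pos: "\<And>x. 0 \<le> u x" "\<And>x. 0 \<le> v x" and ab: "0 \<le> \<alpha>" "0 \<le> \<beta>" "\<alpha> + \<beta> = 1"
    and I: "(\<integral>\<^sup>+x. ennreal (u x) \<partial>M) \<le> ennreal A" "(\<integral>\<^sup>+x. ennreal (v x) \<partial>M) \<le> ennreal B"
    and AB: "0 \<le> A" "0 \<le> B"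
  shows "(\<integral>\<^sup>+x. ennreal (u x powr \<alpha> * v x powr \<beta>) \<partial>M) \<le> ennreal (A powr \<alpha> * B powr \<beta>)"
proof (cases "A = 0 \<or> B = 0")
  case True
  have "AE x in M. u x powr \<alpha> * v x powr \<beta> = 0"
    using True
  proof
    assume "A = 0"
    with I have "(\<integral>\<^sup>+x. ennreal (u x) \<partial>M) = 0" by simp
    then have "AE x in M. ennreal (u x) = 0" by (subst (asm) nn_integral_0_iff_AE) auto
    then show ?thesis using pos by (auto simp: ennreal_eq_0_iff elim!: eventually_mono) (smt (verit) pos powr_0)
  next
    assume "B = 0"
    with I have "(\<integral>\<^sup>+x. ennreal (v x) \<partial>M) = 0" by simp
    then have "AE x in M. ennreal (v x) = 0" by (subst (asm) nn_integral_0_iff_AE) auto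
    then show ?thesis using pos by (auto simp: ennreal_eq_0_iff elim!: eventually_mono) (smt (verit) pos powr_0)
  qed
  then have "(\<integral>\<^sup>+x. ennreal (u x powr \<alpha> * v x powr \<beta>) \<partial>M) = (\<integral>\<^sup>+x. 0 \<partial>M)"
    by (intro nn_integral_cong_AE) (auto elim!: eventually_mono)
  then show ?thesis by simp
next
  case False
  with AB have A: "A > 0" and B: "B > 0" by auto
  let ?K = "A powr \<alpha> * B powr \<beta>"
  have K: "?K \<ge> 0" by simp
  have "(\<integral>\<^sup>+x. ennreal (u x powr \<alpha> * v x powr \<beta>) \<partial>M)
      \<le> (\<integral>\<^sup>+x. ennreal (?K * \<alpha> / A) * ennreal (u x) + ennreal (?K * \<beta> / B) * ennreal (v x) \<partial>M)"
  proof (intro nn_integral_mono)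
    fix x
    have "u x powr \<alpha> * v x powr \<beta> = ?K * ((u x / A) powr \<alpha> * (v x / B) powr \<beta>)"
      using A B pos by (simp add: powr_divide)
    also have "\<dots> \<le> ?K * (\<alpha> * (u x / A) + \<beta> * (v x / B))"
      using Youngs_inequality_0[of \<alpha> \<beta> "u x / A" "v x / B"] A B pos[of x] ab
      by (cases "u x = 0 \<or> v x = 0") (auto intro!: mult_left_mono simp: less_le)
    also have "\<dots> = (?K * \<alpha> / A) * u x + (?K * \<beta> / B) * v x" by (simp add: algebra_simps)
    finally have "ennreal (u x powr \<alpha> * v x powr \<beta>) \<le> ennreal ((?K * \<alpha> / A) * u x + (?K * \<beta> / B) * v x)"
      by (rule ennreal_leI)
    also have "\<dots> = ennreal (?K * \<alpha> / A) * ennreal (u x) + ennreal (?K * \<beta> / B) * ennreal (v x)"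
      using A B ab pos by (simp add: ennreal_plus[symmetric] ennreal_mult''[symmetric] del: ennreal_plus)
    finally show "ennreal (u x powr \<alpha> * v x powr \<beta>) \<le> ennreal (?K * \<alpha> / A) * ennreal (u x) + ennreal (?K * \<beta> / B) * ennreal (v x)" .
  qed
  also have "\<dots> = ennreal (?K * \<alpha> / A) * (\<integral>\<^sup>+x. ennreal (u x) \<partial>M) + ennreal (?K * \<beta> / B) * (\<integral>\<^sup>+x. ennreal (v x) \<partial>M)"
    by (subst nn_integral_add) (auto simp: nn_integral_cmult)
  also have "\<dots> \<le> ennreal (?K * \<alpha> / A) * ennreal A + ennreal (?K * \<beta> / B) * ennreal B"
    using I by (intro add_mono mult_left_mono) auto
  also have "\<dots> = ennreal (?K * \<alpha> + ?K * \<beta>)"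
    using A B ab by (simp add: ennreal_plus[symmetric] ennreal_mult''[symmetric] del: ennreal_plus)
  also have "?K * \<alpha> + ?K * \<beta> = ?K" using ab by (simp add: distrib_left[symmetric])
  finally show ?thesis .
qed

section \<open>Coverings by balls and the Assouad dimension\<close>

lemma emeasure_ball_powr:
  assumes "0 < r"
  shows "emeasure lborel (ball (x::'a::euclidean_space) r) = ennreal (unit_ball_vol DIM('a) * r powr DIM('a))"
  using assms by (simp add: emeasure_ball powr_realpow)

lemma measure_ball_powr:
  assumes "0 < r"
  shows "measure lborel (ball (x::'a::euclidean_space) r) = unit_ball_vol DIM('a) * r powr DIM('a)"
  using emeasure_ball_powr[OF assms, of x] by (simp add: measure_def)

lemma vitali_finite_cover:
  fixes K :: "'a::euclidean_space set"
  assumes K: "compact K" and r: "\<And>x. x \<in> K \<Longrightarrow> 0 < r x \<and> r x \<le> b"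
  obtains S where "finite S" "S \<subseteq> K" "disjoint_family_on (\<lambda>x. ball x (r x)) S"
    "K \<subseteq> (\<Union>x\<in>S. ball x (5 * r x))"
proof -
  have "K \<subseteq> (\<Union>x\<in>K. ball x (r x))" using r by force
  then obtain C where C: "C \<subseteq> K" "pairwise (\<lambda>i j. disjnt (ball i (r i)) (ball j (r j))) C" "K \<subseteq> (\<Union>i\<in>C. ball i (5 * r i))"
    by (rule Vitali_covering_lemma_balls[where a="\<lambda>x. x" and r=r and B=b]) (use r in auto)
  obtain S where S: "S \<subseteq> C" "finite S" "K \<subseteq> (\<Union>i\<in>S. ball i (5 * r i))"
    using compactE_image[OF K _ C(3)] by auto
  show ?thesis
  proof (rule that[of S])
    show "disjoint_family_on (\<lambda>x. ball x (r x)) S"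
      using C(2) S(1) by (auto simp: disjoint_family_on_def pairwise_def disjnt_def subset_iff)
  qed (use S C in auto)
qed

text \<open>
  A maximal \<open>r\<close>-separated subset of \<open>A\<close> covers \<open>A\<close>, and the disjoint balls of radius \<open>r / 2\<close> around its
  points lie in a ball of radius \<open>3 / 2 * R\<close>; comparing volumes bounds its size.
\<close>
lemma packing_cover:
  fixes A :: "'a::euclidean_space set"
  assumes A: "A \<subseteq> ball x R" and r: "0 < r" "r \<le> R"
  obtains S where "finite S" "S \<subseteq> A" "A \<subseteq> (\<Union>a\<in>S. ball a r)" "real (card S) \<le> (3 * R / r) powr DIM('a)"
proof -
  let ?n = "real DIM('a)" and ?V = "unit_ball_vol (real DIM('a))"
  define P where "P S \<longleftrightarrow> finite S \<and> S \<subseteq> A \<and> (\<forall>a\<in>S. \<forall>b\<in>S. a \<noteq> b \<longrightarrow> r \<le> dist a b)" for S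
  have V: "?V > 0" by simp
  have bound: "real (card S) \<le> (3 * R / r) powr ?n" if "P S" for S
  proof -
    have fin: "finite S" and sep: "\<And>a b. a \<in> S \<Longrightarrow> b \<in> S \<Longrightarrow> a \<noteq> b \<Longrightarrow> r \<le> dist a b" and SA: "S \<subseteq> A"
      using that by (auto simp: P_def)
    have disj: "disjoint_family_on (\<lambda>a. ball a (r/2)) S"
      unfolding disjoint_family_on_def
    proof (intro ballI impI)
      fix a b assume ab: "a \<in> S" "b \<in> S" "a \<noteq> b"
      have "False" if "y \<in> ball a (r/2)" "y \<in> ball b (r/2)" for y
        using sep[OF ab] that dist_triangle_half_r[of y a r b] by (auto simp: dist_commute)
      then show "ball a (r / 2) \<inter> ball b (r / 2) = {}" by auto
    qed
    have "(\<Sum>a\<in>S. emeasure lborel (ball a (r/2))) = emeasure lborel (\<Union>a\<in>S. ball a (r/2))"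
      using disj fin by (intro sum_emeasure) auto
    also have "\<dots> \<le> emeasure lborel (ball x (3/2 * R))"
    proof (rule emeasure_mono)
      show "(\<Union>a\<in>S. ball a (r / 2)) \<subseteq> ball x (3/2 * R)"
      proof
        fix y assume "y \<in> (\<Union>a\<in>S. ball a (r / 2))"
        then obtain a where "a \<in> S" "dist a y < r/2" by auto
        moreover then have "dist x a < R" using SA A by auto
        ultimately show "y \<in> ball x (3/2 * R)" using dist_triangle[of x y a] r by auto
      qed
    qed auto
    finally have "ennreal (real (card S) * (?V * (r/2) powr ?n)) \<le> ennreal (?V * (3/2 * R) powr ?n)"
      using r by (simp add: emeasure_ball_powr ennreal_mult' ennreal_of_nat_eq_real_of_nat)
    then have "real (card S) * (?V * (r/2) powr ?n) \<le> ?V * (3/2 * R) powr ?n"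
      by (subst (asm) ennreal_le_iff) auto
    then have "?V * (real (card S) * (r/2) powr ?n) \<le> ?V * (3/2 * R) powr ?n"
      by (simp only: mult.left_commute)
    then have "real (card S) * (r/2) powr ?n \<le> (3/2 * R) powr ?n"
      using V by (rule mult_left_le_imp_le)
    also have "(3/2 * R) powr ?n = (3 * R / r) powr ?n * (r/2) powr ?n"
      using r by (simp add: powr_mult[symmetric])
    finally show ?thesis using r by simp
  qed
  have P0: "P {}" by (simp add: P_def)
  have card_le: "\<forall>S. P S \<longrightarrow> card S < Suc (nat \<lceil>(3 * R / r) powr ?n\<rceil>)"
  proof (intro allI impI)
    fix S assume "P S"
    then have "real (card S) \<le> real (nat \<lceil>(3 * R / r) powr ?n\<rceil>)"
      using bound real_nat_ceiling_ge order_trans by blast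
    then show "card S < Suc (nat \<lceil>(3 * R / r) powr ?n\<rceil>)" by (simp only: of_nat_le_iff less_Suc_eq_le)
  qed
  obtain S where S: "P S" "\<And>T. P T \<Longrightarrow> card T \<le> card S"
    using Lattices_Big.ex_has_greatest_nat[of P "{}" card, OF P0 card_le] by auto
  have "A \<subseteq> (\<Union>a\<in>S. ball a r)"
  proof
    fix y assume y: "y \<in> A"
    show "y \<in> (\<Union>a\<in>S. ball a r)"
    proof (rule ccontr)
      assume n: "y \<notin> (\<Union>a\<in>S. ball a r)"
      then have "y \<notin> S" using r by auto
      moreover have "P (insert y S)" using S(1) y n by (auto simp: P_def dist_commute not_less)
      ultimately show False using S(2)[of "insert y S"] S(1) by (auto simp: P_def)
    qed
  qed
  then show ?thesis using that[of S] S(1) bound[OF S(1)] by (auto simp: P_def)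
qed

lemma covering_number_cover:
  fixes A :: "'a::euclidean_space set"
  assumes "bounded A" and r: "0 < r"
  obtains S where "finite S" "S \<subseteq> A" "A \<subseteq> (\<Union>a\<in>S. ball a r)" "card S = covering_number A r"
proof -
  obtain x R0 where "A \<subseteq> ball x R0" using assms(1) bounded_subset_ballD by blast
  then have "A \<subseteq> ball x (max r R0)" by auto
  then obtain S where "finite S" "S \<subseteq> A" "A \<subseteq> (\<Union>a\<in>S. ball a r)" "real (card S) \<le> (3 * max r R0 / r) powr DIM('a)"
    using packing_cover[OF _ r, of A x "max r R0"] by auto
  then have "\<exists>k. \<exists>S. finite S \<and> card S = k \<and> S \<subseteq> A \<and> A \<subseteq> (\<Union>a\<in>S. ball a r)" by auto
  from LeastI_ex[OF this] that show ?thesis unfolding covering_number_def by auto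
qed

lemma covering_number_le:
  assumes "finite S" "S \<subseteq> A" "A \<subseteq> (\<Union>a\<in>S. ball a r)"
  shows "covering_number A r \<le> card S"
  unfolding covering_number_def using assms by (intro Least_le) auto

text \<open>
  A real infimum below \<open>t\<close> is witnessed by an exponent below \<open>t\<close> only if the set of exponents is
  nonempty; the packing bound puts the dimension of the space into it.
\<close>
lemma assouad_dim_less_obtains:
  fixes E :: "'a::euclidean_space set"
  assumes "assouad_dim E < t"
  obtains \<nu> C where "0 \<le> \<nu>" "\<nu> < t" "0 < C"
    "\<And>x r R. x \<in> E \<Longrightarrow> 0 < r \<Longrightarrow> r < R \<Longrightarrow> ennreal R < ediameter E \<Longrightarrow>
        real (covering_number (E \<inter> ball x R) r) \<le> C * (r / R) powr (- \<nu>)"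
proof -
  define X where "X = {s::real. 0 \<le> s \<and>
     (\<exists>C>0. \<forall>x\<in>E. \<forall>r R::real. 0 < r \<and> r < R \<and> ennreal R < ediameter E \<longrightarrow>
        real (covering_number (E \<inter> ball x R) r) \<le> C * (r / R) powr (- s))}"
  have "real DIM('a) \<in> X"
    unfolding X_def
  proof (intro CollectI conjI exI[of _ "3 powr real DIM('a)"] ballI allI impI)
    fix x r R assume x: "x \<in> E" and rR: "0 < r \<and> r < R \<and> ennreal R < ediameter E"
    obtain S where S: "finite S" "S \<subseteq> E \<inter> ball x R" "E \<inter> ball x R \<subseteq> (\<Union>a\<in>S. ball a r)" "real (card S) \<le> (3 * R / r) powr DIM('a)"
      using packing_cover[of "E \<inter> ball x R" x R r] rR by auto
    have "(3 * R / r) powr DIM('a) = 3 powr real DIM('a) * (r / R) powr - real DIM('a)"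
      using rR by (simp add: powr_minus powr_mult powr_divide field_simps)
    with S covering_number_le[OF S(1-3)] show "real (covering_number (E \<inter> ball x R) r) \<le> 3 powr real DIM('a) * (r / R) powr - real DIM('a)"
      by linarith
  qed auto
  then have "X \<noteq> {}" by auto
  moreover have "Inf X < t" using assms by (simp add: assouad_dim_def X_def)
  ultimately obtain s where "s \<in> X" "s < t" by (meson cInf_lessD)
  then show ?thesis using that unfolding X_def by blast
qed

lemma dist_le_ediameter: "x \<in> E \<Longrightarrow> y \<in> E \<Longrightarrow> ennreal (dist x y) \<le> ediameter E"
  unfolding ediameter_def by (meson SUP_upper2 order_refl)

text \<open>
  The definition of the Assouad dimension controls scales below the diameter of \<open>E\<close>.  A bounded \<open>E\<close> is
  covered by finitely many balls of half its diameter, and so the same power bound holds at every scale,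
  with a constant that depends on \<open>E\<close>.
\<close>
lemma covering_all_scales:
  fixes E :: "'a::euclidean_space set"
  assumes E: "closed E" and \<nu>: "0 \<le> \<nu>" and C: "0 < C"
    and cov: "\<And>x r R. x \<in> E \<Longrightarrow> 0 < r \<Longrightarrow> r < R \<Longrightarrow> ennreal R < ediameter E \<Longrightarrow>
        real (covering_number (E \<inter> ball x R) r) \<le> C * (r / R) powr (- \<nu>)"
  obtains K where "0 < K" "\<And>x r R. x \<in> E \<Longrightarrow> 0 < r \<Longrightarrow> r \<le> R \<Longrightarrow>
     \<exists>S. finite S \<and> E \<inter> ball x R \<subseteq> (\<Union>a\<in>S. ball a r) \<and> real (card S) \<le> K * (R / r) powr \<nu>"
proof -
  have small: "\<exists>S. finite S \<and> E \<inter> ball x R \<subseteq> (\<Union>a\<in>S. ball a r) \<and> real (card S) \<le> C * (R / r) powr \<nu>"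
    if *: "x \<in> E" "0 < r" "r < R" "ennreal R < ediameter E" for x r R
  proof -
    have b: "bounded (E \<inter> ball x R)" by (simp add: bounded_Int)
    obtain S where "finite S" "E \<inter> ball x R \<subseteq> (\<Union>a\<in>S. ball a r)" "card S = covering_number (E \<inter> ball x R) r"
      using covering_number_cover[OF b *(2)] by metis
    moreover have "(r / R) powr (- \<nu>) = (R / r) powr \<nu>"
      using * by (simp add: powr_minus powr_divide)
    ultimately show ?thesis using cov[OF *] by auto
  qed
  have ge1: "1 \<le> (R / r) powr \<nu>" if "0 < r" "r \<le> R" for r R :: real
    using that \<nu> by (simp add: ge_one_powr_ge_zero)
  show ?thesis
  proof (cases "ediameter E = \<infinity>")
    case True
    show ?thesis
    proof (rule that[of "1 + C"])
      fix x :: 'a and r R :: real assume *: "x \<in> E" "0 < r" "r \<le> R"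
      show "\<exists>S. finite S \<and> E \<inter> ball x R \<subseteq> (\<Union>a\<in>S. ball a r) \<and> real (card S) \<le> (1 + C) * (R / r) powr \<nu>"
      proof (cases "r < R")
        case True
        then obtain S where "finite S" "E \<inter> ball x R \<subseteq> (\<Union>a\<in>S. ball a r)" "real (card S) \<le> C * (R / r) powr \<nu>"
          using small[of x r R] * \<open>ediameter E = \<infinity>\<close> by auto
        then show ?thesis using ge1[OF *(2,3)] by (intro exI[of _ S]) (auto simp: distrib_right)
      next
        case False
        then have "r = R" using * by auto
        then show ?thesis using * C by (intro exI[of _ "{x}"]) auto
      qed
    qed (use C in auto)
  next
    case False
    define D where "D = enn2real (ediameter E)"
    have D: "ediameter E = ennreal D" "0 \<le> D" using False by (auto simp: D_def less_top)
    have dist: "dist x y \<le> D" if "x \<in> E" "y \<in> E" for x y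
      using dist_le_ediameter[OF that] D by simp
    have bE: "bounded E" unfolding bounded_def using dist by blast
    obtain F where F: "finite F" "F \<subseteq> E" "D > 0 \<Longrightarrow> E \<subseteq> (\<Union>a\<in>F. ball a (D/2))"
    proof (cases "D > 0")
      case True
      then show ?thesis using covering_number_cover[OF bE, of "D/2"] that by (metis half_gt_zero)
    qed (use that[of "{}"] in auto)
    (* 1 serves r = R and r > D, C the scales below D, card F the r between D/2 and D, and
       card F * C the covering of E by covers of the pieces in the balls of F. *)
    define K where "K = 1 + C + real (card F) * (1 + C)"
    show ?thesis
    proof (rule that[of K])
      show "K > 0" using C by (simp add: K_def add_pos_nonneg)
      have K1: "K \<ge> 1" "K \<ge> C" "K \<ge> card F * C" "K \<ge> card F" using C by (auto simp: K_def algebra_simps)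
      fix x :: 'a and r R :: real assume *: "x \<in> E" "0 < r" "r \<le> R"
      have g: "1 \<le> (R / r) powr \<nu>" using ge1 * by auto
      have wk: "y \<le> K * (R / r) powr \<nu>" if "y \<le> c * (R / r) powr \<nu>" "c \<le> K" for y c
        using that mult_right_mono[OF that(2), of "(R / r) powr \<nu>"] by simp
      have wk1: "y \<le> K * (R / r) powr \<nu>" if "0 \<le> y" "y \<le> K" for y
        using that g mult_mono[of y K 1 "(R / r) powr \<nu>"] by simp
      consider "r > D" | "r \<le> D" "r \<ge> D/2" | "r < D/2" "r = R" | "r < D/2" "r < R" "R < D" | "r < D/2" "R \<ge> D"
        using * by linarith
      then show "\<exists>S. finite S \<and> E \<inter> ball x R \<subseteq> (\<Union>a\<in>S. ball a r) \<and> real (card S) \<le> K * (R / r) powr \<nu>"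
      proof cases
        case 1
        have "E \<subseteq> ball x r" using dist[OF *(1)] 1 by force
        then show ?thesis using wk1[of 1] K1 by (intro exI[of _ "{x}"]) auto
      next
        case 2
        with * have "D > 0" by linarith
        then have "E \<subseteq> (\<Union>a\<in>F. ball a (D/2))" by (rule F(3))
        also have "\<dots> \<subseteq> (\<Union>a\<in>F. ball a r)" using 2 by (intro UN_mono subset_ball) auto
        finally have "E \<subseteq> (\<Union>a\<in>F. ball a r)" .
        then show ?thesis using F(1) wk1[of "card F"] K1 by (intro exI[of _ F]) auto
      next
        case 3
        then show ?thesis using wk1[of 1] K1 by (intro exI[of _ "{x}"]) auto
      next
        case 4
        then have "ennreal R < ediameter E" using D * by (simp add: ennreal_lessI)
        then obtain S where "finite S" "E \<inter> ball x R \<subseteq> (\<Union>a\<in>S. ball a r)" "real (card S) \<le> C * (R / r) powr \<nu>"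
          using small[of x r R] * 4 by auto
        then show ?thesis using wk[OF _ K1(2)] by (intro exI[of _ S]) auto
      next
        case 5
        have Dp: "D > 0" using 5 * by linarith
        have "\<exists>S. finite S \<and> E \<inter> ball a (D/2) \<subseteq> (\<Union>b\<in>S. ball b r) \<and> real (card S) \<le> C * (D/2 / r) powr \<nu>" if "a \<in> F" for a
          using small[of a r "D/2"] that F(2) 5 * D Dp by (auto simp: ennreal_lessI)
        then obtain S where S: "\<And>a. a \<in> F \<Longrightarrow> finite (S a) \<and> E \<inter> ball a (D/2) \<subseteq> (\<Union>b\<in>S a. ball b r) \<and> real (card (S a)) \<le> C * (D/2 / r) powr \<nu>"
          by metis
        have "real (card (\<Union>a\<in>F. S a)) \<le> (\<Sum>a\<in>F. real (card (S a)))"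
          using card_UN_le[OF F(1), of S] by (metis of_nat_le_iff of_nat_sum)
        also have "\<dots> \<le> (\<Sum>a\<in>F. C * (D/2 / r) powr \<nu>)" using S by (intro sum_mono) auto
        also have "\<dots> = (card F * C) * (D/2 / r) powr \<nu>" by simp
        also have "\<dots> \<le> (card F * C) * (R / r) powr \<nu>"
          using 5 * C \<nu> Dp by (intro mult_left_mono powr_mono2 divide_right_mono) auto
        finally have "real (card (\<Union>a\<in>F. S a)) \<le> K * (R / r) powr \<nu>" by (rule wk[OF _ K1(3)])
        moreover have "E \<inter> ball x R \<subseteq> (\<Union>b\<in>(\<Union>a\<in>F. S a). ball b r)"
          using F(3)[OF Dp] S by blast
        ultimately show ?thesis using S F(1) by (intro exI[of _ "\<Union>a\<in>F. S a"]) auto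
      qed
    qed
  qed
qed

text \<open>
  Doubling the radius of the balls of a cover of \<open>E\<close> by balls of radius \<open>r\<close> covers the
  \<open>r\<close>-neighbourhood of \<open>E\<close>.  In contrast to the covering numbers, the centre \<open>x\<close> may be any point of
  the space.
\<close>
lemma assouad_neighbourhood_volume:
  fixes E :: "'a::euclidean_space set"
  assumes E: "closed E" "E \<noteq> {}" and dim: "assouad_dim E < t"
  obtains \<nu> C :: real where "0 \<le> \<nu>" "\<nu> < t" "0 < C"
    "\<And>x r R. 0 < r \<Longrightarrow> r \<le> R \<Longrightarrow> emeasure lborel {y \<in> ball x R. infdist y E < r}
       \<le> ennreal (C * r powr (real DIM('a) - \<nu>) * R powr \<nu>)"
proof -
  obtain \<nu> C where \<nu>: "0 \<le> \<nu>" "\<nu> < t" and C: "0 < C" and cov: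
    "\<And>x r R. x \<in> E \<Longrightarrow> 0 < r \<Longrightarrow> r < R \<Longrightarrow> ennreal R < ediameter E \<Longrightarrow>
        real (covering_number (E \<inter> ball x R) r) \<le> C * (r / R) powr (- \<nu>)"
    using assouad_dim_less_obtains[OF dim] by metis
  obtain K where K: "0 < K" "\<And>x r R. x \<in> E \<Longrightarrow> 0 < r \<Longrightarrow> r \<le> R \<Longrightarrow>
     \<exists>S. finite S \<and> E \<inter> ball x R \<subseteq> (\<Union>a\<in>S. ball a r) \<and> real (card S) \<le> K * (R / r) powr \<nu>"
    using covering_all_scales[OF E(1) \<nu>(1) C cov] by blast
  let ?n = "real DIM('a)" and ?V = "unit_ball_vol (real DIM('a))"
  define C' where "C' = K * 4 powr \<nu> * ?V * 2 powr ?n"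
  show ?thesis
  proof (rule that[of \<nu> C'])
    show "C' > 0" using K by (simp add: C'_def)
    fix x :: 'a and r R :: real assume r: "0 < r" "r \<le> R"
    show "emeasure lborel {y \<in> ball x R. infdist y E < r} \<le> ennreal (C' * r powr (?n - \<nu>) * R powr \<nu>)"
    proof (cases "E \<inter> ball x (2*R) = {}")
      case True
      have "{y \<in> ball x R. infdist y E < r} = {}"
      proof (rule ccontr)
        assume "\<not> ?thesis"
        then obtain y where y: "dist x y < R" "infdist y E < r" by auto
        obtain e where "e \<in> E" "infdist y E = dist y e" using infdist_attains_inf[OF E] by blast
        then show False using True y r dist_triangle[of x e y] by (auto simp: set_eq_iff)
      qed
      then show ?thesis by (simp only: emeasure_empty zero_le)
    next
      case False
      then obtain e where e: "e \<in> E" "dist x e < 2 * R" by auto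
      obtain S where S: "finite S" "E \<inter> ball e (4*R) \<subseteq> (\<Union>a\<in>S. ball a r)" "real (card S) \<le> K * (4 * R / r) powr \<nu>"
        using K(2)[of e r "4*R"] e r by auto
      have "{y \<in> ball x R. infdist y E < r} \<subseteq> (\<Union>a\<in>S. ball a (2*r))"
      proof
        fix y assume "y \<in> {y \<in> ball x R. infdist y E < r}"
        then have y: "dist x y < R" "infdist y E < r" by auto
        obtain z where z: "z \<in> E" "infdist y E = dist y z" using infdist_attains_inf[OF E] by blast
        have "dist e z < 4 * R"
          using dist_triangle[of e z x] dist_triangle[of x z y] y z e r by (simp add: dist_commute)
        then obtain a where "a \<in> S" "dist a z < r" using z S(2) by auto
        then show "y \<in> (\<Union>a\<in>S. ball a (2*r))" using z y dist_triangle[of a y z] by (force simp: dist_commute)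
      qed
      then have "emeasure lborel {y \<in> ball x R. infdist y E < r} \<le> emeasure lborel (\<Union>a\<in>S. ball a (2*r))"
        by (intro emeasure_mono) (auto intro!: borel_open)
      also have "\<dots> \<le> (\<Sum>a\<in>S. emeasure lborel (ball a (2*r)))"
        by (intro emeasure_subadditive_finite) (use S in auto)
      also have "\<dots> = ennreal (real (card S) * (?V * (2*r) powr ?n))"
        using r by (simp add: emeasure_ball_powr ennreal_mult' ennreal_of_nat_eq_real_of_nat)
      also have "\<dots> \<le> ennreal (K * (4 * R / r) powr \<nu> * (?V * (2*r) powr ?n))"
        using S(3) by (intro ennreal_leI mult_right_mono) auto
      also have "K * (4 * R / r) powr \<nu> * (?V * (2*r) powr ?n) = C' * r powr (?n - \<nu>) * R powr \<nu>"
        using r by (simp add: C'_def powr_mult powr_divide powr_diff)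
      finally show ?thesis .
    qed
  qed (use \<nu> in auto)
qed

section \<open>Powers of the distance function\<close>

text \<open>
  If a bounded piece of \<open>E\<close> had positive measure, it would almost fill some open set \<open>U\<close>.  Small disjoint
  balls in \<open>U\<close> chosen by the Vitali lemma would carry a fixed part of the measure of the piece, while
  their holes, of proportional size, would have to fit into the small rest of \<open>U\<close>.
\<close>
lemma porous_closed_null:
  fixes E :: "'a::euclidean_space set"
  assumes E: "closed E" and por: "porous E"
  shows "emeasure lborel E = 0"
proof (cases "\<exists>x\<in>E. \<exists>y\<in>E. x \<noteq> y")
  case False
  then have "E = {} \<or> (\<exists>x. E = {x})" by blast
  then show ?thesis by auto
next
  case True
  let ?n = "real DIM('a)"
  from True obtain x0 y0 where xy: "x0 \<in> E" "y0 \<in> E" "x0 \<noteq> y0" by auto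
  define D where "D = min 1 (dist x0 y0 / 2)"
  have D: "0 < D" "D \<le> 1" "ennreal D < ediameter E"
  proof -
    show "0 < D" "D \<le> 1" using xy by (auto simp: D_def)
    have "ennreal D < ennreal (dist x0 y0)" using xy zero_less_dist_iff[of x0 y0] by (intro ennreal_lessI) (auto simp: D_def min_less_iff_disj)
    also have "\<dots> \<le> ediameter E" by (rule dist_le_ediameter[OF xy(1,2)])
    finally show "ennreal D < ediameter E" .
  qed
  obtain c where c: "0 < c" "c < 1" and hole: "\<And>x r. x \<in> E \<Longrightarrow> 0 < r \<Longrightarrow> ennreal r < ediameter E \<Longrightarrow> \<exists>y. ball y (c * r) \<subseteq> ball x r - E"
    using por unfolding porous_def by blast
  have null: "emeasure lborel (E \<inter> cball 0 k) = 0" for k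
  proof (rule ccontr)
    let ?K = "E \<inter> cball 0 k"
    assume nz: "emeasure lborel ?K \<noteq> 0"
    have K: "compact ?K" using E by (simp add: closed_Int_compact)
    have Ks[measurable]: "?K \<in> sets borel" using K by (simp add: borel_compact)
    have fin: "emeasure lborel ?K < \<infinity>" using K by (intro emeasure_bounded_finite compact_imp_bounded)
    define m where "m = measure lborel ?K"
    have m: "emeasure lborel ?K = ennreal m" "m > 0"
    proof -
      show 1: "emeasure lborel ?K = ennreal m" unfolding m_def using fin by (intro emeasure_eq_ennreal_measure) auto
      show "m > 0" using nz 1 by (metis ennreal_eq_0_iff not_less)
    qed
    (* The balls enlarged five times cover the piece of measure m, so the holes have total measure
       at least (c/5)^n * m. *)
    define \<epsilon> where "\<epsilon> = (c/5) powr ?n * m"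
    have \<epsilon>: "\<epsilon> > 0" using c m by (simp add: \<epsilon>_def)
    have "?K \<in> sets lebesgue" using Ks by simp
    then obtain U where U: "open U" "?K \<subseteq> U" "emeasure lebesgue (U - ?K) < ennreal \<epsilon>"
      using sets_lebesgue_outer_open[OF _ \<epsilon>] by metis
    have Us[measurable]: "U \<in> sets borel" using U by simp
    have UK: "emeasure lborel (U - ?K) < ennreal \<epsilon>" using U(3) by simp
    have "\<exists>r. 0 < r \<and> r \<le> D \<and> ball x r \<subseteq> U" if "x \<in> ?K" for x
    proof -
      have "x \<in> U" using that U(2) by auto
      then obtain e where "e > 0" "ball x e \<subseteq> U" using U(1) openE by blast
      then show ?thesis using D by (intro exI[of _ "min e D"]) auto
    qed
    then obtain \<rho> where \<rho>: "\<And>x. x \<in> ?K \<Longrightarrow> 0 < \<rho> x \<and> \<rho> x \<le> D \<and> ball x (\<rho> x) \<subseteq> U" by metis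
    obtain S where S: "finite S" "S \<subseteq> ?K" "disjoint_family_on (\<lambda>x. ball x (\<rho> x)) S"
      "?K \<subseteq> (\<Union>x\<in>S. ball x (5 * \<rho> x))"
      using vitali_finite_cover[OF K, of \<rho> D] \<rho> by blast
    have "\<exists>y. ball y (c * \<rho> x) \<subseteq> ball x (\<rho> x) - E" if "x \<in> S" for x
    proof -
      have "x \<in> ?K" using that S by auto
      moreover have "ennreal (\<rho> x) < ediameter E" using \<rho>[OF \<open>x \<in> ?K\<close>] D by (meson ennreal_leI le_less_trans)
      ultimately show ?thesis using hole[of x "\<rho> x"] \<rho>[of x] by auto
    qed
    then obtain y where y: "\<And>x. x \<in> S \<Longrightarrow> ball (y x) (c * \<rho> x) \<subseteq> ball x (\<rho> x) - E" by metis
    have \<rho>S: "\<rho> x > 0" "ball x (\<rho> x) \<subseteq> U" if "x \<in> S" for x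
      using \<rho>[OF subsetD[OF S(2) that]] by auto
    have "emeasure lborel ?K \<le> emeasure lborel (\<Union>x\<in>S. ball x (5 * \<rho> x))"
      using S by (intro emeasure_mono) (auto intro!: borel_open)
    also have "\<dots> \<le> (\<Sum>x\<in>S. emeasure lborel (ball x (5 * \<rho> x)))"
      by (intro emeasure_subadditive_finite) (use S in auto)
    also have "\<dots> = (\<Sum>x\<in>S. ennreal ((5/c) powr ?n) * emeasure lborel (ball (y x) (c * \<rho> x)))"
    proof (rule sum.cong[OF refl])
      fix x assume x: "x \<in> S"
      have "(5 * \<rho> x) powr ?n = (5/c) powr ?n * (c * \<rho> x) powr ?n"
        using c \<rho>S[OF x] by (simp add: powr_mult[symmetric])
      then show "emeasure lborel (ball x (5 * \<rho> x)) = ennreal ((5/c) powr ?n) * emeasure lborel (ball (y x) (c * \<rho> x))"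
        using c \<rho>S[OF x] by (simp add: emeasure_ball_powr ennreal_mult[symmetric] mult.left_commute)
    qed
    also have "\<dots> = ennreal ((5/c) powr ?n) * emeasure lborel (\<Union>x\<in>S. ball (y x) (c * \<rho> x))"
    proof -
      have "disjoint_family_on (\<lambda>x. ball (y x) (c * \<rho> x)) S"
        using S(3) y unfolding disjoint_family_on_def by blast
      then show ?thesis using S(1) by (subst sum_emeasure[symmetric]) (auto simp: sum_distrib_left)
    qed
    also have "\<dots> \<le> ennreal ((5/c) powr ?n) * emeasure lborel (U - ?K)"
    proof (intro mult_left_mono emeasure_mono)
      show "(\<Union>x\<in>S. ball (y x) (c * \<rho> x)) \<subseteq> U - ?K" using y \<rho>S by blast
    qed auto
    also have "\<dots> < ennreal ((5/c) powr ?n) * ennreal \<epsilon>"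
      using UK c by (intro ennreal_mult_strict_left_mono) auto
    also have "\<dots> = ennreal m"
      using c m by (simp add: ennreal_mult''[symmetric] \<epsilon>_def powr_divide)
    finally show False using m by simp
  qed
  have "E = (\<Union>k. E \<inter> cball 0 (real k))"
    using real_arch_simple by (auto simp: mem_cball)
  moreover have "(\<Union>k. E \<inter> cball 0 (real k)) \<in> null_sets lborel"
    using null E by (intro null_sets_UN) (auto simp: null_sets_def)
  ultimately show ?thesis by (metis null_setsD1)
qed

text \<open>
  On the ball \<open>\<delta>\<close> is at most \<open>3 * R\<close>.  The layer where \<open>\<delta>\<close> is comparable to \<open>\<rho> = 3 * R / 2 ^ j\<close>
  contributes at most a multiple of \<open>\<rho> powr (Q - n) * \<rho> powr (n - \<nu>) * R powr \<nu>\<close>, which is a geometric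
  sequence in \<open>j\<close> because \<open>Q > \<nu>\<close>.
\<close>
lemma distance_weight_ball:
  fixes E :: "'a::euclidean_space set"
  assumes \<nu>: "\<nu> < Q" and C: "0 < C"
    and vol: "\<And>x r R. 0 < r \<Longrightarrow> r \<le> R \<Longrightarrow> emeasure lborel {y \<in> ball x R. infdist y E < r}
       \<le> ennreal (C * r powr (real DIM('a) - \<nu>) * R powr \<nu>)"
  obtains K where "0 < K" "\<And>x R. 0 < R \<Longrightarrow> infdist x E \<le> 2 * R \<Longrightarrow>
     (\<integral>\<^sup>+y. ennreal (infdist y E powr (Q - real DIM('a))) * indicator (ball x R) y \<partial>lborel) \<le> ennreal (K * R powr Q)"
proof -
  let ?n = "real DIM('a)"
  (* The oscillation of \<delta> powr (Q - n) on a dyadic layer, for either sign of Q - n. *)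
  define M where "M = max 1 (2 powr (?n - Q))"
  define \<theta> where "\<theta> = (1/2::real) powr (Q - \<nu>)"
  have \<theta>: "0 < \<theta>" "\<theta> < 1" using \<nu> powr_less_mono2[of "Q - \<nu>" "1/2" 1] by (auto simp: \<theta>_def)
  define K0 where "K0 = M * 3 powr (Q - ?n) * C * 6 powr ?n"
  define K where "K = K0 / (1 - \<theta>)"
  have [measurable]: "(\<lambda>y. infdist y E) \<in> borel_measurable borel"
    by (intro borel_measurable_continuous_onI continuous_intros)
  have M: "M \<ge> 1" by (simp add: M_def)
  have K0: "K0 > 0" using M C by (simp add: K0_def)
  show ?thesis
  proof (rule that[of K])
    show "0 < K" using K0 \<theta> by (simp add: K_def)
    fix x :: 'a and R :: real
    assume R: "0 < R" and x: "infdist x E \<le> 2 * R"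
    define \<rho> where "\<rho> j = 3 * R * (1/2) ^ j" for j :: nat
    have \<rho>: "\<rho> j > 0" "2 * \<rho> j \<le> 6 * R" for j
      using R power_le_one[of "1/2::real" j] by (auto simp: \<rho>_def)
    define A where "A j = {y \<in> ball x (6 * R). infdist y E < 2 * \<rho> j}" for j
    have [measurable]: "A j \<in> sets borel" for j
      unfolding A_def by measurable
    (* On E itself the weight is 0 by the convention for powr, so only positive distances have to be
       assigned to a layer. *)
    have pt: "ennreal (infdist y E powr (Q - ?n)) * indicator (ball x R) y \<le> (\<Sum>j. ennreal (M * \<rho> j powr (Q - ?n)) * indicator (A j) y)" for y
    proof (cases "y \<in> ball x R \<and> infdist y E > 0")
      case False
      then have "infdist y E powr (Q - ?n) * indicator (ball x R) y = 0"
        using infdist_nonneg[of y E] by auto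
      then show ?thesis using False infdist_nonneg[of y E] by (auto simp: indicator_def)
    next
      case True
      define d where "d = infdist y E"
      have d: "0 < d" "d \<le> 3 * R"
        using True x infdist_triangle[of y E x] by (auto simp: d_def dist_commute)
      have "\<exists>j. \<rho> (Suc j) < d"
      proof -
        obtain j where "(1/2::real) ^ j < d / (3 * R)" using real_arch_pow_inv[of "d / (3*R)" "1/2"] d R by auto
        then have "\<rho> j < d" using R by (simp add: \<rho>_def field_simps)
        moreover have "\<rho> (Suc j) \<le> \<rho> j" using R by (simp add: \<rho>_def)
        ultimately show ?thesis by (intro exI[of _ j]) linarith
      qed
      define j where "j = (LEAST j. \<rho> (Suc j) < d)"
      have j1: "\<rho> (Suc j) < d" unfolding j_def using \<open>\<exists>j. \<rho> (Suc j) < d\<close> by (rule LeastI_ex)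
      have j2: "d \<le> \<rho> j"
      proof (cases j)
        case 0 then show ?thesis using d by (simp add: \<rho>_def)
      next
        case (Suc i)
        then have "\<not> \<rho> (Suc i) < d" using not_less_Least[of i "\<lambda>j. \<rho> (Suc j) < d"] by (simp add: j_def)
        then show ?thesis using Suc by simp
      qed
      have half: "\<rho> j / 2 \<le> d" using j1 by (simp add: \<rho>_def)
      have "d powr (Q - ?n) \<le> M * \<rho> j powr (Q - ?n)"
      proof (cases "Q - ?n \<ge> 0")
        case True
        then have "d powr (Q - ?n) \<le> 1 * \<rho> j powr (Q - ?n)" using d j2 by (simp add: powr_mono2)
        also have "\<dots> \<le> M * \<rho> j powr (Q - ?n)" using M by (intro mult_right_mono) auto
        finally show ?thesis .
      next
        case False
        then have "d powr (Q - ?n) \<le> (\<rho> j / 2) powr (Q - ?n)" using half \<rho>[of j] by (intro powr_mono2') auto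
        also have "\<dots> = 2 powr (?n - Q) * \<rho> j powr (Q - ?n)"
          using \<rho>[of j] by (simp add: powr_divide powr_diff)
        also have "\<dots> \<le> M * \<rho> j powr (Q - ?n)" by (intro mult_right_mono) (auto simp: M_def)
        finally show ?thesis .
      qed
      moreover have "y \<in> A j" using True j2 d R by (auto simp: A_def d_def)
      ultimately have "ennreal (infdist y E powr (Q - ?n)) * indicator (ball x R) y \<le> ennreal (M * \<rho> j powr (Q - ?n)) * indicator (A j) y"
        using True by (simp add: d_def ennreal_leI)
      also have "\<dots> \<le> (\<Sum>j. ennreal (M * \<rho> j powr (Q - ?n)) * indicator (A j) y)"
      proof -
        define g where "g = (\<lambda>j. ennreal (M * \<rho> j powr (Q - ?n)) * indicator (A j) y)"
        have "g j = sum g {j}" by simp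
        also have "\<dots> \<le> suminf g" by (intro sum_le_suminf) auto
        finally show ?thesis by (simp add: g_def)
      qed
      finally show ?thesis .
    qed
    have layer: "ennreal (M * \<rho> j powr (Q - ?n)) * emeasure lborel (A j) \<le> ennreal (K0 * R powr Q * \<theta> ^ j)" for j
    proof -
      have "ennreal (M * \<rho> j powr (Q - ?n)) * emeasure lborel (A j)
          \<le> ennreal (M * \<rho> j powr (Q - ?n)) * ennreal (C * (2 * \<rho> j) powr (?n - \<nu>) * (6 * R) powr \<nu>)"
        unfolding A_def using \<rho>[of j] by (intro mult_left_mono vol) auto
      also have "\<dots> = ennreal (M * \<rho> j powr (Q - ?n) * (C * (2 * \<rho> j) powr (?n - \<nu>) * (6 * R) powr \<nu>))"
        using M C by (intro ennreal_mult[symmetric]) auto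
      also have "M * \<rho> j powr (Q - ?n) * (C * (2 * \<rho> j) powr (?n - \<nu>) * (6 * R) powr \<nu>) = K0 * R powr Q * \<theta> ^ j"
      proof -
        define h where "h = (1/2::real) ^ j"
        have h: "h > 0" by (simp add: h_def)
        have h\<theta>: "\<theta> ^ j = h powr (Q - \<nu>)"
          unfolding \<theta>_def h_def by (simp add: powr_realpow[symmetric] powr_powr mult.commute)
        have "\<rho> j = 3 * R * h" by (simp add: \<rho>_def h_def)
        then show ?thesis unfolding h\<theta> K0_def using R h
          by (simp add: powr_mult powr_diff field_simps)
      qed
      finally show ?thesis .
    qed
    have "(\<integral>\<^sup>+y. ennreal (infdist y E powr (Q - ?n)) * indicator (ball x R) y \<partial>lborel)
       \<le> (\<integral>\<^sup>+y. (\<Sum>j. ennreal (M * \<rho> j powr (Q - ?n)) * indicator (A j) y) \<partial>lborel)"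
      by (intro nn_integral_mono pt)
    also have "\<dots> = (\<Sum>j. \<integral>\<^sup>+y. ennreal (M * \<rho> j powr (Q - ?n)) * indicator (A j) y \<partial>lborel)"
      by (intro nn_integral_suminf) auto
    also have "\<dots> = (\<Sum>j. ennreal (M * \<rho> j powr (Q - ?n)) * emeasure lborel (A j))"
      by (simp add: nn_integral_cmult_indicator)
    also have "\<dots> \<le> (\<Sum>j. ennreal (K0 * R powr Q * \<theta> ^ j))"
      by (intro suminf_le layer) auto
    also have "\<dots> = ennreal (\<Sum>j. K0 * R powr Q * \<theta> ^ j)"
      using K0 \<theta> by (intro suminf_ennreal2) (auto intro: summable_mult summable_geometric)
    also have "(\<Sum>j. K0 * R powr Q * \<theta> ^ j) = K * R powr Q"
      using \<theta> by (simp add: suminf_mult suminf_geometric K_def)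
    finally show "(\<integral>\<^sup>+y. ennreal (infdist y E powr (Q - ?n)) * indicator (ball x R) y \<partial>lborel) \<le> ennreal (K * R powr Q)" .
  qed
qed

lemma powr_comparable:
  fixes y d :: real
  assumes "0 < d" "d / 2 \<le> y" "y \<le> 2 * d"
  shows "y powr a \<le> 2 powr \<bar>a\<bar> * d powr a" "d powr a \<le> 2 powr \<bar>a\<bar> * y powr a"
proof -
  have gen: "u powr a \<le> 2 powr \<bar>a\<bar> * v powr a" if "0 < u" "0 < v" "u \<le> 2 * v" "v \<le> 2 * u" for u v :: real
  proof (cases "a \<ge> 0")
    case True
    then have "u powr a \<le> (2 * v) powr a" using that by (intro powr_mono2) auto
    then show ?thesis using True that by (simp add: powr_mult)
  next
    case False
    then have "u powr a \<le> (v / 2) powr a" using that by (intro powr_mono2') auto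
    then show ?thesis using False that by (simp add: powr_divide powr_minus divide_simps)
  qed
  show "y powr a \<le> 2 powr \<bar>a\<bar> * d powr a" "d powr a \<le> 2 powr \<bar>a\<bar> * y powr a"
    using assms by (intro gen; linarith)+
qed

lemma infdist_ball_bounds:
  assumes "y \<in> ball x r"
  shows "infdist y E \<le> infdist x E + r" "infdist x E - r \<le> infdist y E"
  using assms infdist_triangle[of y E x] infdist_triangle[of x E y] by (auto simp: dist_commute)

section \<open>Densities that are large on every segment between two sets\<close>

lemma nn_integral_lborel_affine:
  fixes f :: "'a::euclidean_space \<Rightarrow> ennreal"
  assumes [measurable]: "f \<in> borel_measurable borel" and c: "c \<noteq> 0"
  shows "(\<integral>\<^sup>+x. f x \<partial>lborel) = ennreal (\<bar>c\<bar> ^ DIM('a)) * (\<integral>\<^sup>+x. f (t + c *\<^sub>R x) \<partial>lborel)"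
  by (subst lborel_affine[OF c, of t])
     (simp add: nn_integral_density nn_integral_distr nn_integral_cmult)

text \<open>
  The contraction towards \<open>a\<close> by the factor \<open>\<tau>\<close> maps the convex ball into itself and has Jacobian
  \<open>\<tau> ^ n \<ge> 2 ^ (- n)\<close>.
\<close>
lemma nn_integral_contract_to_point:
  fixes G :: "'a::euclidean_space \<Rightarrow> ennreal"
  assumes [measurable]: "G \<in> borel_measurable borel" and a: "a \<in> ball x r" and \<tau>: "\<tau> \<in> {1/2..1}"
  shows "(\<integral>\<^sup>+d. G (a + \<tau> *\<^sub>R (d - a)) * indicator (ball x r) d \<partial>lborel)
      \<le> 2 ^ DIM('a) * (\<integral>\<^sup>+y. G y * indicator (ball x r) y \<partial>lborel)"
proof -
  have \<tau>0: "\<tau> \<noteq> 0" using \<tau> by auto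
  have [measurable]: "ball x r \<in> sets borel" by simp
  let ?t = "a - \<tau> *\<^sub>R a"
  have "(\<integral>\<^sup>+d. G (a + \<tau> *\<^sub>R (d - a)) * indicator (ball x r) d \<partial>lborel)
      \<le> (\<integral>\<^sup>+d. G (?t + \<tau> *\<^sub>R d) * indicator (ball x r) (?t + \<tau> *\<^sub>R d) \<partial>lborel)"
  proof (intro nn_integral_mono)
    fix d
    have *: "a + \<tau> *\<^sub>R (d - a) = ?t + \<tau> *\<^sub>R d" by (simp add: algebra_simps)
    have "?t + \<tau> *\<^sub>R d \<in> ball x r" if "d \<in> ball x r"
    proof -
      have "(1 - \<tau>) *\<^sub>R a + \<tau> *\<^sub>R d \<in> ball x r"
        using convexD[OF convex_ball[of x r] a that, of "1 - \<tau>" \<tau>] \<tau> by auto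
      then show ?thesis by (simp add: algebra_simps)
    qed
    then show "G (a + \<tau> *\<^sub>R (d - a)) * indicator (ball x r) d \<le> G (?t + \<tau> *\<^sub>R d) * indicator (ball x r) (?t + \<tau> *\<^sub>R d)"
      unfolding * by (auto simp: indicator_def)
  qed
  also have "\<dots> \<le> 2 ^ DIM('a) * (ennreal (\<bar>\<tau>\<bar> ^ DIM('a)) * (\<integral>\<^sup>+d. G (?t + \<tau> *\<^sub>R d) * indicator (ball x r) (?t + \<tau> *\<^sub>R d) \<partial>lborel))"
  proof -
    have "1 \<le> (2 * \<tau>) ^ DIM('a)" using \<tau> by (intro one_le_power) auto
    then have "1 \<le> ennreal (2 ^ DIM('a) * \<bar>\<tau>\<bar> ^ DIM('a))" using \<tau> by (simp add: power_mult_distrib)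
    also have "\<dots> = 2 ^ DIM('a) * ennreal (\<bar>\<tau>\<bar> ^ DIM('a))" by (subst ennreal_mult) (auto simp: ennreal_power[symmetric])
    finally have 1: "1 \<le> 2 ^ DIM('a) * ennreal (\<bar>\<tau>\<bar> ^ DIM('a))" .
    show ?thesis using mult_right_mono[OF 1, of "(\<integral>\<^sup>+d. G (?t + \<tau> *\<^sub>R d) * indicator (ball x r) (?t + \<tau> *\<^sub>R d) \<partial>lborel)"]
      by (simp add: mult.assoc)
  qed
  also have "ennreal (\<bar>\<tau>\<bar> ^ DIM('a)) * (\<integral>\<^sup>+d. G (?t + \<tau> *\<^sub>R d) * indicator (ball x r) (?t + \<tau> *\<^sub>R d) \<partial>lborel)
    = (\<integral>\<^sup>+y. G y * indicator (ball x r) y \<partial>lborel)"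
    by (rule nn_integral_lborel_affine[symmetric, where f="\<lambda>y. G y * indicator (ball x r) y", OF _ \<tau>0]) simp
  finally show ?thesis .
qed

text \<open>
  A Poincare inequality of exponent 1 for a pair of sets: integrate the assumption over all \<open>a \<in> A\<close> and
  \<open>d \<in> D\<close>.  On the half of the segment near \<open>d\<close> the point \<open>a\<close> is kept fixed and the integral over \<open>d\<close> is
  transformed by \<open>nn_integral_contract_to_point\<close>; the other half is symmetric.  The density
  \<open>G\<close> may jump, and those used below do: they are cut off at the boundary of a layer of \<open>f\<close> or of a
  neighbourhood of \<open>E\<close>.
\<close>
lemma two_set_poincare:
  fixes G :: "'a::euclidean_space \<Rightarrow> ennreal"
  assumes [measurable]: "G \<in> borel_measurable borel" "A \<in> sets borel" "D \<in> sets borel"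
    and AD: "A \<subseteq> ball x r" "D \<subseteq> ball x r" and r: "r > 0"
    and seg: "\<And>a d. a \<in> A \<Longrightarrow> d \<in> D \<Longrightarrow>
        1 \<le> ennreal (dist a d) * (\<integral>\<^sup>+\<tau>. G (a + \<tau> *\<^sub>R (d - a)) * indicator {0..1} \<tau> \<partial>lborel)"
  shows "emeasure lborel A * emeasure lborel D
    \<le> ennreal (4 * r * 2 ^ DIM('a)) * emeasure lborel (ball x r) * (\<integral>\<^sup>+y. G y * indicator (ball x r) y \<partial>lborel)"
proof -
  let ?B = "ball x r"
  have [measurable]: "?B \<in> sets borel" by simp
  define I where "I = (\<integral>\<^sup>+y. G y * indicator ?B y \<partial>lborel)"
  define N :: ennreal where "N = 2 ^ DIM('a)"
  have half1: "(\<integral>\<^sup>+a. \<integral>\<^sup>+d. (\<integral>\<^sup>+\<tau>. G (a + \<tau> *\<^sub>R (d - a)) * indicator {1/2..1} \<tau> * indicator ?B d * indicator ?B a \<partial>lborel) \<partial>lborel \<partial>lborel)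
     \<le> N * I * emeasure lborel ?B"
  proof -
    have "(\<integral>\<^sup>+d. (\<integral>\<^sup>+\<tau>. G (a + \<tau> *\<^sub>R (d - a)) * indicator {1/2..1} \<tau> * indicator ?B d * indicator ?B a \<partial>lborel) \<partial>lborel)
       \<le> N * I * indicator ?B a" for a
    proof (cases "a \<in> ?B")
      case True
      have "(\<integral>\<^sup>+d. (\<integral>\<^sup>+\<tau>. G (a + \<tau> *\<^sub>R (d - a)) * indicator {1/2..1} \<tau> * indicator ?B d * indicator ?B a \<partial>lborel) \<partial>lborel)
          = (\<integral>\<^sup>+\<tau>. (\<integral>\<^sup>+d. G (a + \<tau> *\<^sub>R (d - a)) * indicator {1/2..1} \<tau> * indicator ?B d * indicator ?B a \<partial>lborel) \<partial>lborel)"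
        by (intro lborel_pair.Fubini') measurable
      also have "\<dots> \<le> (\<integral>\<^sup>+\<tau>. N * I * indicator {0..1::real} \<tau> \<partial>lborel)"
      proof (intro nn_integral_mono)
        fix \<tau> :: real
        show "(\<integral>\<^sup>+d. G (a + \<tau> *\<^sub>R (d - a)) * indicator {1/2..1} \<tau> * indicator ?B d * indicator ?B a \<partial>lborel) \<le> N * I * indicator {0..1::real} \<tau>"
          using nn_integral_contract_to_point[of G a x r \<tau>] True by (auto simp: indicator_def N_def I_def)
      qed
      also have "\<dots> = N * I" by (simp add: nn_integral_cmult_indicator)
      finally show ?thesis using True by simp
    qed simp
    then have "(\<integral>\<^sup>+a. \<integral>\<^sup>+d. (\<integral>\<^sup>+\<tau>. G (a + \<tau> *\<^sub>R (d - a)) * indicator {1/2..1} \<tau> * indicator ?B d * indicator ?B a \<partial>lborel) \<partial>lborel \<partial>lborel)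
       \<le> (\<integral>\<^sup>+a. N * I * indicator ?B a \<partial>lborel)" by (intro nn_integral_mono)
    then show ?thesis by (simp add: nn_integral_cmult_indicator)
  qed
  have half2: "(\<integral>\<^sup>+a. \<integral>\<^sup>+d. (\<integral>\<^sup>+\<tau>. G (a + \<tau> *\<^sub>R (d - a)) * indicator {0..1/2} \<tau> * indicator ?B d * indicator ?B a \<partial>lborel) \<partial>lborel \<partial>lborel)
     \<le> N * I * emeasure lborel ?B"
  proof -
    have "(\<integral>\<^sup>+a. \<integral>\<^sup>+d. (\<integral>\<^sup>+\<tau>. G (a + \<tau> *\<^sub>R (d - a)) * indicator {0..1/2} \<tau> * indicator ?B d * indicator ?B a \<partial>lborel) \<partial>lborel \<partial>lborel)
        = (\<integral>\<^sup>+d. \<integral>\<^sup>+a. (\<integral>\<^sup>+\<tau>. G (a + \<tau> *\<^sub>R (d - a)) * indicator {0..1/2} \<tau> * indicator ?B d * indicator ?B a \<partial>lborel) \<partial>lborel \<partial>lborel)"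
      by (intro lborel_pair.Fubini') measurable
    also have "\<dots> = (\<integral>\<^sup>+d. \<integral>\<^sup>+a. (\<integral>\<^sup>+\<tau>. G (d + \<tau> *\<^sub>R (a - d)) * indicator {1/2..1} \<tau> * indicator ?B a * indicator ?B d \<partial>lborel) \<partial>lborel \<partial>lborel)"
    proof (rule nn_integral_cong, rule nn_integral_cong)
      fix d a :: 'a
      have "(\<integral>\<^sup>+\<tau>. G (a + \<tau> *\<^sub>R (d - a)) * indicator {0..1/2} \<tau> * indicator ?B d * indicator ?B a \<partial>lborel)
        = ennreal \<bar>-1\<bar> * (\<integral>\<^sup>+\<tau>. G (a + (1 + (-1) * \<tau>) *\<^sub>R (d - a)) * indicator {0..1/2} (1 + (-1) * \<tau>) * indicator ?B d * indicator ?B a \<partial>lborel)"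
        by (rule nn_integral_real_affine) auto
      also have "\<dots> = (\<integral>\<^sup>+\<tau>. G (d + \<tau> *\<^sub>R (a - d)) * indicator {1/2..1} \<tau> * indicator ?B a * indicator ?B d \<partial>lborel)"
      proof -
        have "ennreal \<bar>-1\<bar> = 1" by simp
        moreover have "(\<integral>\<^sup>+\<tau>. G (a + (1 + (-1) * \<tau>) *\<^sub>R (d - a)) * indicator {0..1/2} (1 + (-1) * \<tau>) * indicator ?B d * indicator ?B a \<partial>lborel) = (\<integral>\<^sup>+\<tau>. G (d + \<tau> *\<^sub>R (a - d)) * indicator {1/2..1} \<tau> * indicator ?B a * indicator ?B d \<partial>lborel)"
          by (intro nn_integral_cong) (auto simp: indicator_def algebra_simps)
        ultimately show ?thesis by simp
      qed
      finally show "(\<integral>\<^sup>+\<tau>. G (a + \<tau> *\<^sub>R (d - a)) * indicator {0..1/2} \<tau> * indicator ?B d * indicator ?B a \<partial>lborel)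
        = (\<integral>\<^sup>+\<tau>. G (d + \<tau> *\<^sub>R (a - d)) * indicator {1/2..1} \<tau> * indicator ?B a * indicator ?B d \<partial>lborel)" .
    qed
    also have "\<dots> \<le> N * I * emeasure lborel ?B" by (rule half1)
    finally show ?thesis .
  qed
  have "emeasure lborel A * emeasure lborel D = (\<integral>\<^sup>+a. \<integral>\<^sup>+d. indicator A a * indicator D d \<partial>lborel \<partial>lborel)"
    by (simp add: nn_integral_cmult nn_integral_multc)
  also have "\<dots> \<le> (\<integral>\<^sup>+a. \<integral>\<^sup>+d. ennreal (2 * r) *
       ((\<integral>\<^sup>+\<tau>. G (a + \<tau> *\<^sub>R (d - a)) * indicator {1/2..1} \<tau> * indicator ?B d * indicator ?B a \<partial>lborel)
      + (\<integral>\<^sup>+\<tau>. G (a + \<tau> *\<^sub>R (d - a)) * indicator {0..1/2} \<tau> * indicator ?B d * indicator ?B a \<partial>lborel)) \<partial>lborel \<partial>lborel)"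
  proof (intro nn_integral_mono)
    fix a d
    show "indicator A a * indicator D d \<le> ennreal (2 * r) *
       ((\<integral>\<^sup>+\<tau>. G (a + \<tau> *\<^sub>R (d - a)) * indicator {1/2..1} \<tau> * indicator ?B d * indicator ?B a \<partial>lborel)
      + (\<integral>\<^sup>+\<tau>. G (a + \<tau> *\<^sub>R (d - a)) * indicator {0..1/2} \<tau> * indicator ?B d * indicator ?B a \<partial>lborel))"
    proof (cases "a \<in> A \<and> d \<in> D")
      case True
      then have B: "a \<in> ?B" "d \<in> ?B" using AD by auto
      have d: "dist a d \<le> 2 * r" using B dist_triangle3[of a d x] by auto
      have "1 \<le> ennreal (dist a d) * (\<integral>\<^sup>+\<tau>. G (a + \<tau> *\<^sub>R (d - a)) * indicator {0..1} \<tau> \<partial>lborel)"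
        using seg True by auto
      also have "\<dots> \<le> ennreal (2 * r) * (\<integral>\<^sup>+\<tau>. G (a + \<tau> *\<^sub>R (d - a)) * indicator {1/2..1} \<tau> * indicator ?B d * indicator ?B a
           + G (a + \<tau> *\<^sub>R (d - a)) * indicator {0..1/2} \<tau> * indicator ?B d * indicator ?B a \<partial>lborel)"
        using d B by (intro mult_mono nn_integral_mono ennreal_leI) (auto simp: indicator_def)
      finally show ?thesis using True by (simp add: nn_integral_add)
    qed auto
  qed
  also have "\<dots> = ennreal (2 * r) * ((\<integral>\<^sup>+a. \<integral>\<^sup>+d. (\<integral>\<^sup>+\<tau>. G (a + \<tau> *\<^sub>R (d - a)) * indicator {1/2..1} \<tau> * indicator ?B d * indicator ?B a \<partial>lborel) \<partial>lborel \<partial>lborel)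
      + (\<integral>\<^sup>+a. \<integral>\<^sup>+d. (\<integral>\<^sup>+\<tau>. G (a + \<tau> *\<^sub>R (d - a)) * indicator {0..1/2} \<tau> * indicator ?B d * indicator ?B a \<partial>lborel) \<partial>lborel \<partial>lborel))"
    by (simp add: nn_integral_add nn_integral_cmult)
  also have "\<dots> \<le> ennreal (2 * r) * (N * I * emeasure lborel ?B + N * I * emeasure lborel ?B)"
    by (intro mult_left_mono add_mono half1 half2) auto
  also have "\<dots> = ennreal (4 * r * 2 ^ DIM('a)) * emeasure lborel ?B * I"
  proof -
    have N: "N = ennreal (2 ^ DIM('a))" by (simp add: N_def flip: ennreal_power)
    have "ennreal (4 * r * 2 ^ DIM('a)) = ennreal (2 * r * 2 * 2 ^ DIM('a))" by (simp add: mult_ac)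
    also have "\<dots> = ennreal (2 * r) * 2 * N"
      using r unfolding N by (subst ennreal_mult, simp, simp, subst ennreal_mult) auto
    finally have "ennreal (4 * r * 2 ^ DIM('a)) = ennreal (2 * r) * 2 * N" .
    then show ?thesis by (simp add: mult_2[symmetric] mult_ac)
  qed
  finally show ?thesis by (simp add: I_def)
qed

text \<open>
  Along the segment \<open>\<bar>f\<bar>\<close> passes from \<open>s + h\<close> down to \<open>s\<close> on an interval that is mapped into the layer
  \<open>{s < \<bar>f\<bar> < s + h}\<close>, and there \<open>f\<close> changes by at least \<open>h\<close>.
\<close>
lemma segment_crossing:
  fixes f :: "'a::euclidean_space \<Rightarrow> real"
  assumes df: "\<And>y. GDERIV f y :> F y" and F: "continuous_on UNIV F"
    and h: "h > 0" and a: "s + h \<le> \<bar>f a\<bar>" and d: "\<bar>f d\<bar> \<le> s"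
  shows "1 \<le> ennreal (dist a d) * (\<integral>\<^sup>+\<tau>. ennreal (norm (F (a + \<tau> *\<^sub>R (d - a))) / h)
      * indicator {y. s < \<bar>f y\<bar> \<and> \<bar>f y\<bar> < s + h} (a + \<tau> *\<^sub>R (d - a)) * indicator {0..1} \<tau> \<partial>lborel)"
proof -
  define \<gamma> where "\<gamma> \<tau> = a + \<tau> *\<^sub>R (d - a)" for \<tau>
  have contf: "continuous_on UNIV f"
    using df by (auto simp: gderiv_def intro!: continuous_at_imp_continuous_on has_derivative_continuous)
  have cont\<gamma>: "continuous_on UNIV \<gamma>" unfolding \<gamma>_def by (intro continuous_intros)
  define \<phi> where "\<phi> \<tau> = \<bar>f (\<gamma> \<tau>)\<bar>" for \<tau>
  have cont\<phi>: "continuous_on T \<phi>" for T unfolding \<phi>_def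
    by (intro continuous_intros continuous_on_compose2[OF contf] continuous_on_subset[OF cont\<gamma>]) auto
  have \<phi>0: "\<phi> 0 \<ge> s + h" and \<phi>1: "\<phi> 1 \<le> s" using a d by (auto simp: \<phi>_def \<gamma>_def)
  have "closed ({0..1} \<inter> \<phi> -` {..s})"
    by (intro continuous_closed_preimage cont\<phi>) auto
  then have comp: "compact ({0..1} \<inter> \<phi> -` {..s})" by (metis Int_assoc compact_Int_closed compact_Icc inf.idem)
  have "{0..1} \<inter> \<phi> -` {..s} \<noteq> {}" using \<phi>1 by (auto intro!: exI[of _ "1::real"] simp: set_eq_iff)
  (* b is the first time below s, and c the last time before b at or above s + h. *)
  from compact_attains_inf[OF comp this] obtain b where b: "b \<in> {0..1}" "\<phi> b \<le> s" "\<And>t. t \<in> {0..1} \<Longrightarrow> \<phi> t \<le> s \<Longrightarrow> b \<le> t"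
    by auto
  have "closed ({0..b} \<inter> \<phi> -` {s+h..})"
    by (intro continuous_closed_preimage cont\<phi>) auto
  then have comp: "compact ({0..b} \<inter> \<phi> -` {s+h..})" by (metis Int_assoc compact_Int_closed compact_Icc inf.idem)
  have "{0..b} \<inter> \<phi> -` {s+h..} \<noteq> {}" using \<phi>0 b by (auto intro!: exI[of _ "0::real"] simp: set_eq_iff)
  from compact_attains_sup[OF comp this] obtain c where c: "c \<in> {0..b}" "\<phi> c \<ge> s+h" "\<And>t. t \<in> {0..b} \<Longrightarrow> \<phi> t \<ge> s+h \<Longrightarrow> t \<le> c"
    by auto
  have mid: "s < \<phi> t \<and> \<phi> t < s + h" if "t \<in> {c<..<b}" for t
    using that b(3)[of t] c(3)[of t] b(1) c(1) by force
  have cb: "c \<le> b" using c by auto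
  let ?g = "\<lambda>\<tau>. F (\<gamma> \<tau>) \<bullet> (d - a)"
  have der: "((\<lambda>\<tau>. f (\<gamma> \<tau>)) has_vector_derivative ?g \<tau>) (at \<tau> within {c..b})" for \<tau>
  proof -
    have 1: "(f has_derivative (\<lambda>h. h \<bullet> F (\<gamma> \<tau>))) (at (\<gamma> \<tau>))" using df by (simp add: gderiv_def)
    have 2: "(\<gamma> has_derivative (\<lambda>t. t *\<^sub>R (d - a))) (at \<tau> within {c..b})"
      unfolding \<gamma>_def by (auto intro!: derivative_eq_intros)
    have "((\<lambda>\<tau>. f (\<gamma> \<tau>)) has_derivative (\<lambda>t. (t *\<^sub>R (d - a)) \<bullet> F (\<gamma> \<tau>))) (at \<tau> within {c..b})"
      using has_derivative_compose[OF 2 1] by (simp add: o_def)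
    then show ?thesis by (simp add: has_vector_derivative_def inner_commute)
  qed
  have gc: "continuous_on {c..b} ?g"
    by (intro continuous_intros continuous_on_compose2[OF F] continuous_on_subset[OF cont\<gamma>]) auto
  have int: "(\<integral>\<tau>. indicator {c..b} \<tau> *\<^sub>R ?g \<tau> \<partial>lborel) = f (\<gamma> b) - f (\<gamma> c)"
    by (rule integral_FTC_Icc[OF cb]) (auto intro: der gc)
  have intg: "integrable lborel (\<lambda>\<tau>. indicator {c..b} \<tau> *\<^sub>R ?g \<tau>)"
    using borel_integrable_compact[OF compact_Icc gc] by simp
  have "h \<le> \<phi> c - \<phi> b" using b c by auto
  also have "\<dots> \<le> \<bar>f (\<gamma> b) - f (\<gamma> c)\<bar>" unfolding \<phi>_def by linarith
  finally have "ennreal h \<le> ennreal (norm (\<integral>\<tau>. indicator {c..b} \<tau> *\<^sub>R ?g \<tau> \<partial>lborel))"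
    unfolding int by (simp add: ennreal_leI)
  also have "\<dots> \<le> (\<integral>\<^sup>+\<tau>. ennreal (norm (indicator {c..b} \<tau> *\<^sub>R ?g \<tau>)) \<partial>lborel)"
    by (rule integral_norm_bound_ennreal[OF intg])
  also have "\<dots> \<le> (\<integral>\<^sup>+\<tau>. ennreal (h * dist a d) * (ennreal (norm (F (\<gamma> \<tau>)) / h)
      * indicator {y. s < \<bar>f y\<bar> \<and> \<bar>f y\<bar> < s + h} (\<gamma> \<tau>) * indicator {0..1} \<tau>) \<partial>lborel)"
  proof (rule nn_integral_mono_AE)
    have "AE \<tau> in lborel. \<tau> \<noteq> b" "AE \<tau> in lborel. \<tau> \<noteq> c" by (rule AE_lborel_singleton)+
    then show "AE \<tau> in lborel. ennreal (norm (indicator {c..b} \<tau> *\<^sub>R ?g \<tau>)) \<le> ennreal (h * dist a d) * (ennreal (norm (F (\<gamma> \<tau>)) / h)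
      * indicator {y. s < \<bar>f y\<bar> \<and> \<bar>f y\<bar> < s + h} (\<gamma> \<tau>) * indicator {0..1} \<tau>)"
    proof eventually_elim
      case (elim \<tau>)
      show ?case
      proof (cases "\<tau> \<in> {c<..<b}")
        case True
        have m: "s < \<bar>f (\<gamma> \<tau>)\<bar> \<and> \<bar>f (\<gamma> \<tau>)\<bar> < s + h" using mid[OF True] by (simp add: \<phi>_def)
        have in01: "\<tau> \<in> {0..1}" "\<tau> \<in> {c..b}" using True b(1) c(1) by auto
        have "\<bar>?g \<tau>\<bar> \<le> norm (F (\<gamma> \<tau>)) * norm (d - a)" by (rule Cauchy_Schwarz_ineq2)
        also have "\<dots> = (h * dist a d) * (norm (F (\<gamma> \<tau>)) / h)" using h by (simp add: dist_norm norm_minus_commute)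
        finally have "ennreal \<bar>?g \<tau>\<bar> \<le> ennreal (h * dist a d) * ennreal (norm (F (\<gamma> \<tau>)) / h)"
          using h by (simp add: ennreal_mult''[symmetric] ennreal_leI)
        then show ?thesis using m in01 by simp
      next
        case False
        with elim have "\<tau> \<notin> {c..b}" by auto
        then show ?thesis by simp
      qed
    qed
  qed
  also have "\<dots> = ennreal (h * dist a d) * (\<integral>\<^sup>+\<tau>. ennreal (norm (F (\<gamma> \<tau>)) / h)
      * indicator {y. s < \<bar>f y\<bar> \<and> \<bar>f y\<bar> < s + h} (\<gamma> \<tau>) * indicator {0..1} \<tau> \<partial>lborel)"
  proof (rule nn_integral_cmult)
    have [measurable]: "f \<in> borel_measurable borel" "F \<in> borel_measurable borel" "\<gamma> \<in> borel_measurable borel"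
      using contf F cont\<gamma> by (auto intro: borel_measurable_continuous_onI)
    show "(\<lambda>\<tau>. ennreal (norm (F (\<gamma> \<tau>)) / h)
      * indicator {y. s < \<bar>f y\<bar> \<and> \<bar>f y\<bar> < s + h} (\<gamma> \<tau>) * indicator {0..1} \<tau>) \<in> borel_measurable lborel"
      by measurable
  qed
  finally have "ennreal h \<le> ennreal h * (ennreal (dist a d) * (\<integral>\<^sup>+\<tau>. ennreal (norm (F (\<gamma> \<tau>)) / h)
      * indicator {y. s < \<bar>f y\<bar> \<and> \<bar>f y\<bar> < s + h} (\<gamma> \<tau>) * indicator {0..1} \<tau> \<partial>lborel))"
    using h by (simp add: ennreal_mult mult.assoc)
  then have "ennreal (1/h) * ennreal h \<le> ennreal (1/h) * (ennreal h * (ennreal (dist a d) * (\<integral>\<^sup>+\<tau>. ennreal (norm (F (\<gamma> \<tau>)) / h)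
      * indicator {y. s < \<bar>f y\<bar> \<and> \<bar>f y\<bar> < s + h} (\<gamma> \<tau>) * indicator {0..1} \<tau> \<partial>lborel)))"
    by (rule mult_left_mono) auto
  moreover have "ennreal (1/h) * ennreal h = 1" using h by (simp add: ennreal_mult''[symmetric])
  ultimately show ?thesis unfolding \<gamma>_def[symmetric] by (simp add: mult.assoc[symmetric])
qed

text \<open>
  This is admissibility in the sense of the modulus of curve families, for the family of straight
  segments from \<open>A\<close> to \<open>D\<close>.
\<close>
definition admissible_between :: "('a::euclidean_space \<Rightarrow> ennreal) \<Rightarrow> 'a set \<Rightarrow> 'a set \<Rightarrow> bool" where
  "admissible_between G A D \<longleftrightarrow> (\<forall>a\<in>A. \<forall>d\<in>D.
     1 \<le> ennreal (dist a d) * (\<integral>\<^sup>+\<tau>. G (a + \<tau> *\<^sub>R (d - a)) * indicator {0..1} \<tau> \<partial>lborel))"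

lemma fmeasurable_subset_ball:
  fixes A :: "'a::euclidean_space set"
  assumes "A \<in> sets borel" "A \<subseteq> ball x r"
  shows "emeasure lborel A = ennreal (measure lborel A)" 
  using assms emeasure_bounded_finite[of A] bounded_subset[OF bounded_ball assms(2)]
  by (intro emeasure_eq_ennreal_measure) auto

lemma admissible_integral_lower:
  fixes G :: "'a::euclidean_space \<Rightarrow> ennreal"
  assumes adm: "admissible_between G A D"
    and G[measurable]: "G \<in> borel_measurable borel" and AD[measurable]: "A \<in> sets borel" "D \<in> sets borel"
    and sub: "A \<subseteq> ball x r" "D \<subseteq> ball x r" and r: "r > 0" and \<theta>: "\<theta> > 0"
    and dens: "\<theta> * measure lborel (ball x r) \<le> measure lborel A" "measure lborel (ball x r) / 2 \<le> measure lborel D"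
  shows "ennreal (\<theta> * (unit_ball_vol DIM('a) / (8 * 2 ^ DIM('a))) * r powr (real DIM('a) - 1))
    \<le> (\<integral>\<^sup>+y. G y * indicator (ball x r) y \<partial>lborel)"
proof (cases "(\<integral>\<^sup>+y. G y * indicator (ball x r) y \<partial>lborel)")
  case top
  then show ?thesis by simp
next
  case (real J)
  let ?B = "measure lborel (ball x r)" and ?n = "real DIM('a)"
  have B: "?B > 0" using r by simp
  have fin: "emeasure lborel A = ennreal (measure lborel A)" "emeasure lborel D = ennreal (measure lborel D)"
    "emeasure lborel (ball x r) = ennreal ?B"
    using fmeasurable_subset_ball[OF AD(1) sub(1)] fmeasurable_subset_ball[OF AD(2) sub(2)] fmeasurable_subset_ball[of "ball x r" x r] by auto
  have "emeasure lborel A * emeasure lborel D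
    \<le> ennreal (4 * r * 2 ^ DIM('a)) * emeasure lborel (ball x r) * (\<integral>\<^sup>+y. G y * indicator (ball x r) y \<partial>lborel)"
    using two_set_poincare[OF G AD sub r] adm by (auto simp: admissible_between_def)
  then have "ennreal (measure lborel A * measure lborel D) \<le> ennreal (4 * r * 2 ^ DIM('a) * ?B * J)"
    unfolding fin real using r \<open>0 \<le> J\<close> by (simp add: ennreal_mult'' mult.assoc)
  then have le: "measure lborel A * measure lborel D \<le> 4 * r * 2 ^ DIM('a) * ?B * J"
    using r \<open>0 \<le> J\<close> by (subst (asm) ennreal_le_iff) auto
  have "(\<theta> * ?B) * (?B / 2) \<le> measure lborel A * measure lborel D"
    using dens B \<theta> by (intro mult_mono) auto
  with le have "?B * (\<theta> * ?B / 2) \<le> ?B * (4 * r * 2 ^ DIM('a) * J)" by (simp add: mult_ac)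
  then have "\<theta> * ?B / 2 \<le> 4 * r * 2 ^ DIM('a) * J" using B by (simp only: mult_le_cancel_left_pos)
  also have "?B = unit_ball_vol ?n * (r powr (?n - 1) * r)"
    using r by (simp add: measure_ball_powr powr_diff)
  finally have "r * (\<theta> * (unit_ball_vol ?n / (8 * 2 ^ DIM('a))) * r powr (?n - 1)) \<le> r * J"
    by (simp add: field_simps)
  then have "\<theta> * (unit_ball_vol ?n / (8 * 2 ^ DIM('a))) * r powr (?n - 1) \<le> J"
    using r by (simp only: mult_le_cancel_left_pos)
  then show ?thesis unfolding real by (rule ennreal_leI)
qed

lemma admissible_weighted_far:
  fixes G :: "'a::euclidean_space \<Rightarrow> ennreal"
  assumes adm: "admissible_between G A D"
    and G[measurable]: "G \<in> borel_measurable borel" and AD[measurable]: "A \<in> sets borel" "D \<in> sets borel"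
    and sub: "A \<subseteq> ball x r" "D \<subseteq> ball x r" and r: "r > 0" and \<theta>: "\<theta> > 0"
    and dens: "\<theta> * measure lborel (ball x r) \<le> measure lborel A" "measure lborel (ball x r) / 2 \<le> measure lborel D"
    and far: "2 * r \<le> infdist x E"
  shows "ennreal (\<theta> * (unit_ball_vol DIM('a) / (8 * 2 ^ DIM('a))) / 2 powr \<bar>\<beta>\<bar> * (infdist x E powr \<beta> * r powr (real DIM('a) - 1)))
    \<le> (\<integral>\<^sup>+y. G y * ennreal (infdist y E powr \<beta>) * indicator (ball x r) y \<partial>lborel)"
proof -
  let ?d = "infdist x E" and ?c = "\<theta> * (unit_ball_vol DIM('a) / (8 * 2 ^ DIM('a)))"
  have [measurable]: "(\<lambda>y. infdist y E) \<in> borel_measurable borel"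
    by (intro borel_measurable_continuous_onI continuous_intros)
  have [measurable]: "ball x r \<in> sets borel" by simp
  have "ennreal (?c / 2 powr \<bar>\<beta>\<bar> * (?d powr \<beta> * r powr (real DIM('a) - 1)))
     = ennreal (?d powr \<beta> / 2 powr \<bar>\<beta>\<bar>) * ennreal (?c * r powr (real DIM('a) - 1))"
    by (subst ennreal_mult''[symmetric]) (use \<theta> in \<open>auto simp: field_simps\<close>)
  also have "\<dots> \<le> ennreal (?d powr \<beta> / 2 powr \<bar>\<beta>\<bar>) * (\<integral>\<^sup>+y. G y * indicator (ball x r) y \<partial>lborel)"
    by (intro mult_left_mono admissible_integral_lower[OF adm G AD sub r \<theta> dens]) auto
  also have "\<dots> = (\<integral>\<^sup>+y. ennreal (?d powr \<beta> / 2 powr \<bar>\<beta>\<bar>) * (G y * indicator (ball x r) y) \<partial>lborel)"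
    by (intro nn_integral_cmult[symmetric]) auto
  also have "\<dots> \<le> (\<integral>\<^sup>+y. G y * ennreal (infdist y E powr \<beta>) * indicator (ball x r) y \<partial>lborel)"
  proof (intro nn_integral_mono)
    fix y
    show "ennreal (?d powr \<beta> / 2 powr \<bar>\<beta>\<bar>) * (G y * indicator (ball x r) y) \<le> G y * ennreal (infdist y E powr \<beta>) * indicator (ball x r) y"
    proof (cases "y \<in> ball x r")
      case True
      have "?d powr \<beta> \<le> 2 powr \<bar>\<beta>\<bar> * infdist y E powr \<beta>"
        using infdist_ball_bounds[OF True, of E] far r by (intro powr_comparable) auto
      then have "?d powr \<beta> / 2 powr \<bar>\<beta>\<bar> \<le> infdist y E powr \<beta>" by (simp add: divide_le_eq mult.commute)
      then have "ennreal (?d powr \<beta> / 2 powr \<bar>\<beta>\<bar>) * G y \<le> ennreal (infdist y E powr \<beta>) * G y"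
        by (intro mult_right_mono ennreal_leI) auto
      then show ?thesis using True by (simp add: mult.commute)
    qed auto
  qed
  finally show ?thesis .
qed

text \<open>
  On the ball \<open>\<delta>\<close> is at most \<open>11 * r\<close>, so \<open>\<delta> powr \<beta>\<close> is bounded below off \<open>E\<close>.  The set \<open>E\<close> has to be null
  since \<open>0 powr \<beta> = 0\<close> would make the weight vanish there.
\<close>
lemma admissible_weighted_near_nonpos:
  fixes G :: "'a::euclidean_space \<Rightarrow> ennreal"
  assumes adm: "admissible_between G A D"
    and G[measurable]: "G \<in> borel_measurable borel" and AD[measurable]: "A \<in> sets borel" "D \<in> sets borel"
    and sub: "A \<subseteq> ball x r" "D \<subseteq> ball x r" and r: "r > 0" and \<theta>: "\<theta> > 0"
    and dens: "\<theta> * measure lborel (ball x r) \<le> measure lborel A" "measure lborel (ball x r) / 2 \<le> measure lborel D"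
    and near: "infdist x E \<le> 10 * r" and \<beta>: "\<beta> \<le> 0" and null: "emeasure lborel E = 0" and E: "closed E" "E \<noteq> {}"
  shows "ennreal (\<theta> * (unit_ball_vol DIM('a) / (8 * 2 ^ DIM('a))) * 11 powr \<beta> * r powr (real DIM('a) - 1 + \<beta>))
    \<le> (\<integral>\<^sup>+y. G y * ennreal (infdist y E powr \<beta>) * indicator (ball x r) y \<partial>lborel)"
proof -
  let ?c = "\<theta> * (unit_ball_vol DIM('a) / (8 * 2 ^ DIM('a)))"
  have [measurable]: "(\<lambda>y. infdist y E) \<in> borel_measurable borel"
    by (intro borel_measurable_continuous_onI continuous_intros)
  have [measurable]: "ball x r \<in> sets borel" by simp
  have "ennreal (?c * 11 powr \<beta> * r powr (real DIM('a) - 1 + \<beta>))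
     = ennreal ((11 * r) powr \<beta>) * ennreal (?c * r powr (real DIM('a) - 1))"
    using \<theta> r by (subst ennreal_mult''[symmetric]) (auto simp: powr_add[of r "real DIM('a) - 1"] powr_mult)
  also have "\<dots> \<le> ennreal ((11 * r) powr \<beta>) * (\<integral>\<^sup>+y. G y * indicator (ball x r) y \<partial>lborel)"
    by (intro mult_left_mono admissible_integral_lower[OF adm G AD sub r \<theta> dens]) auto
  also have "\<dots> = (\<integral>\<^sup>+y. ennreal ((11 * r) powr \<beta>) * (G y * indicator (ball x r) y) \<partial>lborel)"
    by (intro nn_integral_cmult[symmetric]) auto
  also have "\<dots> \<le> (\<integral>\<^sup>+y. G y * ennreal (infdist y E powr \<beta>) * indicator (ball x r) y \<partial>lborel)"
  proof (intro nn_integral_mono_AE)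
    have "AE y in lborel. y \<notin> E"
      using null E by (intro AE_not_in) (auto simp: null_sets_def)
    then show "AE y in lborel. ennreal ((11 * r) powr \<beta>) * (G y * indicator (ball x r) y) \<le> G y * ennreal (infdist y E powr \<beta>) * indicator (ball x r) y"
    proof eventually_elim
      case (elim y)
      show ?case
      proof (cases "y \<in> ball x r")
        case True
        have "infdist y E > 0" using elim E by (simp add: infdist_pos_not_in_closed)
        then have "(11 * r) powr \<beta> \<le> infdist y E powr \<beta>"
          using infdist_ball_bounds[OF True, of E] near \<beta> by (intro powr_mono2') auto
        then have "ennreal ((11 * r) powr \<beta>) * G y \<le> ennreal (infdist y E powr \<beta>) * G y"
          by (intro mult_right_mono ennreal_leI) auto
        then show ?thesis using True by (simp add: mult.commute)
      qed auto
    qed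
  qed
  finally show ?thesis .
qed

text \<open>
  A segment that meets \<open>{\<delta> < \<rho>}\<close> starts at distance at least \<open>2 * \<rho>\<close> from \<open>E\<close> and therefore spends at
  least the length \<open>\<rho>\<close> in \<open>{\<delta> < 2 * \<rho>}\<close>, where the second summand charges it \<open>1 / \<rho>\<close> per unit of length.
  All other segments only see the part of \<open>G\<close> on \<open>{\<delta> \<ge> \<rho>}\<close>.
\<close>
lemma admissible_between_avoid:
  fixes G :: "'a::euclidean_space \<Rightarrow> ennreal"
  assumes adm: "admissible_between G A D" and \<rho>: "\<rho> > 0" and A: "\<And>a. a \<in> A \<Longrightarrow> 2 * \<rho> \<le> infdist a E"
  shows "admissible_between (\<lambda>y. G y * indicator {y. \<rho> \<le> infdist y E} y + ennreal (1 / \<rho>) * indicator {y. infdist y E < 2 * \<rho>} y) A D"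
  unfolding admissible_between_def
proof (intro ballI)
  fix a d assume a: "a \<in> A" and d: "d \<in> D"
  let ?H = "\<lambda>y. G y * indicator {y. \<rho> \<le> infdist y E} y + ennreal (1 / \<rho>) * indicator {y. infdist y E < 2 * \<rho>} y"
  show "1 \<le> ennreal (dist a d) * (\<integral>\<^sup>+ \<tau>. ?H (a + \<tau> *\<^sub>R (d - a)) * indicator {0..1} \<tau> \<partial>lborel)"
  proof (cases "\<forall>\<tau>\<in>{0..1}. \<rho> \<le> infdist (a + \<tau> *\<^sub>R (d - a)) E")
    case True
    have "1 \<le> ennreal (dist a d) * (\<integral>\<^sup>+\<tau>. G (a + \<tau> *\<^sub>R (d - a)) * indicator {0..1} \<tau> \<partial>lborel)"
      using adm a d by (auto simp: admissible_between_def)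
    also have "\<dots> \<le> ennreal (dist a d) * (\<integral>\<^sup>+ \<tau>. ?H (a + \<tau> *\<^sub>R (d - a)) * indicator {0..1} \<tau> \<partial>lborel)"
      using True by (intro mult_left_mono nn_integral_mono) (auto simp: indicator_def)
    finally show ?thesis .
  next
    case False
    then obtain \<tau>0 where \<tau>0: "0 \<le> \<tau>0" "\<tau>0 \<le> 1" "infdist (a + \<tau>0 *\<^sub>R (d - a)) E < \<rho>" by auto
    let ?L = "dist a d"
    have dist\<gamma>: "dist (a + s *\<^sub>R (d - a)) (a + u *\<^sub>R (d - a)) = \<bar>s - u\<bar> * ?L" for s u
      by (simp add: dist_norm norm_minus_commute scaleR_diff_left[symmetric])
    have "2 * \<rho> \<le> infdist a E" using A a by auto
    also have "\<dots> \<le> infdist (a + \<tau>0 *\<^sub>R (d - a)) E + dist a (a + \<tau>0 *\<^sub>R (d - a))" by (rule infdist_triangle)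
    also have "dist a (a + \<tau>0 *\<^sub>R (d - a)) = \<tau>0 * ?L" using dist\<gamma>[of 0 \<tau>0] \<tau>0 by simp
    finally have \<tau>L: "\<rho> < \<tau>0 * ?L" using \<tau>0 by linarith
    then have L: "?L > 0" using \<rho> \<tau>0 by (metis dist_eq_0_iff less_trans mult_zero_right not_less_iff_gr_or_eq zero_less_dist_iff)
    define u where "u = \<tau>0 - \<rho> / ?L"
    have u: "0 \<le> u" "u \<le> \<tau>0" using \<tau>L L \<rho> by (auto simp: u_def field_simps)
    have near: "infdist (a + \<tau> *\<^sub>R (d - a)) E < 2 * \<rho>" if "\<tau> \<in> {u..\<tau>0}" for \<tau>
    proof -
      have "\<bar>\<tau> - \<tau>0\<bar> \<le> \<rho> / ?L" using that by (auto simp: u_def)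
      then have "\<bar>\<tau> - \<tau>0\<bar> * ?L \<le> \<rho>" using L by (simp add: pos_le_divide_eq)
      then show ?thesis using infdist_triangle[of "a + \<tau> *\<^sub>R (d - a)" E "a + \<tau>0 *\<^sub>R (d - a)"] \<tau>0(3) dist\<gamma>[of \<tau> \<tau>0] by linarith
    qed
    have "1 = ennreal (?L * (1 / \<rho> * (\<rho> / ?L)))" using L \<rho> by simp
    also have "\<dots> = ennreal ?L * (ennreal (1 / \<rho>) * ennreal (\<tau>0 - u))"
      using L \<rho> by (simp add: u_def ennreal_mult''[symmetric])
    also have "ennreal (1 / \<rho>) * ennreal (\<tau>0 - u) = (\<integral>\<^sup>+\<tau>. ennreal (1 / \<rho>) * indicator {u..\<tau>0} \<tau> \<partial>lborel)"
      using u by (simp add: nn_integral_cmult_indicator)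
    also have "ennreal ?L * \<dots> \<le> ennreal ?L * (\<integral>\<^sup>+ \<tau>. ?H (a + \<tau> *\<^sub>R (d - a)) * indicator {0..1} \<tau> \<partial>lborel)"
    proof (intro mult_left_mono nn_integral_mono)
      fix \<tau>
      show "ennreal (1 / \<rho>) * indicator {u..\<tau>0} \<tau> \<le> ?H (a + \<tau> *\<^sub>R (d - a)) * indicator {0..1} \<tau>"
        using near[of \<tau>] u \<tau>0 by (cases "\<tau> \<in> {u..\<tau>0}") auto
    qed auto
    finally show ?thesis .
  qed
qed

text \<open>
  Take \<open>\<rho> = \<epsilon> * r\<close> in \<open>admissible_between_avoid\<close>.  The toll \<open>1 / \<rho>\<close> on the \<open>2 * \<rho>\<close>-neighbourhood of \<open>E\<close>
  integrates to a multiple of \<open>\<epsilon> powr (n - 1 - \<nu>) * r powr (n - 1)\<close>, and removing that neighbourhood from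
  \<open>A\<close> costs a fraction of order \<open>\<epsilon> powr (n - \<nu>)\<close> of the ball.  For small \<open>\<epsilon>\<close> both are absorbed, and the rest
  of the integral is over \<open>{\<epsilon> * r \<le> \<delta> \<le> 11 * r}\<close>, where the weight is comparable to \<open>r powr \<beta>\<close>
  whatever the sign of \<open>\<beta>\<close>.
\<close>
lemma admissible_weighted_near_dim:
  fixes E :: "'a::euclidean_space set"
  assumes \<nu>: "\<nu> < real DIM('a) - 1" and C: "0 < C" and \<theta>: "0 < \<theta>"
    and vol: "\<And>x r R. 0 < r \<Longrightarrow> r \<le> R \<Longrightarrow> emeasure lborel {y \<in> ball x R. infdist y E < r}
       \<le> ennreal (C * r powr (real DIM('a) - \<nu>) * R powr \<nu>)"
  obtains c where "0 < c" "\<And>G A D x r. admissible_between G A D \<Longrightarrow> G \<in> borel_measurable borel \<Longrightarrow>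
     A \<in> sets borel \<Longrightarrow> D \<in> sets borel \<Longrightarrow> A \<subseteq> ball x r \<Longrightarrow> D \<subseteq> ball x r \<Longrightarrow> 0 < r \<Longrightarrow>
     \<theta> * measure lborel (ball x r) \<le> measure lborel A \<Longrightarrow> measure lborel (ball x r) / 2 \<le> measure lborel D \<Longrightarrow>
     infdist x E \<le> 10 * r \<Longrightarrow>
     ennreal (c * r powr (real DIM('a) - 1 + \<beta>)) \<le> (\<integral>\<^sup>+y. G y * ennreal (infdist y E powr \<beta>) * indicator (ball x r) y \<partial>lborel)"
proof -
  let ?n = "real DIM('a)" and ?V = "unit_ball_vol (real DIM('a))"
  have [measurable]: "(\<lambda>y. infdist y E) \<in> borel_measurable borel"
    by (intro borel_measurable_continuous_onI continuous_intros)
  define c1 where "c1 = ?V / (8 * 2 ^ DIM('a))"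
  have V: "?V > 0" by simp
  have c1: "c1 > 0" by (simp add: c1_def)
  define C2 where "C2 = C * 2 powr (?n - \<nu>)"
  have C2: "C2 > 0" using C by (simp add: C2_def)
  (* The two entries of the minimum serve the two absorptions: half of the measure of A is kept,
     and half of the lower bound for the integral. *)
  define \<kappa> where "\<kappa> = min (\<theta> * ?V / 2) (c1 * \<theta> / 4) / C2"
  have \<kappa>: "\<kappa> > 0" using C2 V c1 \<theta> by (simp add: \<kappa>_def)
  define \<epsilon> where "\<epsilon> = min (1/2) (\<kappa> powr (1 / (?n - 1 - \<nu>)))"
  have \<epsilon>: "0 < \<epsilon>" "\<epsilon> \<le> 1/2" using \<kappa> by (auto simp: \<epsilon>_def)
  have "\<epsilon> powr (?n - 1 - \<nu>) \<le> (\<kappa> powr (1 / (?n - 1 - \<nu>))) powr (?n - 1 - \<nu>)"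
    using \<epsilon> \<nu> by (intro powr_mono2) (auto simp: \<epsilon>_def)
  also have "\<dots> = \<kappa>" using \<kappa> \<nu> by (simp add: powr_powr)
  finally have \<epsilon>\<kappa>: "\<epsilon> powr (?n - 1 - \<nu>) \<le> \<kappa>" .
  have \<epsilon>2: "C2 * \<epsilon> powr (?n - 1 - \<nu>) \<le> c1 * \<theta> / 4"
  proof -
    have "C2 * \<epsilon> powr (?n - 1 - \<nu>) \<le> C2 * \<kappa>" using C2 \<epsilon>\<kappa> by simp
    also have "\<dots> \<le> c1 * \<theta> / 4" using C2 by (simp add: \<kappa>_def)
    finally show ?thesis .
  qed
  have \<epsilon>1: "C2 * \<epsilon> powr (?n - \<nu>) \<le> \<theta> / 2 * ?V"
  proof -
    have "\<epsilon> powr (?n - \<nu>) \<le> \<epsilon> powr (?n - 1 - \<nu>)" using \<epsilon> by (intro powr_mono') auto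
    then have "C2 * \<epsilon> powr (?n - \<nu>) \<le> C2 * \<kappa>" using C2 \<epsilon>\<kappa> by simp
    also have "\<dots> \<le> \<theta> / 2 * ?V" using C2 by (simp add: \<kappa>_def)
    finally show ?thesis .
  qed
  define m where "m = min (\<epsilon> powr \<beta>) (11 powr \<beta>)"
  have m: "m > 0" using \<epsilon> by (simp add: m_def)
  show ?thesis
  proof (rule that[of "m * (c1 * \<theta> / 4)"])
    show "0 < m * (c1 * \<theta> / 4)" using m c1 \<theta> by simp
    fix G :: "'a \<Rightarrow> ennreal" and A D :: "'a set" and x :: 'a and r :: real
    assume adm: "admissible_between G A D" and G[measurable]: "G \<in> borel_measurable borel"
      and AD[measurable]: "A \<in> sets borel" "D \<in> sets borel" and sub: "A \<subseteq> ball x r" "D \<subseteq> ball x r" and r: "0 < r"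
      and dens: "\<theta> * measure lborel (ball x r) \<le> measure lborel A" "measure lborel (ball x r) / 2 \<le> measure lborel D"
      and near: "infdist x E \<le> 10 * r"
    have [measurable]: "ball x r \<in> sets borel" by simp
    define \<rho> where "\<rho> = \<epsilon> * r"
    have \<rho>: "\<rho> > 0" "2 * \<rho> \<le> r" using \<epsilon> r by (auto simp: \<rho>_def)
    define N where "N = {y \<in> ball x r. infdist y E < 2 * \<rho>}"
    have N[measurable]: "N \<in> sets borel" unfolding N_def by measurable
    have N_le: "emeasure lborel N \<le> ennreal (C2 * \<epsilon> powr (?n - \<nu>) * r powr ?n)"
    proof -
      have "emeasure lborel N \<le> ennreal (C * (2 * \<rho>) powr (?n - \<nu>) * r powr \<nu>)"
        unfolding N_def by (rule vol) (use \<rho> in auto)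
      also have "C * (2 * \<rho>) powr (?n - \<nu>) * r powr \<nu> = C2 * \<epsilon> powr (?n - \<nu>) * r powr ?n"
        using \<epsilon> r by (simp add: C2_def \<rho>_def powr_mult powr_diff)
      finally show ?thesis .
    qed
    define A' where "A' = A - N"
    have A'[measurable]: "A' \<in> sets borel" unfolding A'_def by measurable
    have A'sub: "A' \<subseteq> ball x r" using sub by (auto simp: A'_def)
    have mN: "measure lborel N \<le> \<theta> / 2 * measure lborel (ball x r)"
    proof -
      have "ennreal (measure lborel N) \<le> ennreal (C2 * \<epsilon> powr (?n - \<nu>) * r powr ?n)"
        using N_le fmeasurable_subset_ball[OF N, of x r] by (simp add: N_def subset_iff)
      then have "measure lborel N \<le> C2 * \<epsilon> powr (?n - \<nu>) * r powr ?n" using C2 by simp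
      also have "\<dots> \<le> \<theta> / 2 * ?V * r powr ?n" using \<epsilon>1 by (intro mult_right_mono) auto
      finally show ?thesis using r by (simp add: measure_ball_powr)
    qed
    have "ennreal (measure lborel A) \<le> ennreal (measure lborel A' + measure lborel N)"
    proof -
      have "emeasure lborel A \<le> emeasure lborel (A' \<union> N)" by (intro emeasure_mono) (auto simp: A'_def)
      also have "\<dots> \<le> emeasure lborel A' + emeasure lborel N" by (intro emeasure_subadditive) auto
      finally show ?thesis using fmeasurable_subset_ball[OF N, of x r] fmeasurable_subset_ball[OF A' A'sub] fmeasurable_subset_ball[OF AD(1) sub(1)]
        by (simp add: N_def subset_iff)
    qed
    then have "measure lborel A \<le> measure lborel A' + measure lborel N" by (subst (asm) ennreal_le_iff) auto
    then have dens': "\<theta> / 2 * measure lborel (ball x r) \<le> measure lborel A'" using dens(1) mN by linarith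
    define S where "S = {y. \<rho> \<le> infdist y E}"
    have [measurable]: "S \<in> sets borel" unfolding S_def by measurable
    define H where "H y = G y * indicator S y + ennreal (1 / \<rho>) * indicator {y. infdist y E < 2 * \<rho>} y" for y
    have H[measurable]: "H \<in> borel_measurable borel" unfolding H_def by measurable
    have admH: "admissible_between H A' D"
      unfolding H_def S_def
    proof (rule admissible_between_avoid)
      show "admissible_between G A' D" using adm by (auto simp: admissible_between_def A'_def)
      show "\<And>a. a \<in> A' \<Longrightarrow> 2 * \<rho> \<le> infdist a E" using sub by (auto simp: A'_def N_def)
    qed (use \<rho> in auto)
    define X where "X = (\<integral>\<^sup>+y. G y * indicator S y * indicator (ball x r) y \<partial>lborel)"
    have "ennreal (\<theta> / 2 * c1 * r powr (?n - 1)) \<le> (\<integral>\<^sup>+y. H y * indicator (ball x r) y \<partial>lborel)"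
      unfolding c1_def by (rule admissible_integral_lower[OF admH H A' AD(2) A'sub sub(2) r _ dens' dens(2)]) (use \<theta> in auto)
    also have "\<dots> = (\<integral>\<^sup>+y. G y * indicator S y * indicator (ball x r) y + ennreal (1 / \<rho>) * indicator N y \<partial>lborel)"
      by (intro nn_integral_cong) (auto simp: H_def N_def indicator_def)
    also have "\<dots> = X + ennreal (1 / \<rho>) * emeasure lborel N"
      unfolding X_def by (subst nn_integral_add) (auto simp: nn_integral_cmult_indicator)
    also have "\<dots> \<le> X + ennreal (c1 * \<theta> / 4 * r powr (?n - 1))"
    proof (intro add_left_mono)
      have "ennreal (1 / \<rho>) * emeasure lborel N \<le> ennreal (1 / \<rho>) * ennreal (C2 * \<epsilon> powr (?n - \<nu>) * r powr ?n)"
        by (intro mult_left_mono N_le) auto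
      also have "\<dots> = ennreal (C2 * \<epsilon> powr (?n - 1 - \<nu>) * r powr (?n - 1))"
        using \<rho> r \<epsilon> C2 by (subst ennreal_mult''[symmetric]) (auto simp: \<rho>_def powr_diff powr_add field_simps)
      also have "\<dots> \<le> ennreal (c1 * \<theta> / 4 * r powr (?n - 1))"
        using \<epsilon>2 by (intro ennreal_leI mult_right_mono) auto
      finally show "ennreal (1 / \<rho>) * emeasure lborel N \<le> ennreal (c1 * \<theta> / 4 * r powr (?n - 1))" .
    qed
    finally have le: "ennreal (\<theta> / 2 * c1 * r powr (?n - 1)) \<le> X + ennreal (c1 * \<theta> / 4 * r powr (?n - 1))" .
    have X: "ennreal (c1 * \<theta> / 4 * r powr (?n - 1)) \<le> X"
    proof (cases X)
      case (real X')
      have "\<theta> / 2 * c1 * r powr (?n - 1) \<le> X' + c1 * \<theta> / 4 * r powr (?n - 1)"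
        using le real c1 \<theta> by (simp add: ennreal_plus[symmetric] del: ennreal_plus)
      then have "c1 * \<theta> / 4 * r powr (?n - 1) \<le> X'" by (simp add: field_simps)
      then show ?thesis using real by (simp add: ennreal_leI)
    qed simp
    have "ennreal (m * (c1 * \<theta> / 4) * r powr (?n - 1 + \<beta>)) = ennreal (m * r powr \<beta>) * ennreal (c1 * \<theta> / 4 * r powr (?n - 1))"
      using m c1 \<theta> r by (subst ennreal_mult''[symmetric]) (auto simp: powr_add powr_diff)
    also have "\<dots> \<le> ennreal (m * r powr \<beta>) * X" by (intro mult_left_mono X) auto
    also have "\<dots> = (\<integral>\<^sup>+y. ennreal (m * r powr \<beta>) * (G y * indicator S y * indicator (ball x r) y) \<partial>lborel)"
      unfolding X_def by (intro nn_integral_cmult[symmetric]) auto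
    also have "\<dots> \<le> (\<integral>\<^sup>+y. G y * ennreal (infdist y E powr \<beta>) * indicator (ball x r) y \<partial>lborel)"
    proof (intro nn_integral_mono)
      fix y
      show "ennreal (m * r powr \<beta>) * (G y * indicator S y * indicator (ball x r) y) \<le> G y * ennreal (infdist y E powr \<beta>) * indicator (ball x r) y"
      proof (cases "y \<in> ball x r \<and> y \<in> S")
        case True
        then have y: "\<epsilon> * r \<le> infdist y E" "infdist y E \<le> 11 * r"
          using infdist_ball_bounds[of y x r E] near by (auto simp: S_def \<rho>_def)
        have er: "0 < \<epsilon> * r" using \<epsilon> r by simp
        have "m * r powr \<beta> \<le> infdist y E powr \<beta>"
        proof (cases "\<beta> \<ge> 0")
          case True
          have "m * r powr \<beta> \<le> \<epsilon> powr \<beta> * r powr \<beta>" by (intro mult_right_mono) (auto simp: m_def)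
          also have "\<dots> = (\<epsilon> * r) powr \<beta>" using \<epsilon> r by (simp add: powr_mult)
          also have "\<dots> \<le> infdist y E powr \<beta>" using y True er by (intro powr_mono2) auto
          finally show ?thesis .
        next
          case False
          have "m * r powr \<beta> \<le> 11 powr \<beta> * r powr \<beta>" by (intro mult_right_mono) (auto simp: m_def)
          also have "\<dots> = (11 * r) powr \<beta>" using r by (simp add: powr_mult)
          also have "\<dots> \<le> infdist y E powr \<beta>" using y False er by (intro powr_mono2') auto
          finally show ?thesis .
        qed
        then have "ennreal (m * r powr \<beta>) * G y \<le> ennreal (infdist y E powr \<beta>) * G y"
          by (intro mult_right_mono ennreal_leI) auto
        then show ?thesis using True by (simp add: mult.commute)
      qed (auto simp: indicator_def)
    qed
    finally show "ennreal (m * (c1 * \<theta> / 4) * r powr (?n - 1 + \<beta>)) \<le> (\<integral>\<^sup>+y. G y * ennreal (infdist y E powr \<beta>) * indicator (ball x r) y \<partial>lborel)" .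
  qed
qed

section \<open>Weighted isoperimetric inequalities\<close>

text \<open>
  Near \<open>E\<close> the weights of both sides are powers of \<open>r\<close>, and the choice \<open>Q = q * (n - 1 + \<beta>)\<close> makes them
  match.  Far from \<open>E\<close> the distance is comparable to its value \<open>d\<close> at the centre, and the remaining factor
  \<open>(r / d) powr (n - q * (n - 1))\<close> is at most 1 because \<open>q * (n - 1) \<le> n\<close>.  The factor 5 is the one of the
  Vitali covering lemma.
\<close>
lemma ball_isoperimetry:
  fixes E :: "'a::euclidean_space set" and q \<beta> \<theta> :: real
  assumes E: "closed E" "E \<noteq> {}" and q: "1 \<le> q" "q * (real DIM('a) - 1) \<le> real DIM('a)"
    and \<theta>: "0 < \<theta>" and K: "0 < K"
    and wball: "\<And>x R. 0 < R \<Longrightarrow> infdist x E \<le> 2 * R \<Longrightarrow>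
       (\<integral>\<^sup>+y. ennreal (infdist y E powr (q * (real DIM('a) - 1 + \<beta>) - real DIM('a))) * indicator (ball x R) y \<partial>lborel)
         \<le> ennreal (K * R powr (q * (real DIM('a) - 1 + \<beta>)))"
    and alt: "(\<beta> \<le> 0 \<and> emeasure lborel E = 0) \<or> (\<exists>\<nu> C. \<nu> < real DIM('a) - 1 \<and> 0 < C \<and>
       (\<forall>x r R. 0 < r \<longrightarrow> r \<le> R \<longrightarrow> emeasure lborel {y \<in> ball x R. infdist y E < r}
          \<le> ennreal (C * r powr (real DIM('a) - \<nu>) * R powr \<nu>)))"
  obtains C where "0 < C" "\<And>G A D x r t. admissible_between G A D \<Longrightarrow> G \<in> borel_measurable borel \<Longrightarrow>
     A \<in> sets borel \<Longrightarrow> D \<in> sets borel \<Longrightarrow> A \<subseteq> ball x r \<Longrightarrow> D \<subseteq> ball x r \<Longrightarrow> 0 < r \<Longrightarrow>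
     \<theta> * measure lborel (ball x r) \<le> measure lborel A \<Longrightarrow> measure lborel (ball x r) / 2 \<le> measure lborel D \<Longrightarrow>
     0 \<le> t \<Longrightarrow> (\<integral>\<^sup>+y. G y * ennreal (infdist y E powr \<beta>) * indicator (ball x r) y \<partial>lborel) \<le> ennreal t \<Longrightarrow>
     (\<integral>\<^sup>+y. ennreal (infdist y E powr (q * (real DIM('a) - 1 + \<beta>) - real DIM('a))) * indicator (ball x (5 * r)) y \<partial>lborel)
       \<le> ennreal ((C * t) powr q)"
proof -
  let ?n = "real DIM('a)" and ?V = "unit_ball_vol (real DIM('a))"
  define Q where "Q = q * (?n - 1 + \<beta>)"
  have [measurable]: "(\<lambda>y. infdist y E) \<in> borel_measurable borel"
    by (intro borel_measurable_continuous_onI continuous_intros)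
  obtain c1 where c1: "c1 > 0" and near_lower: "\<And>G A D x r. admissible_between G A D \<Longrightarrow> G \<in> borel_measurable borel \<Longrightarrow>
     A \<in> sets borel \<Longrightarrow> D \<in> sets borel \<Longrightarrow> A \<subseteq> ball x r \<Longrightarrow> D \<subseteq> ball x r \<Longrightarrow> 0 < r \<Longrightarrow>
     \<theta> * measure lborel (ball x r) \<le> measure lborel A \<Longrightarrow> measure lborel (ball x r) / 2 \<le> measure lborel D \<Longrightarrow>
     infdist x E \<le> 10 * r \<Longrightarrow>
     ennreal (c1 * r powr (?n - 1 + \<beta>)) \<le> (\<integral>\<^sup>+y. G y * ennreal (infdist y E powr \<beta>) * indicator (ball x r) y \<partial>lborel)"
    using alt
  proof
    assume "\<beta> \<le> 0 \<and> emeasure lborel E = 0"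
    then have \<beta>: "\<beta> \<le> 0" and null: "emeasure lborel E = 0" by auto
    show ?thesis
    proof (rule that[of "\<theta> * (?V / (8 * 2 ^ DIM('a))) * 11 powr \<beta>"])
      show "0 < \<theta> * (?V / (8 * 2 ^ DIM('a))) * 11 powr \<beta>" using \<theta> by simp
    qed (rule admissible_weighted_near_nonpos[OF _ _ _ _ _ _ _ \<theta> _ _ _ \<beta> null E]; assumption)
  next
    assume "\<exists>\<nu> C. \<nu> < real DIM('a) - 1 \<and> 0 < C \<and>
       (\<forall>x r R. 0 < r \<longrightarrow> r \<le> R \<longrightarrow> emeasure lborel {y \<in> ball x R. infdist y E < r}
          \<le> ennreal (C * r powr (real DIM('a) - \<nu>) * R powr \<nu>))"
    then obtain \<nu> C where 1: "\<nu> < real DIM('a) - 1" "0 < C" and 2: "\<And>x r R. 0 < r \<Longrightarrow> r \<le> R \<Longrightarrow>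
      emeasure lborel {y \<in> ball x R. infdist y E < r} \<le> ennreal (C * r powr (real DIM('a) - \<nu>) * R powr \<nu>)"
      by blast
    show ?thesis
      by (rule admissible_weighted_near_dim[OF 1 \<theta> 2, where \<beta>=\<beta>]) (assumption | rule that)+
  qed
  define c2 where "c2 = \<theta> * (?V / (8 * 2 ^ DIM('a))) / 2 powr \<bar>\<beta>\<bar>"
  have c2: "c2 > 0" using \<theta> by (simp add: c2_def)
  define M1 where "M1 = K * 5 powr Q"
  define M2 where "M2 = 2 powr \<bar>Q - ?n\<bar> * ?V * 5 powr ?n"
  have M: "M1 > 0" "M2 > 0" using K by (auto simp: M1_def M2_def)
  define C where "C = M1 powr (1/q) / c1 + M2 powr (1/q) / c2"
  have C: "C > 0" using M c1 c2 by (simp add: C_def add_pos_pos)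
  have C1: "M1 powr (1/q) / c1 \<le> C" and C2: "M2 powr (1/q) / c2 \<le> C" using M c1 c2 by (auto simp: C_def)
  (* Turns a bound M * u^q for the weight of a ball and a lower bound c * u for t into the claim;
     u is r^(n-1+\<beta>) near E and d^\<beta> * r^(n-1) far from E. *)
  have conv: "M * u powr q \<le> (C * t) powr q" if "0 < M" "0 < c" "0 \<le> u" "c * u \<le> t" "M powr (1/q) / c \<le> C" for M c u t
  proof -
    have "M * u powr q = (M powr (1/q) / c * (c * u)) powr q"
      using that q by (simp add: powr_mult powr_powr)
    also have "\<dots> \<le> (C * t) powr q"
      using that q C by (intro powr_mono2 mult_mono) auto
    finally show ?thesis .
  qed
  show ?thesis
  proof (rule that[OF C])
    fix G :: "'a \<Rightarrow> ennreal" and A D :: "'a set" and x :: 'a and r t :: real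
    assume adm: "admissible_between G A D" and G: "G \<in> borel_measurable borel"
      and AD: "A \<in> sets borel" "D \<in> sets borel" and sub: "A \<subseteq> ball x r" "D \<subseteq> ball x r" and r: "0 < r"
      and dens: "\<theta> * measure lborel (ball x r) \<le> measure lborel A" "measure lborel (ball x r) / 2 \<le> measure lborel D"
      and t: "0 \<le> t" and int: "(\<integral>\<^sup>+y. G y * ennreal (infdist y E powr \<beta>) * indicator (ball x r) y \<partial>lborel) \<le> ennreal t"
    show "(\<integral>\<^sup>+y. ennreal (infdist y E powr (q * (?n - 1 + \<beta>) - ?n)) * indicator (ball x (5 * r)) y \<partial>lborel) \<le> ennreal ((C * t) powr q)"
    proof (cases "infdist x E \<le> 10 * r")
      case True
      have "ennreal (c1 * r powr (?n - 1 + \<beta>)) \<le> ennreal t"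
        using near_lower[OF adm G AD sub r dens True] int by (rule order_trans)
      then have le: "c1 * r powr (?n - 1 + \<beta>) \<le> t" using t by simp
      have "(\<integral>\<^sup>+y. ennreal (infdist y E powr (q * (?n - 1 + \<beta>) - ?n)) * indicator (ball x (5 * r)) y \<partial>lborel)
          \<le> ennreal (K * (5 * r) powr Q)"
        unfolding Q_def by (rule wball) (use r True in auto)
      also have "K * (5 * r) powr Q = M1 * (r powr (?n - 1 + \<beta>)) powr q"
        using r by (simp add: M1_def powr_mult powr_powr Q_def mult.commute[of q])
      also have "ennreal \<dots> \<le> ennreal ((C * t) powr q)"
        using conv[OF M(1) c1 _ le C1] by (intro ennreal_leI) auto
      finally show ?thesis .
    next
      case False
      let ?d = "infdist x E"
      have d: "10 * r < ?d" using False by auto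
      have "ennreal (c2 * (?d powr \<beta> * r powr (?n - 1))) \<le> ennreal t"
        using order_trans[OF admissible_weighted_far[OF adm G AD sub r \<theta> dens, of E \<beta>] int] d r by (simp add: c2_def)
      then have le: "c2 * (?d powr \<beta> * r powr (?n - 1)) \<le> t" using t by simp
      have "(\<integral>\<^sup>+y. ennreal (infdist y E powr (Q - ?n)) * indicator (ball x (5 * r)) y \<partial>lborel)
         \<le> (\<integral>\<^sup>+y. ennreal (2 powr \<bar>Q - ?n\<bar> * ?d powr (Q - ?n)) * indicator (ball x (5 * r)) y \<partial>lborel)"
      proof (intro nn_integral_mono)
        fix y
        show "ennreal (infdist y E powr (Q - ?n)) * indicator (ball x (5 * r)) y \<le> ennreal (2 powr \<bar>Q - ?n\<bar> * ?d powr (Q - ?n)) * indicator (ball x (5 * r)) y"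
        proof (cases "y \<in> ball x (5 * r)")
          case True
          have "infdist y E powr (Q - ?n) \<le> 2 powr \<bar>Q - ?n\<bar> * ?d powr (Q - ?n)"
            using infdist_ball_bounds[OF True, of E] d r by (intro powr_comparable) auto
          then show ?thesis using True by (simp add: ennreal_leI)
        qed auto
      qed
      also have "\<dots> = ennreal (2 powr \<bar>Q - ?n\<bar> * ?d powr (Q - ?n)) * ennreal (?V * (5 * r) powr ?n)"
        using r by (simp add: nn_integral_cmult_indicator emeasure_ball_powr)
      also have "\<dots> = ennreal (M2 * (?d powr (Q - ?n) * r powr ?n))"
        using r by (subst ennreal_mult''[symmetric]) (auto simp: M2_def powr_mult mult_ac)
      also have "\<dots> \<le> ennreal (M2 * (?d powr \<beta> * r powr (?n - 1)) powr q)"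
      proof (intro ennreal_leI mult_left_mono)
        have dp: "?d > 0" using d r by linarith
        have "?d powr (Q - ?n) = ?d powr (\<beta> * q) * ?d powr (q * (?n - 1) - ?n)"
          by (simp add: powr_add[symmetric] Q_def algebra_simps)
        also have "\<dots> \<le> ?d powr (\<beta> * q) * r powr (q * (?n - 1) - ?n)"
          using q d r by (intro mult_left_mono powr_mono2') auto
        finally have "?d powr (Q - ?n) * r powr ?n \<le> ?d powr (\<beta> * q) * r powr (q * (?n - 1) - ?n) * r powr ?n"
          by (intro mult_right_mono) auto
        also have "\<dots> = ?d powr (\<beta> * q) * r powr ((?n - 1) * q)"
          by (simp add: powr_add[symmetric] mult.assoc mult.commute[of q])
        also have "\<dots> = (?d powr \<beta> * r powr (?n - 1)) powr q"
          by (simp add: powr_mult powr_powr)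
        finally show "?d powr (Q - ?n) * r powr ?n \<le> (?d powr \<beta> * r powr (?n - 1)) powr q" .
      qed (use M in auto)
      also have "\<dots> \<le> ennreal ((C * t) powr q)"
        using conv[OF M(2) c2 _ le C2] by (intro ennreal_leI) auto
      finally show ?thesis by (simp add: Q_def)
    qed
  qed
qed

lemma sum_powr_le_powr_sum:
  fixes a :: "'b \<Rightarrow> real"
  assumes "finite S" "\<And>i. i \<in> S \<Longrightarrow> 0 \<le> a i" "1 \<le> q"
  shows "(\<Sum>i\<in>S. a i powr q) \<le> (\<Sum>i\<in>S. a i) powr q"
proof -
  let ?T = "\<Sum>i\<in>S. a i"
  have T: "?T \<ge> 0" using assms by (intro sum_nonneg) auto
  have pw: "u powr q = u * u powr (q - 1)" if "u \<ge> 0" for u :: real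
    using that by (cases "u = 0") (auto simp: powr_diff)
  have "(\<Sum>i\<in>S. a i powr q) = (\<Sum>i\<in>S. a i * a i powr (q - 1))"
    using assms by (intro sum.cong) (auto simp: pw)
  also have "\<dots> \<le> (\<Sum>i\<in>S. a i * ?T powr (q - 1))"
    using assms by (intro sum_mono mult_left_mono powr_mono2 member_le_sum) auto
  also have "\<dots> = ?T powr q" using T by (simp add: pw sum_distrib_right)
  finally show ?thesis .
qed

text \<open>
  Around a point of \<open>K = {\<bar>f\<bar> \<ge> s + \<sigma>}\<close> the ball of radius \<open>\<rho>\<close> lies in \<open>U = {\<bar>f\<bar> > s}\<close>, while balls of
  radius \<open>2 ^ k * \<rho>\<close> with \<open>k\<close> large are mostly outside of \<open>U\<close>.  At the first \<open>k\<close> for which less than half of the ball is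
  in \<open>U\<close>, the previous radius shows that still a fixed part of it is.  The layer \<open>W h = {s < \<bar>f\<bar> < s + h}\<close>
  shrinks to the empty set as \<open>h\<close> tends to 0, and all radii are at least \<open>\<rho>\<close>; hence for small \<open>h\<close> a fixed
  part of each of these balls is in \<open>{\<bar>f\<bar> \<ge> s + h}\<close>, and \<open>iso\<close> applies to them.  This is why
  the bound on \<open>h\<close> depends on \<open>s\<close> and \<open>\<sigma>\<close>.
\<close>
lemma level_set_estimate:
  fixes f :: "'a::euclidean_space \<Rightarrow> real" and w v :: "'a \<Rightarrow> ennreal"
  assumes df: "\<And>y. GDERIV f y :> F y" and F: "continuous_on UNIV F" and supp: "bounded {y. f y \<noteq> 0}"
    and [measurable]: "w \<in> borel_measurable borel" "v \<in> borel_measurable borel"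
    and q: "1 \<le> q" and C: "0 < C"
    and iso: "\<And>G A D x r t. admissible_between G A D \<Longrightarrow> G \<in> borel_measurable borel \<Longrightarrow>
     A \<in> sets borel \<Longrightarrow> D \<in> sets borel \<Longrightarrow> A \<subseteq> ball x r \<Longrightarrow> D \<subseteq> ball x r \<Longrightarrow> 0 < r \<Longrightarrow>
     (1/2) ^ (DIM('a) + 2) * measure lborel (ball x r) \<le> measure lborel A \<Longrightarrow> measure lborel (ball x r) / 2 \<le> measure lborel D \<Longrightarrow>
     0 \<le> t \<Longrightarrow> (\<integral>\<^sup>+y. G y * v y * indicator (ball x r) y \<partial>lborel) \<le> ennreal t \<Longrightarrow>
     (\<integral>\<^sup>+y. w y * indicator (ball x (5 * r)) y \<partial>lborel) \<le> ennreal ((C * t) powr q)"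
    and s: "0 < s" and \<sigma>: "0 < \<sigma>"
  shows "\<exists>h0>0. \<forall>h t. 0 < h \<longrightarrow> h < h0 \<longrightarrow> 0 \<le> t \<longrightarrow>
     (\<integral>\<^sup>+y. ennreal (norm (F y) / h) * indicator {y. s < \<bar>f y\<bar> \<and> \<bar>f y\<bar> < s + h} y * v y \<partial>lborel) \<le> ennreal t \<longrightarrow>
     (\<integral>\<^sup>+y. w y * indicator {y. s + \<sigma> \<le> \<bar>f y\<bar>} y \<partial>lborel) \<le> ennreal ((C * t) powr q)"
proof -
  let ?n = "real DIM('a)" and ?V = "unit_ball_vol (real DIM('a))"
  have contf: "continuous_on UNIV f"
    using df by (auto simp: gderiv_def intro!: continuous_at_imp_continuous_on has_derivative_continuous)
  have [measurable]: "f \<in> borel_measurable borel" "F \<in> borel_measurable borel"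
    using contf F by (auto intro: borel_measurable_continuous_onI)
  define U where "U = {y. s < \<bar>f y\<bar>}"
  define K where "K = {y. s + \<sigma> \<le> \<bar>f y\<bar>}"
  have Uo: "open U" unfolding U_def by (intro open_Collect_less continuous_intros contf)
  have Us[measurable]: "U \<in> sets borel" using Uo by simp
  have Ub: "bounded U" using supp s by (rule_tac bounded_subset) (auto simp: U_def)
  have "closed K" unfolding K_def by (intro closed_Collect_le continuous_intros contf)
  moreover have KU: "K \<subseteq> U" using \<sigma> by (auto simp: K_def U_def)
  ultimately have K: "compact K" using Ub bounded_subset compact_eq_bounded_closed by blast
  have [measurable]: "K \<in> sets borel" using K by (simp add: borel_compact)
  obtain \<rho> where \<rho>: "\<rho> > 0" "(\<Union>x\<in>K. ball x \<rho>) \<subseteq> U"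
    using compact_subset_open_imp_ball_epsilon_subset[OF K Uo KU] by metis
  obtain R0 where R0: "R0 > 0" "U \<subseteq> ball 0 R0" using Ub bounded_subset_ballD by blast
  (* The factor 4 makes the volume of ball 0 R0 at most a quarter of that of a ball of radius
     2^k0 * \<rho> in every dimension. *)
  obtain k0 where k0: "4 * R0 / \<rho> < 2 ^ k0" using real_arch_pow[of 2 "4 * R0 / \<rho>"] by auto
  define small where "small x k \<longleftrightarrow> measure lborel (U \<inter> ball x (2 ^ k * \<rho>)) < measure lborel (ball x (2 ^ k * \<rho>)) / 2" for x k
  have ballfin: "A \<subseteq> ball x r \<Longrightarrow> A \<in> sets borel \<Longrightarrow> A \<in> fmeasurable lborel" for A and x :: 'a and r
    using bounded_subset[OF bounded_ball, of A x r] emeasure_bounded_finite[of A] by (intro fmeasurableI) auto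
  have small_k0: "small x k0" for x
  proof -
    have pos: "2 ^ k0 * \<rho> > 0" using \<rho> by simp
    have "4 * R0 \<le> 2 ^ k0 * \<rho>" using k0 \<rho> by (simp add: field_simps)
    then have R: "R0 \<le> 2 ^ k0 * \<rho> / 4" by simp
    have "measure lborel (U \<inter> ball x (2 ^ k0 * \<rho>)) \<le> measure lborel (ball (0::'a) R0)"
      using R0 by (intro measure_mono_fmeasurable ballfin[of _ 0 R0]) auto
    also have "\<dots> = ?V * R0 powr ?n" using R0 by (simp add: measure_ball_powr)
    also have "\<dots> \<le> ?V * (2 ^ k0 * \<rho> / 4) powr ?n" using R R0 by (intro mult_left_mono powr_mono2) auto
    also have "\<dots> = (1/4) powr ?n * (?V * (2 ^ k0 * \<rho>) powr ?n)" using pos by (simp add: powr_mult powr_divide)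
    also have "\<dots> \<le> (1/4) powr 1 * (?V * (2 ^ k0 * \<rho>) powr ?n)"
      by (intro mult_right_mono powr_mono') (auto simp: DIM_ge_Suc0)
    also have "\<dots> < (1/2) * (?V * (2 ^ k0 * \<rho>) powr ?n)" using pos by (intro mult_strict_right_mono mult_pos_pos) auto
    also have "\<dots> = measure lborel (ball x (2 ^ k0 * \<rho>)) / 2" using pos by (simp add: measure_ball_powr)
    finally show ?thesis by (simp add: small_def)
  qed
  define k where "k x = (LEAST k. small x k)" for x
  have k: "small x (k x)" "k x \<le> k0" for x unfolding k_def using small_k0 by (auto intro: LeastI Least_le)
  have kmin: "\<not> small x j" if "j < k x" for x j using that not_less_Least unfolding k_def by blast
  define r where "r x = 2 ^ k x * \<rho>" for x
  have r: "r x > 0" "\<rho> \<le> r x" "r x \<le> 2 ^ k0 * \<rho>" for x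
    using \<rho> k(2)[of x] by (auto simp: r_def)
  have outer: "measure lborel (ball x (r x)) / 2 \<le> measure lborel (ball x (r x) - U)" for x
  proof -
    have "ball x (r x) - U = ball x (r x) - U \<inter> ball x (r x)" by auto
    also have "measure lborel \<dots> = measure lborel (ball x (r x)) - measure lborel (U \<inter> ball x (r x))"
      by (intro measurable_measure_Diff) (auto intro!: ballfin[of _ x "r x"])
    finally have "measure lborel (ball x (r x) - U) = measure lborel (ball x (r x)) - measure lborel (U \<inter> ball x (r x))" .
    then show ?thesis using k(1)[of x] by (simp add: small_def r_def)
  qed
  have inner: "(1/2) ^ (DIM('a) + 1) * measure lborel (ball x (r x)) \<le> measure lborel (U \<inter> ball x (r x))" if x: "x \<in> K" for x
  proof -
    have "\<not> small x 0"
    proof -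
      have "U \<inter> ball x \<rho> = ball x \<rho>" using \<rho> x by auto
      then show ?thesis using \<rho> by (simp add: small_def)
    qed
    then obtain j where j: "k x = Suc j" using k(1)[of x] by (metis not0_implies_Suc)
    have rj: "2 ^ j * \<rho> = r x / 2" by (simp add: r_def j)
    have "measure lborel (ball x (r x / 2)) / 2 \<le> measure lborel (U \<inter> ball x (r x / 2))"
      using kmin[of j x] j rj by (simp add: small_def)
    also have "\<dots> \<le> measure lborel (U \<inter> ball x (r x))"
      using r(1)[of x] by (intro measure_mono_fmeasurable ballfin[of _ x "r x"]) auto
    finally show ?thesis using r(1)[of x] by (simp add: content_ball power_divide)
  qed
  define W where "W h = {y. s < \<bar>f y\<bar> \<and> \<bar>f y\<bar> < s + h}" for h
  have Wm[measurable]: "W h \<in> sets borel" for h unfolding W_def by measurable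
  have Wmono: "W h \<subseteq> W h'" if "h \<le> h'" for h h' using that by (auto simp: W_def)
  have WU: "W h \<subseteq> U" for h by (auto simp: W_def U_def)
  have Wf: "W h \<in> fmeasurable lborel" for h using WU R0 by (intro ballfin[of _ 0 R0]) auto
  have "(\<lambda>i. measure lborel (W (1 / real (Suc i)))) \<longlonglongrightarrow> measure lborel (\<Inter>i. W (1 / real (Suc i)))"
  proof (intro Lim_measure_decseq)
    show "decseq (\<lambda>i. W (1 / real (Suc i)))"
      by (intro decseq_SucI Wmono) (simp add: frac_le)
    show "emeasure lborel (W (1 / real (Suc i))) \<noteq> \<infinity>" for i using fmeasurableD2[OF Wf] by simp
  qed auto
  moreover have "(\<Inter>i. W (1 / real (Suc i))) = {}"
  proof (rule ccontr)
    assume "\<not> ?thesis"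
    then obtain y where y: "\<And>i. y \<in> W (1 / real (Suc i))" by auto
    then have "\<bar>f y\<bar> - s > 0" by (auto simp: W_def)
    then obtain i where "1 / real (Suc i) < \<bar>f y\<bar> - s" using nat_approx_posE by metis
    then show False using y[of i] by (auto simp: W_def)
  qed
  ultimately have "(\<lambda>i. measure lborel (W (1 / real (Suc i)))) \<longlonglongrightarrow> 0" by simp
  moreover define \<delta> where "\<delta> = (1/2) ^ (DIM('a) + 2) * (?V * \<rho> powr ?n)"
  have "\<delta> > 0" using \<rho> by (simp add: \<delta>_def)
  ultimately obtain i where i: "measure lborel (W (1 / real (Suc i))) < \<delta>"
    using order_tendstoD(2) eventually_sequentially by (metis (no_types, lifting) order_refl)
  show ?thesis
  proof (intro exI[of _ "1 / real (Suc i)"] conjI allI impI)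
    show "0 < 1 / real (Suc i)" by simp
  next
    fix h t :: real
    assume h: "0 < h" "h < 1 / real (Suc i)" and t: "0 \<le> t"
      and int: "(\<integral>\<^sup>+y. ennreal (norm (F y) / h) * indicator {y. s < \<bar>f y\<bar> \<and> \<bar>f y\<bar> < s + h} y * v y \<partial>lborel) \<le> ennreal t"
    define G where "G y = ennreal (norm (F y) / h) * indicator (W h) y" for y
    have G[measurable]: "G \<in> borel_measurable borel" unfolding G_def by measurable
    define A where "A x = {y. s + h \<le> \<bar>f y\<bar>} \<inter> ball x (r x)" for x
    define D where "D x = ball x (r x) - U" for x
    have Am: "A x \<in> sets borel" for x unfolding A_def by measurable
    have Dm: "D x \<in> sets borel" for x unfolding D_def using Us by simp
    have adm: "admissible_between G (A x) (D x)" for x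
      unfolding admissible_between_def G_def W_def
    proof (intro ballI)
      fix a d assume "a \<in> A x" "d \<in> D x"
      then show "1 \<le> ennreal (dist a d) * (\<integral>\<^sup>+ \<tau>. ennreal (norm (F (a + \<tau> *\<^sub>R (d - a))) / h) *
        indicator {y. s < \<bar>f y\<bar> \<and> \<bar>f y\<bar> < s + h} (a + \<tau> *\<^sub>R (d - a)) * indicator {0..1} \<tau> \<partial>lborel)"
        by (intro segment_crossing[OF df F h(1)]) (auto simp: A_def D_def U_def)
    qed
    have densA: "(1/2) ^ (DIM('a) + 2) * measure lborel (ball x (r x)) \<le> measure lborel (A x)" if x: "x \<in> K" for x
    proof -
      have "measure lborel (W h) \<le> measure lborel (W (1 / real (Suc i)))"
        using h by (intro measure_mono_fmeasurable Wf) (auto simp: W_def)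
      also have "\<dots> \<le> \<delta>" using i by simp
      also have "\<dots> \<le> (1/2) ^ (DIM('a) + 2) * (?V * r x powr ?n)"
        unfolding \<delta>_def using \<rho> r(2)[of x] by (intro mult_left_mono powr_mono2) auto
      also have "\<dots> = (1/2) ^ (DIM('a) + 2) * measure lborel (ball x (r x))" using r(1)[of x] by (simp add: measure_ball_powr)
      finally have W: "measure lborel (W h) \<le> (1/2) ^ (DIM('a) + 2) * measure lborel (ball x (r x))" .
      have "measure lborel (U \<inter> ball x (r x)) \<le> measure lborel (A x \<union> W h)"
        using Am Wm by (intro measure_mono_fmeasurable fmeasurable.Un Wf ballfin[of "A x" x "r x"])
           (auto simp: U_def A_def W_def)
      also have "\<dots> \<le> measure lborel (A x) + measure lborel (W h)"
        using Am Wm by (intro measure_Un_le) auto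
      finally show ?thesis using inner[OF x] W by simp
    qed
    obtain S where S: "finite S" "S \<subseteq> K" "disjoint_family_on (\<lambda>x. ball x (r x)) S" "K \<subseteq> (\<Union>x\<in>S. ball x (5 * r x))"
      by (rule vitali_finite_cover[OF K, of r "2 ^ k0 * \<rho>"]) (use r in auto)
    define T where "T x = (\<integral>\<^sup>+y. G y * v y * indicator (ball x (r x)) y \<partial>lborel)" for x
    have bm[measurable]: "ball x a \<in> sets borel" for x :: 'a and a by simp
    have sumT: "(\<Sum>x\<in>S. T x) \<le> ennreal t"
    proof -
      have "(\<Sum>x\<in>S. T x) = (\<integral>\<^sup>+y. (\<Sum>x\<in>S. G y * v y * indicator (ball x (r x)) y) \<partial>lborel)"
        unfolding T_def by (subst nn_integral_sum) auto
      also have "\<dots> \<le> (\<integral>\<^sup>+y. G y * v y \<partial>lborel)"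
      proof (intro nn_integral_mono)
        fix y
        have "(\<Sum>x\<in>S. indicator (ball x (r x)) y :: ennreal) = indicator (\<Union>x\<in>S. ball x (r x)) y"
          by (rule indicator_UN_disjoint[symmetric, OF S(1,3)])
        also have "\<dots> \<le> 1" by (simp add: indicator_def)
        finally have "G y * v y * (\<Sum>x\<in>S. indicator (ball x (r x)) y) \<le> G y * v y * 1" by (intro mult_left_mono) auto
        then show "(\<Sum>x\<in>S. G y * v y * indicator (ball x (r x)) y) \<le> G y * v y" by (simp add: sum_distrib_left)
      qed
      also have "\<dots> \<le> ennreal t" using int by (simp add: G_def W_def)
      finally show ?thesis .
    qed
    have Tfin: "T x = ennreal (enn2real (T x))" if "x \<in> S" for x
    proof -
      have "T x \<le> (\<Sum>x\<in>S. T x)" using that S(1) by (intro member_le_sum) auto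
      also have "\<dots> < \<infinity>" using sumT by (simp add: le_less_trans)
      finally show ?thesis by simp
    qed
    have sumt: "(\<Sum>x\<in>S. enn2real (T x)) \<le> t"
    proof -
      have "ennreal (\<Sum>x\<in>S. enn2real (T x)) = (\<Sum>x\<in>S. ennreal (enn2real (T x)))" by (rule sum_ennreal[symmetric]) simp
      also have "\<dots> = (\<Sum>x\<in>S. T x)" using Tfin by (intro sum.cong) auto
      also have "\<dots> \<le> ennreal t" by (rule sumT)
      finally show ?thesis using t by simp
    qed
    have "(\<integral>\<^sup>+y. w y * indicator K y \<partial>lborel) \<le> (\<integral>\<^sup>+y. (\<Sum>x\<in>S. w y * indicator (ball x (5 * r x)) y) \<partial>lborel)"
    proof (intro nn_integral_mono)
      fix y
      have "indicator K y \<le> (\<Sum>x\<in>S. indicator (ball x (5 * r x)) y :: ennreal)"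
      proof (cases "y \<in> K")
        case True
        then obtain x where x: "x \<in> S" "y \<in> ball x (5 * r x)" using S(4) by auto
        have "indicator K y \<le> (indicator (ball x (5 * r x)) y :: ennreal)" using x by (simp add: indicator_def)
        also have "\<dots> \<le> (\<Sum>x\<in>S. indicator (ball x (5 * r x)) y)" using x S(1) by (intro member_le_sum) auto
        finally show ?thesis .
      qed auto
      then have "w y * indicator K y \<le> w y * (\<Sum>x\<in>S. indicator (ball x (5 * r x)) y)" by (intro mult_left_mono) auto
      then show "w y * indicator K y \<le> (\<Sum>x\<in>S. w y * indicator (ball x (5 * r x)) y)" by (simp add: sum_distrib_left)
    qed
    also have "\<dots> = (\<Sum>x\<in>S. \<integral>\<^sup>+y. w y * indicator (ball x (5 * r x)) y \<partial>lborel)"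
      by (subst nn_integral_sum) auto
    also have "\<dots> \<le> (\<Sum>x\<in>S. ennreal ((C * enn2real (T x)) powr q))"
    proof (intro sum_mono)
      fix x assume x: "x \<in> S"
      then have xK: "x \<in> K" using S by auto
      show "(\<integral>\<^sup>+y. w y * indicator (ball x (5 * r x)) y \<partial>lborel) \<le> ennreal ((C * enn2real (T x)) powr q)"
      proof (rule iso[OF adm[of x] G Am[of x] Dm[of x] _ _ r(1)])
        show "A x \<subseteq> ball x (r x)" "D x \<subseteq> ball x (r x)" by (auto simp: A_def D_def)
        show "measure lborel (ball x (r x)) / 2 \<le> measure lborel (D x)" using outer by (simp add: D_def)
        show "(\<integral>\<^sup>+y. G y * v y * indicator (ball x (r x)) y \<partial>lborel) \<le> ennreal (enn2real (T x))"
          using Tfin[OF x] by (simp add: T_def)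
      qed (use densA[OF xK] in auto)
    qed
    also have "\<dots> = ennreal (\<Sum>x\<in>S. (C * enn2real (T x)) powr q)" by (rule sum_ennreal) simp
    also have "\<dots> \<le> ennreal ((\<Sum>x\<in>S. C * enn2real (T x)) powr q)"
      using C q S(1) by (intro ennreal_leI sum_powr_le_powr_sum) auto
    also have "\<dots> \<le> ennreal ((C * t) powr q)"
      using C q sumt by (intro ennreal_leI powr_mono2) (auto simp: sum_distrib_left[symmetric] intro!: sum_nonneg mult_nonneg_nonneg)
    finally show "(\<integral>\<^sup>+y. w y * indicator {y. s + \<sigma> \<le> \<bar>f y\<bar>} y \<partial>lborel) \<le> ennreal ((C * t) powr q)"
      by (simp add: K_def)
  qed
qed

section \<open>From level sets to functions\<close>

lemma nn_integral_powr_below: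
  fixes u \<gamma> :: real
  assumes "0 \<le> u" "0 < \<gamma>"
  shows "(\<integral>\<^sup>+s. ennreal (\<gamma> * s powr (\<gamma> - 1)) * indicator {s. 0 < s \<and> s < u} s \<partial>lborel) = ennreal (u powr \<gamma>)"
proof -
  have "((\<lambda>s. s powr (\<gamma> - 1)) has_integral (u powr \<gamma> / \<gamma>)) {0..u}"
    using has_integral_powr_from_0[of "\<gamma> - 1" u] assms by simp
  then have "((\<lambda>s. \<gamma> * s powr (\<gamma> - 1)) has_integral (\<gamma> * (u powr \<gamma> / \<gamma>))) {0..u}"
    by (rule has_integral_mult_right)
  then have hi: "((\<lambda>s. \<gamma> * s powr (\<gamma> - 1)) has_integral (u powr \<gamma>)) {0..u}" using assms by simp
  have "(\<integral>\<^sup>+s. ennreal (\<gamma> * s powr (\<gamma> - 1)) * indicator {s. 0 < s \<and> s < u} s \<partial>lborel)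
      = (\<integral>\<^sup>+s. ennreal (\<gamma> * s powr (\<gamma> - 1)) * indicator {0..u} s \<partial>lborel)"
  proof (rule nn_integral_cong_AE)
    have "AE s in lborel. s \<noteq> (0::real)" "AE s in lborel. s \<noteq> u" by (rule AE_lborel_singleton)+
    then show "AE s in lborel. ennreal (\<gamma> * s powr (\<gamma> - 1)) * indicator {s. 0 < s \<and> s < u} s = ennreal (\<gamma> * s powr (\<gamma> - 1)) * indicator {0..u} s"
      by eventually_elim (auto simp: indicator_def)
  qed
  also have "\<dots> = (\<integral>\<^sup>+s. ennreal (indicator {0..u} s * (\<gamma> * s powr (\<gamma> - 1))) \<partial>lborel)"
    by (intro nn_integral_cong) (auto simp: indicator_def)
  also have "\<dots> = ennreal (u powr \<gamma>)"
  proof (rule nn_integral_has_integral_lborel)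
    show "((\<lambda>s. indicator {0..u} s * (\<gamma> * s powr (\<gamma> - 1))) has_integral u powr \<gamma>) UNIV"
    proof -
      have "(\<lambda>s. indicator {0..u} s * (\<gamma> * s powr (\<gamma> - 1))) = (\<lambda>s. if s \<in> {0..u} then \<gamma> * s powr (\<gamma> - 1) else 0)"
        by (auto simp: fun_eq_iff indicator_def)
      then show ?thesis using hi by (simp only: has_integral_restrict_UNIV)
    qed
  qed (use assms in \<open>auto simp: indicator_def\<close>)
  finally show ?thesis .
qed

text \<open>
  A substitute for the coarea formula.  The density of the layer \<open>{s < \<bar>f\<bar> < s + h}\<close>, divided by \<open>h\<close>,
  has an integral over \<open>s\<close> that does not exceed the integral of the gradient, because for fixed \<open>y\<close> the
  admissible \<open>s\<close> form an interval of length \<open>h\<close>.  Fatou's lemma passes to the limit \<open>h \<rightarrow> 0\<close>, in which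
  \<open>level\<close> holds for every \<open>\<sigma> > 0\<close>.  The factor \<open>\<gamma> * s powr (\<gamma> - 1)\<close> is the
  change of variables from the levels of \<open>\<bar>f\<bar>\<close> to those of \<open>\<bar>f\<bar> powr \<gamma>\<close>.
\<close>
lemma weighted_coarea_bound:
  fixes f :: "'a::euclidean_space \<Rightarrow> real" and w v :: "'a \<Rightarrow> ennreal"
  assumes [measurable]: "f \<in> borel_measurable borel" "F \<in> borel_measurable borel" "w \<in> borel_measurable borel" "v \<in> borel_measurable borel"
    and q: "1 \<le> q" and C: "0 < C" and \<gamma>: "1 \<le> \<gamma>"
    and fin: "emeasure (density lborel w) {y. f y \<noteq> 0} < \<infinity>"
    and level: "\<And>s \<sigma>. 0 < s \<Longrightarrow> 0 < \<sigma> \<Longrightarrow> \<exists>h0>0. \<forall>h t. 0 < h \<longrightarrow> h < h0 \<longrightarrow> 0 \<le> t \<longrightarrow>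
     (\<integral>\<^sup>+y. ennreal (norm (F y :: 'a) / h) * indicator {y. s < \<bar>f y\<bar> \<and> \<bar>f y\<bar> < s + h} y * v y \<partial>lborel) \<le> ennreal t \<longrightarrow>
     (\<integral>\<^sup>+y. w y * indicator {y. s + \<sigma> \<le> \<bar>f y\<bar>} y \<partial>lborel) \<le> ennreal ((C * t) powr q)"
  shows "(\<integral>\<^sup>+s. ennreal (\<gamma> * s powr (\<gamma> - 1) * measure (density lborel w) {y. s < \<bar>f y\<bar>} powr (1 / q)) * indicator {0<..} s \<partial>lborel)
    \<le> ennreal C * (\<integral>\<^sup>+y. ennreal (\<gamma> * \<bar>f y\<bar> powr (\<gamma> - 1) * norm (F y)) * v y \<partial>lborel)"
proof -
  let ?M = "density lborel w"
  define h where "h k = 1 / real (Suc k)" for k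
  have h: "h k > 0" for k by (simp add: h_def)
  have h0: "h \<longlonglongrightarrow> 0" unfolding h_def by (rule LIMSEQ_Suc[OF lim_1_over_n])
  define \<Phi> where "\<Phi> k s = (\<integral>\<^sup>+y. ennreal (norm (F y) / h k) * indicator {y. s < \<bar>f y\<bar> \<and> \<bar>f y\<bar> < s + h k} y * v y \<partial>lborel)" for k s
  have step1: "ennreal (a * measure ?M {y. s < \<bar>f y\<bar>} powr (1 / q)) \<le> liminf (\<lambda>k. ennreal (C * a) * \<Phi> k s)"
    if s: "0 < s" and a: "0 \<le> a" for s a
  proof -
    define X where "X i = {y. s + h i \<le> \<bar>f y\<bar>}" for i
    have [measurable]: "X i \<in> sets borel" for i unfolding X_def by measurable
    have finX: "emeasure ?M A < \<infinity>" if "A \<subseteq> {y. f y \<noteq> 0}" "A \<in> sets borel" for A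
    proof -
      have "emeasure ?M A \<le> emeasure ?M {y. f y \<noteq> 0}" using that by (intro emeasure_mono) auto
      then show ?thesis using fin by (rule le_less_trans)
    qed
    have sub: "X i \<subseteq> {y. f y \<noteq> 0}" for i using s h[of i] by (auto simp: X_def)
    have le: "ennreal (a * measure ?M (X i) powr (1 / q)) \<le> liminf (\<lambda>k. ennreal (C * a) * \<Phi> k s)" for i
    proof (rule Liminf_bounded)
      obtain h0 where h0': "h0 > 0" and lev: "\<And>e t. 0 < e \<Longrightarrow> e < h0 \<Longrightarrow> 0 \<le> t \<Longrightarrow>
         (\<integral>\<^sup>+y. ennreal (norm (F y) / e) * indicator {y. s < \<bar>f y\<bar> \<and> \<bar>f y\<bar> < s + e} y * v y \<partial>lborel) \<le> ennreal t \<Longrightarrow>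
         (\<integral>\<^sup>+y. w y * indicator {y. s + h i \<le> \<bar>f y\<bar>} y \<partial>lborel) \<le> ennreal ((C * t) powr q)"
        using level[OF s h[of i]] by blast
      have "eventually (\<lambda>k. h k < h0) sequentially" using order_tendstoD(2)[OF h0 h0'] .
      then show "\<forall>\<^sub>F k in sequentially. ennreal (a * measure ?M (X i) powr (1 / q)) \<le> ennreal (C * a) * \<Phi> k s"
      proof eventually_elim
        case (elim k)
        show ?case
        proof (cases "a = 0 \<or> \<Phi> k s = \<infinity>")
          case True
          then show ?thesis using a C by (auto simp: ennreal_mult_top)
        next
          case False
          then obtain t where t: "\<Phi> k s = ennreal t" "0 \<le> t" by (cases "\<Phi> k s") auto
          have "emeasure ?M (X i) \<le> ennreal ((C * t) powr q)"
            using lev[OF h[of k] elim t(2)] t(1) by (simp add: \<Phi>_def emeasure_density X_def)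
          moreover have "emeasure ?M (X i) = ennreal (measure ?M (X i))"
            using finX[OF sub[of i]] by (intro emeasure_eq_ennreal_measure) (auto simp: less_top)
          ultimately have "measure ?M (X i) \<le> (C * t) powr q" by simp
          then have "measure ?M (X i) powr (1/q) \<le> ((C * t) powr q) powr (1/q)" using q by (intro powr_mono2) auto
          also have "\<dots> = C * t" using q C t by (simp add: powr_powr)
          finally have "a * measure ?M (X i) powr (1/q) \<le> a * (C * t)" using a by (intro mult_left_mono)
          then have "ennreal (a * measure ?M (X i) powr (1/q)) \<le> ennreal (C * a * t)" by (intro ennreal_leI) (simp add: mult_ac)
          also have "\<dots> = ennreal (C * a) * \<Phi> k s" unfolding t(1) using t(2) a C by (intro ennreal_mult) auto
          finally show ?thesis .
        qed
      qed
    qed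
    have "(\<lambda>i. measure ?M (X i)) \<longlonglongrightarrow> measure ?M (\<Union>i. X i)"
    proof (intro Lim_measure_incseq)
      have h_dec: "h (Suc i) \<le> h i" for i unfolding h_def by (simp add: frac_le)
      have "X i \<subseteq> X (Suc i)" for i
      proof
        fix y assume "y \<in> X i"
        then show "y \<in> X (Suc i)" using h_dec[of i] unfolding X_def by simp
      qed
      then show "incseq X" by (rule incseq_SucI)
      have "(\<Union>i. X i) \<subseteq> {y. f y \<noteq> 0}" using sub by auto
      then show "emeasure ?M (\<Union>i. X i) \<noteq> \<infinity>" using finX[of "\<Union>i. X i"] by auto
    qed auto
    moreover have "(\<Union>i. X i) = {y. s < \<bar>f y\<bar>}"
    proof (intro equalityI subsetI)
      fix y assume "y \<in> {y. s < \<bar>f y\<bar>}"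
      then have "\<bar>f y\<bar> - s > 0" by simp
      then obtain i where "h i < \<bar>f y\<bar> - s" unfolding h_def using nat_approx_posE by metis
      then show "y \<in> (\<Union>i. X i)" by (auto simp: X_def intro!: exI[of _ i])
    next
      fix y assume "y \<in> (\<Union>i. X i)"
      then obtain i where "s + h i \<le> \<bar>f y\<bar>" by (auto simp: X_def)
      then show "y \<in> {y. s < \<bar>f y\<bar>}" using h[of i] by auto
    qed
    ultimately have "(\<lambda>i. measure ?M (X i)) \<longlonglongrightarrow> measure ?M {y. s < \<bar>f y\<bar>}" by simp
    then have "(\<lambda>i. ennreal (a * measure ?M (X i) powr (1 / q))) \<longlonglongrightarrow> ennreal (a * measure ?M {y. s < \<bar>f y\<bar>} powr (1 / q))"
      using q by (intro tendsto_ennrealI tendsto_mult tendsto_const tendsto_powr') auto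
    then show ?thesis by (rule LIMSEQ_le_const2) (use le in auto)
  qed
  have bound: "(\<integral>\<^sup>+s. ennreal (C * (\<gamma> * s powr (\<gamma> - 1))) * \<Phi> k s * indicator {0<..} s \<partial>lborel)
      \<le> ennreal C * (\<integral>\<^sup>+y. ennreal (\<gamma> * \<bar>f y\<bar> powr (\<gamma> - 1) * norm (F y)) * v y \<partial>lborel)" for k
  proof -
    have "(\<integral>\<^sup>+s. ennreal (C * (\<gamma> * s powr (\<gamma> - 1))) * \<Phi> k s * indicator {0<..} s \<partial>lborel)
       = (\<integral>\<^sup>+s. \<integral>\<^sup>+y. ennreal (C * (\<gamma> * s powr (\<gamma> - 1))) * (ennreal (norm (F y) / h k) * indicator {y. s < \<bar>f y\<bar> \<and> \<bar>f y\<bar> < s + h k} y * v y) * indicator {0<..} s \<partial>lborel \<partial>lborel)"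
      unfolding \<Phi>_def by (intro nn_integral_cong) (simp add: nn_integral_cmult nn_integral_multc)
    also have "\<dots> = (\<integral>\<^sup>+y. \<integral>\<^sup>+s. ennreal (C * (\<gamma> * s powr (\<gamma> - 1))) * (ennreal (norm (F y) / h k) * indicator {y. s < \<bar>f y\<bar> \<and> \<bar>f y\<bar> < s + h k} y * v y) * indicator {0<..} s \<partial>lborel \<partial>lborel)"
      by (intro lborel_pair.Fubini') measurable
    also have "\<dots> \<le> (\<integral>\<^sup>+y. ennreal C * (ennreal (\<gamma> * \<bar>f y\<bar> powr (\<gamma> - 1) * norm (F y)) * v y) \<partial>lborel)"
    proof (intro nn_integral_mono)
      fix y
      let ?c = "ennreal (C * (\<gamma> * \<bar>f y\<bar> powr (\<gamma> - 1))) * (ennreal (norm (F y) / h k) * v y)"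
      have "(\<integral>\<^sup>+s. ennreal (C * (\<gamma> * s powr (\<gamma> - 1))) * (ennreal (norm (F y) / h k) * indicator {y. s < \<bar>f y\<bar> \<and> \<bar>f y\<bar> < s + h k} y * v y) * indicator {0<..} s \<partial>lborel)
         \<le> (\<integral>\<^sup>+s. ?c * indicator {\<bar>f y\<bar> - h k..\<bar>f y\<bar>} s \<partial>lborel)"
      proof (intro nn_integral_mono)
        fix s
        show "ennreal (C * (\<gamma> * s powr (\<gamma> - 1))) * (ennreal (norm (F y) / h k) * indicator {y. s < \<bar>f y\<bar> \<and> \<bar>f y\<bar> < s + h k} y * v y) * indicator {0<..} s
          \<le> ?c * indicator {\<bar>f y\<bar> - h k..\<bar>f y\<bar>} s"
        proof (cases "0 < s \<and> s < \<bar>f y\<bar> \<and> \<bar>f y\<bar> < s + h k")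
          case True
          then have "s powr (\<gamma> - 1) \<le> \<bar>f y\<bar> powr (\<gamma> - 1)" using \<gamma> by (intro powr_mono2) auto
          then have "ennreal (C * (\<gamma> * s powr (\<gamma> - 1))) \<le> ennreal (C * (\<gamma> * \<bar>f y\<bar> powr (\<gamma> - 1)))"
            using C \<gamma> by (intro ennreal_leI mult_left_mono) auto
          then have "ennreal (C * (\<gamma> * s powr (\<gamma> - 1))) * (ennreal (norm (F y) / h k) * v y) \<le> ?c"
            by (rule mult_right_mono) simp
          then show ?thesis using True by simp
        next
          case False
          then have "indicator {y. s < \<bar>f y\<bar> \<and> \<bar>f y\<bar> < s + h k} y * (indicator {0<..} s :: ennreal) = 0" by auto
          then show ?thesis by auto
        qed
      qed
      also have "\<dots> = ?c * ennreal (h k)" using h[of k] by (simp add: nn_integral_cmult_indicator)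
      also have "\<dots> = ennreal C * (ennreal (\<gamma> * \<bar>f y\<bar> powr (\<gamma> - 1) * norm (F y)) * v y)"
      proof -
        have "ennreal (C * (\<gamma> * \<bar>f y\<bar> powr (\<gamma> - 1))) * ennreal (norm (F y) / h k) * ennreal (h k) = ennreal C * ennreal (\<gamma> * \<bar>f y\<bar> powr (\<gamma> - 1) * norm (F y))"
          using h[of k] C \<gamma> by (simp add: ennreal_mult''[symmetric] ennreal_mult'[symmetric] mult_ac)
        moreover have "?c * ennreal (h k) = ennreal (C * (\<gamma> * \<bar>f y\<bar> powr (\<gamma> - 1))) * ennreal (norm (F y) / h k) * ennreal (h k) * v y"
          by (simp only: mult_ac)
        ultimately show ?thesis by (simp only: mult.assoc)
      qed
      finally show "(\<integral>\<^sup>+s. ennreal (C * (\<gamma> * s powr (\<gamma> - 1))) * (ennreal (norm (F y) / h k) * indicator {y. s < \<bar>f y\<bar> \<and> \<bar>f y\<bar> < s + h k} y * v y) * indicator {0<..} s \<partial>lborel)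
         \<le> ennreal C * (ennreal (\<gamma> * \<bar>f y\<bar> powr (\<gamma> - 1) * norm (F y)) * v y)" .
    qed
    also have "\<dots> = ennreal C * (\<integral>\<^sup>+y. ennreal (\<gamma> * \<bar>f y\<bar> powr (\<gamma> - 1) * norm (F y)) * v y \<partial>lborel)"
      by (rule nn_integral_cmult) measurable
    finally show ?thesis .
  qed
  have [measurable]: "\<Phi> k \<in> borel_measurable borel" for k
    unfolding \<Phi>_def by measurable
  have "(\<integral>\<^sup>+s. ennreal (\<gamma> * s powr (\<gamma> - 1) * measure ?M {y. s < \<bar>f y\<bar>} powr (1 / q)) * indicator {0<..} s \<partial>lborel)
     \<le> (\<integral>\<^sup>+s. liminf (\<lambda>k. ennreal (C * (\<gamma> * s powr (\<gamma> - 1))) * \<Phi> k s * indicator {0<..} s) \<partial>lborel)"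
  proof (intro nn_integral_mono)
    fix s
    show "ennreal (\<gamma> * s powr (\<gamma> - 1) * measure ?M {y. s < \<bar>f y\<bar>} powr (1 / q)) * indicator {0<..} s
      \<le> liminf (\<lambda>k. ennreal (C * (\<gamma> * s powr (\<gamma> - 1))) * \<Phi> k s * indicator {0<..} s)"
    proof (cases "0 < s")
      case True
      then show ?thesis using step1[of s "\<gamma> * s powr (\<gamma> - 1)"] \<gamma> by simp
    qed simp
  qed
  also have "\<dots> \<le> liminf (\<lambda>k. \<integral>\<^sup>+s. ennreal (C * (\<gamma> * s powr (\<gamma> - 1))) * \<Phi> k s * indicator {0<..} s \<partial>lborel)"
    by (intro nn_integral_liminf) measurable
  also have "\<dots> \<le> ennreal C * (\<integral>\<^sup>+y. ennreal (\<gamma> * \<bar>f y\<bar> powr (\<gamma> - 1) * norm (F y)) * v y \<partial>lborel)"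
    by (intro Liminf_le always_eventually allI bound) simp
  finally show ?thesis .
qed

text \<open>
  Write one factor \<open>\<bar>f\<bar> powr \<gamma>\<close> of \<open>\<bar>f\<bar> powr (\<gamma> * q)\<close> as the integral of \<open>\<gamma> * s powr (\<gamma> - 1)\<close> over \<open>0 < s < \<bar>f\<bar>\<close>,
  exchange the integrals and apply Hoelder's inequality on each set \<open>{\<bar>f\<bar> > s}\<close>.  Cancelling the power of \<open>I\<close> gives
  Minkowski's inequality for the layer-cake representation of \<open>\<bar>f\<bar> powr \<gamma>\<close>.
\<close>
lemma layer_cake_bound:
  fixes f :: "'a::euclidean_space \<Rightarrow> real" and w :: "'a \<Rightarrow> ennreal"
  assumes [measurable]: "f \<in> borel_measurable borel" "w \<in> borel_measurable borel"
    and q: "1 \<le> q" and \<gamma>: "1 \<le> \<gamma>"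
    and fin: "emeasure (density lborel w) {y. f y \<noteq> 0} < \<infinity>"
    and I: "(\<integral>\<^sup>+y. ennreal (\<bar>f y\<bar> powr (\<gamma> * q)) * w y \<partial>lborel) = ennreal I" "0 \<le> I"
  shows "ennreal I \<le> (\<integral>\<^sup>+s. ennreal (\<gamma> * s powr (\<gamma> - 1) * measure (density lborel w) {y. s < \<bar>f y\<bar>} powr (1 / q)) * indicator {0<..} s \<partial>lborel)
     * ennreal (I powr (1 - 1 / q))"
proof -
  let ?M = "density lborel w"
  have inner: "(\<integral>\<^sup>+y. indicator {y. s < \<bar>f y\<bar>} y * ennreal (\<bar>f y\<bar> powr (\<gamma> * q - \<gamma>)) * w y \<partial>lborel)
      \<le> ennreal (measure ?M {y. s < \<bar>f y\<bar>} powr (1 / q) * I powr (1 - 1 / q))" if s: "0 < s" for s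
  proof -
    let ?S = "{y. s < \<bar>f y\<bar>}"
    have "emeasure ?M ?S \<le> emeasure ?M {y. f y \<noteq> 0}" using s by (intro emeasure_mono) auto
    then have finS: "emeasure ?M ?S = ennreal (measure ?M ?S)"
      using fin by (intro emeasure_eq_ennreal_measure) auto
    have ind: "(\<integral>\<^sup>+y. ennreal (indicator ?S y) \<partial>?M) = emeasure ?M ?S"
      by (subst ennreal_indicator) simp
    have "(\<integral>\<^sup>+y. indicator ?S y * ennreal (\<bar>f y\<bar> powr (\<gamma> * q - \<gamma>)) * w y \<partial>lborel)
       = (\<integral>\<^sup>+y. ennreal (indicator ?S y powr (1 / q) * (\<bar>f y\<bar> powr (\<gamma> * q)) powr (1 - 1 / q)) \<partial>?M)"
    proof (subst nn_integral_density)
      have "\<gamma> * q * (1 - 1 / q) = \<gamma> * q - \<gamma>" using q by (simp add: field_simps)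
      then show "(\<integral>\<^sup>+y. indicator ?S y * ennreal (\<bar>f y\<bar> powr (\<gamma> * q - \<gamma>)) * w y \<partial>lborel)
        = (\<integral>\<^sup>+y. w y * ennreal (indicator ?S y powr (1 / q) * (\<bar>f y\<bar> powr (\<gamma> * q)) powr (1 - 1 / q)) \<partial>lborel)"
        by (intro nn_integral_cong) (auto simp: powr_powr indicator_def mult_ac)
    qed auto
    also have "\<dots> \<le> ennreal (measure ?M ?S powr (1 / q) * I powr (1 - 1 / q))"
    proof (rule nn_integral_Holder)
      show "(\<integral>\<^sup>+y. ennreal (indicator ?S y) \<partial>?M) \<le> ennreal (measure ?M ?S)" using ind finS by simp
      show "(\<integral>\<^sup>+y. ennreal (\<bar>f y\<bar> powr (\<gamma> * q)) \<partial>?M) \<le> ennreal I"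
        using I by (subst nn_integral_density) (auto simp: mult.commute)
    qed (use q I in auto)
    finally show ?thesis .
  qed
  have "ennreal I = (\<integral>\<^sup>+y. (\<integral>\<^sup>+s. ennreal (\<gamma> * s powr (\<gamma> - 1)) * indicator {s. 0 < s \<and> s < \<bar>f y\<bar>} s \<partial>lborel) * ennreal (\<bar>f y\<bar> powr (\<gamma> * q - \<gamma>)) * w y \<partial>lborel)"
    unfolding I(1)[symmetric]
  proof (intro nn_integral_cong)
    fix y
    have "\<bar>f y\<bar> powr (\<gamma> * q) = \<bar>f y\<bar> powr \<gamma> * \<bar>f y\<bar> powr (\<gamma> * q - \<gamma>)" by (simp add: powr_add[symmetric])
    then show "ennreal (\<bar>f y\<bar> powr (\<gamma> * q)) * w y = (\<integral>\<^sup>+s. ennreal (\<gamma> * s powr (\<gamma> - 1)) * indicator {s. 0 < s \<and> s < \<bar>f y\<bar>} s \<partial>lborel) * ennreal (\<bar>f y\<bar> powr (\<gamma> * q - \<gamma>)) * w y"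
      using \<gamma> by (subst nn_integral_powr_below) (auto simp: ennreal_mult)
  qed
  also have "\<dots> = (\<integral>\<^sup>+y. \<integral>\<^sup>+s. ennreal (\<gamma> * s powr (\<gamma> - 1)) * indicator {s. 0 < s \<and> s < \<bar>f y\<bar>} s * ennreal (\<bar>f y\<bar> powr (\<gamma> * q - \<gamma>)) * w y \<partial>lborel \<partial>lborel)"
    by (intro nn_integral_cong) (simp add: nn_integral_multc)
  also have "\<dots> = (\<integral>\<^sup>+s. \<integral>\<^sup>+y. ennreal (\<gamma> * s powr (\<gamma> - 1)) * indicator {s. 0 < s \<and> s < \<bar>f y\<bar>} s * ennreal (\<bar>f y\<bar> powr (\<gamma> * q - \<gamma>)) * w y \<partial>lborel \<partial>lborel)"
    by (intro lborel_pair.Fubini') measurable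
  also have "\<dots> = (\<integral>\<^sup>+s. ennreal (\<gamma> * s powr (\<gamma> - 1)) * indicator {0<..} s * (\<integral>\<^sup>+y. indicator {y. s < \<bar>f y\<bar>} y * ennreal (\<bar>f y\<bar> powr (\<gamma> * q - \<gamma>)) * w y \<partial>lborel) \<partial>lborel)"
  proof (rule nn_integral_cong)
    fix s :: real
    have "(\<integral>\<^sup>+y. ennreal (\<gamma> * s powr (\<gamma> - 1)) * indicator {s. 0 < s \<and> s < \<bar>f y\<bar>} s * ennreal (\<bar>f y\<bar> powr (\<gamma> * q - \<gamma>)) * w y \<partial>lborel)
      = (\<integral>\<^sup>+y. ennreal (\<gamma> * s powr (\<gamma> - 1)) * indicator {0<..} s * (indicator {y. s < \<bar>f y\<bar>} y * ennreal (\<bar>f y\<bar> powr (\<gamma> * q - \<gamma>)) * w y) \<partial>lborel)"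
      by (rule nn_integral_cong) (auto simp: indicator_def mult_ac)
    also have "\<dots> = ennreal (\<gamma> * s powr (\<gamma> - 1)) * indicator {0<..} s * (\<integral>\<^sup>+y. indicator {y. s < \<bar>f y\<bar>} y * ennreal (\<bar>f y\<bar> powr (\<gamma> * q - \<gamma>)) * w y \<partial>lborel)"
      by (rule nn_integral_cmult) measurable
    finally show "(\<integral>\<^sup>+y. ennreal (\<gamma> * s powr (\<gamma> - 1)) * indicator {s. 0 < s \<and> s < \<bar>f y\<bar>} s * ennreal (\<bar>f y\<bar> powr (\<gamma> * q - \<gamma>)) * w y \<partial>lborel)
      = ennreal (\<gamma> * s powr (\<gamma> - 1)) * indicator {0<..} s * (\<integral>\<^sup>+y. indicator {y. s < \<bar>f y\<bar>} y * ennreal (\<bar>f y\<bar> powr (\<gamma> * q - \<gamma>)) * w y \<partial>lborel)" .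
  qed
  also have "\<dots> \<le> (\<integral>\<^sup>+s. ennreal (\<gamma> * s powr (\<gamma> - 1) * measure ?M {y. s < \<bar>f y\<bar>} powr (1 / q)) * indicator {0<..} s * ennreal (I powr (1 - 1 / q)) \<partial>lborel)"
  proof (intro nn_integral_mono)
    fix s :: real
    show "ennreal (\<gamma> * s powr (\<gamma> - 1)) * indicator {0<..} s * (\<integral>\<^sup>+y. indicator {y. s < \<bar>f y\<bar>} y * ennreal (\<bar>f y\<bar> powr (\<gamma> * q - \<gamma>)) * w y \<partial>lborel)
      \<le> ennreal (\<gamma> * s powr (\<gamma> - 1) * measure ?M {y. s < \<bar>f y\<bar>} powr (1 / q)) * indicator {0<..} s * ennreal (I powr (1 - 1 / q))"
    proof (cases "0 < s")
      case True
      have "ennreal (\<gamma> * s powr (\<gamma> - 1)) * (\<integral>\<^sup>+y. indicator {y. s < \<bar>f y\<bar>} y * ennreal (\<bar>f y\<bar> powr (\<gamma> * q - \<gamma>)) * w y \<partial>lborel)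
        \<le> ennreal (\<gamma> * s powr (\<gamma> - 1)) * ennreal (measure ?M {y. s < \<bar>f y\<bar>} powr (1 / q) * I powr (1 - 1 / q))"
        by (intro mult_left_mono inner True) simp
      also have "\<dots> = ennreal (\<gamma> * s powr (\<gamma> - 1) * measure ?M {y. s < \<bar>f y\<bar>} powr (1 / q)) * ennreal (I powr (1 - 1 / q))"
        using \<gamma> by (simp add: ennreal_mult''[symmetric] mult.assoc)
      finally show ?thesis using True by simp
    qed simp
  qed
  also have "\<dots> = (\<integral>\<^sup>+s. ennreal (\<gamma> * s powr (\<gamma> - 1) * measure ?M {y. s < \<bar>f y\<bar>} powr (1 / q)) * indicator {0<..} s \<partial>lborel) * ennreal (I powr (1 - 1 / q))"
  proof (rule nn_integral_multc)
    have M: "measure ?M {y. s < \<bar>f y\<bar>} = enn2real (\<integral>\<^sup>+y. w y * indicator {y. s < \<bar>f y\<bar>} y \<partial>lborel)" for s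
      unfolding measure_def by (subst emeasure_density) auto
    show "(\<lambda>s. ennreal (\<gamma> * s powr (\<gamma> - 1) * measure ?M {y. s < \<bar>f y\<bar>} powr (1 / q)) * indicator {0<..} s) \<in> borel_measurable lborel"
      unfolding M by measurable
  qed
  finally show ?thesis .
qed

section \<open>The Hardy-Sobolev inequality\<close>

text \<open>
  The parameters of the inequality of exponent 1 that is applied to \<open>\<bar>f\<bar> powr \<gamma>\<close>.
  They are forced by two demands: \<open>(\<bar>f\<bar> powr \<gamma>) powr q1\<close> is \<open>\<bar>f\<bar> powr q\<close>, and Hoelder's inequality splits
  \<open>\<bar>f\<bar> powr (\<gamma> - 1) * norm (gradient f) * \<delta> powr \<beta>1\<close> into the two integrands of the theorem.
\<close>
lemma hardy_sobolev_exponents: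
  fixes n p q \<beta> Q q1 \<gamma> \<beta>1 :: real
  assumes p: "1 \<le> p" "p \<le> q" "p < n" "q \<le> n * p / (n - p)"
    and Q: "Q = q / p * (n - p + \<beta>)" and q1: "q1 = q * p / (q * p + p - q)"
    and \<gamma>: "\<gamma> = 1 + q * (p - 1) / p" and \<beta>1: "\<beta>1 = (Q - n) * ((p - 1) / p) + \<beta> / p"
  shows "1 \<le> \<gamma>" "1 \<le> q1" "q1 * (n - 1) \<le> n" "\<gamma> * q1 = q" "q1 * (n - 1 + \<beta>1) = Q"
    "1 - 1 / q1 = 1 / p - 1 / q"
    "\<beta> \<le> (p - 1) * (q * p + n * p - n * q) / (q * p + p - q) \<Longrightarrow> \<beta>1 \<le> 0"
proof -
  define d where "d = q * p + p - q"
  have q: "q > 0" using p by linarith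
  have d: "d > 0"
  proof -
    have "d = q * (p - 1) + p" by (simp add: d_def algebra_simps)
    then show ?thesis using p q by (simp add: add_nonneg_pos)
  qed
  have q1': "q1 = q * p / d" by (simp add: q1 d_def)
  show "1 \<le> \<gamma>" using p q by (simp add: \<gamma>)
  show "1 \<le> q1" using p d by (simp add: q1' d_def)
  have "q * (n - p) \<le> n * p" using p by (simp add: pos_le_divide_eq)
  then have "q * p * (n - 1) \<le> n * d" by (simp add: d_def algebra_simps)
  then show "q1 * (n - 1) \<le> n" using d by (simp add: q1' pos_divide_le_eq)
  have \<gamma>d: "\<gamma> = d / p" using p by (simp add: \<gamma> d_def field_simps)
  show "\<gamma> * q1 = q" using p d by (simp add: \<gamma>d q1')
  show "1 - 1 / q1 = 1 / p - 1 / q" using p q d by (simp add: q1' field_simps) (simp add: d_def algebra_simps)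
  have Qp: "Q * p = q * (n - p + \<beta>)" using p by (simp add: Q)
  have b1p: "\<beta>1 * p = (Q - n) * (p - 1) + \<beta>" using p by (simp add: \<beta>1 field_simps)
  have "q * p * (n - 1 + \<beta>1) = q * (p * (n - 1) + \<beta>1 * p)" by (simp add: algebra_simps)
  also have "\<dots> = q * (n - p + \<beta>) + q * Q * (p - 1)" unfolding b1p by (simp add: algebra_simps)
  also have "\<dots> = Q * d" unfolding Qp[symmetric] by (simp add: d_def algebra_simps)
  finally have "q * p * (n - 1 + \<beta>1) = Q * d" .
  then show "q1 * (n - 1 + \<beta>1) = Q" using d by (simp add: q1' field_simps)
  assume "\<beta> \<le> (p - 1) * (q * p + n * p - n * q) / (q * p + p - q)"
  then have "\<beta> * d \<le> (p - 1) * (q * p + n * p - n * q)" using d by (simp add: d_def pos_le_divide_eq)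
  moreover have "\<beta>1 * p * p = \<beta> * d - (p - 1) * (q * p + n * p - n * q)"
  proof -
    have "\<beta>1 * p * p = (Q * p - n * p) * (p - 1) + \<beta> * p" unfolding b1p by (simp add: algebra_simps)
    also have "\<dots> = \<beta> * d - (p - 1) * (q * p + n * p - n * q)" unfolding Qp by (simp add: d_def algebra_simps)
    finally show ?thesis .
  qed
  ultimately have "\<beta>1 * (p * p) \<le> 0" by (simp add: mult.assoc)
  then show "\<beta>1 \<le> 0" using p by (simp add: mult_le_0_iff)
qed

text \<open>
  With \<open>I\<close> and \<open>J\<close> the integrals on the left and on the right, the estimates for the level sets give
  \<open>I \<le> C1 * T * I powr (1 - 1 / q1)\<close>, and Hoelder's inequality gives
  \<open>T \<le> \<gamma> * I powr ((p - 1) / p) * J powr (1 / p)\<close>.  As \<open>(p - 1) / p + 1 - 1 / q1 = 1 - 1 / q\<close>, dividing by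
  \<open>I powr (1 - 1 / q)\<close> leaves the claim.
\<close>
lemma hardy_sobolev_C1:
  fixes E :: "'a::euclidean_space set" and n p q \<beta> \<nu> C0 :: real
  assumes n: "n = real DIM('a)" and E: "closed E" "E \<noteq> {}" and null: "emeasure lborel E = 0"
    and p: "1 \<le> p" "p \<le> q" "p < n" "q \<le> n * p / (n - p)"
    and \<nu>: "\<nu> < q / p * (n - p + \<beta>)" and C0: "0 < C0"
    and vol: "\<And>x r R. 0 < r \<Longrightarrow> r \<le> R \<Longrightarrow> emeasure lborel {y \<in> ball x R. infdist y E < r}
       \<le> ennreal (C0 * r powr (real DIM('a) - \<nu>) * R powr \<nu>)"
    and alt: "\<nu> < n - 1 \<or> \<beta> \<le> (p - 1) * (q * p + n * p - n * q) / (q * p + p - q)"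
  shows "\<exists>C>0. \<forall>f F. (\<forall>y. GDERIV f y :> F y) \<longrightarrow> continuous_on UNIV F \<longrightarrow> bounded {y. f y \<noteq> 0} \<longrightarrow>
    ennreal_powr (\<integral>\<^sup>+x. ennreal (\<bar>f x\<bar> powr q * infdist x E powr (q / p * (n - p + \<beta>) - n)) \<partial>lborel) (1 / q)
    \<le> ennreal C * ennreal_powr (\<integral>\<^sup>+x. ennreal (norm (F x :: 'a) powr p * infdist x E powr \<beta>) \<partial>lborel) (1 / p)"
proof -
  define Q where "Q = q / p * (n - p + \<beta>)"
  define q1 where "q1 = q * p / (q * p + p - q)"
  define \<gamma> where "\<gamma> = 1 + q * (p - 1) / p"
  define \<beta>1 where "\<beta>1 = (Q - n) * ((p - 1) / p) + \<beta> / p"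
  note ex = hardy_sobolev_exponents[OF p Q_def q1_def \<gamma>_def \<beta>1_def]
  have [measurable]: "(\<lambda>y. infdist y E) \<in> borel_measurable borel"
    by (intro borel_measurable_continuous_onI continuous_intros)
  obtain K where K: "0 < K" and wball: "\<And>x R. 0 < R \<Longrightarrow> infdist x E \<le> 2 * R \<Longrightarrow>
     (\<integral>\<^sup>+y. ennreal (infdist y E powr (Q - real DIM('a))) * indicator (ball x R) y \<partial>lborel) \<le> ennreal (K * R powr Q)"
    by (rule distance_weight_ball[OF \<nu>[folded Q_def] C0 vol]) (assumption | rule that)+
  have alt': "(\<beta>1 \<le> 0 \<and> emeasure lborel E = 0) \<or> (\<exists>\<nu> C. \<nu> < real DIM('a) - 1 \<and> 0 < C \<and>
       (\<forall>x r R. 0 < r \<longrightarrow> r \<le> R \<longrightarrow> emeasure lborel {y \<in> ball x R. infdist y E < r}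
          \<le> ennreal (C * r powr (real DIM('a) - \<nu>) * R powr \<nu>)))"
    using alt
  proof
    assume "\<nu> < n - 1"
    then show ?thesis using C0 vol n by blast
  next
    assume "\<beta> \<le> (p - 1) * (q * p + n * p - n * q) / (q * p + p - q)"
    then show ?thesis using ex(7) null by blast
  qed
  have Q': "q1 * (real DIM('a) - 1 + \<beta>1) = Q" using ex(5) n by simp
  let ?w = "\<lambda>y. ennreal (infdist y E powr (Q - n))" and ?v = "\<lambda>y. ennreal (infdist y E powr \<beta>1)"
  have wball': "(\<integral>\<^sup>+y. ennreal (infdist y E powr (q1 * (real DIM('a) - 1 + \<beta>1) - real DIM('a))) * indicator (ball x R) y \<partial>lborel)
         \<le> ennreal (K * R powr (q1 * (real DIM('a) - 1 + \<beta>1)))" if "0 < R" "infdist x E \<le> 2 * R" for x R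
    unfolding Q' using wball[OF that] .
  have half: "(0::real) < (1/2) ^ (DIM('a) + 2)" by simp
  have q1n: "q1 * (real DIM('a) - 1) \<le> real DIM('a)" using ex(3) n by simp
  obtain C1 where C1: "0 < C1" and iso: "\<And>G A D x r t. admissible_between G A D \<Longrightarrow> G \<in> borel_measurable borel \<Longrightarrow>
     A \<in> sets borel \<Longrightarrow> D \<in> sets borel \<Longrightarrow> A \<subseteq> ball x r \<Longrightarrow> D \<subseteq> ball x r \<Longrightarrow> 0 < r \<Longrightarrow>
     (1/2) ^ (DIM('a) + 2) * measure lborel (ball x r) \<le> measure lborel A \<Longrightarrow> measure lborel (ball x r) / 2 \<le> measure lborel D \<Longrightarrow>
     0 \<le> t \<Longrightarrow> (\<integral>\<^sup>+y. G y * ?v y * indicator (ball x r) y \<partial>lborel) \<le> ennreal t \<Longrightarrow>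
     (\<integral>\<^sup>+y. ?w y * indicator (ball x (5 * r)) y \<partial>lborel) \<le> ennreal ((C1 * t) powr q1)"
    by (rule ball_isoperimetry[OF E ex(2) q1n half K wball' alt', unfolded n[symmetric], unfolded ex(5)]) (assumption | rule that)+
  show ?thesis
  proof (intro exI[of _ "C1 * \<gamma>"] conjI allI impI)
    show "0 < C1 * \<gamma>" using C1 ex(1) by simp
    fix f :: "'a \<Rightarrow> real" and F :: "'a \<Rightarrow> 'a"
    assume "\<forall>y. GDERIV f y :> F y" and F: "continuous_on UNIV F" and supp: "bounded {y. f y \<noteq> 0}"
    then have df: "GDERIV f y :> F y" for y by blast
    have contf: "continuous_on UNIV f"
      using df by (auto simp: gderiv_def intro!: continuous_at_imp_continuous_on has_derivative_continuous)
    have [measurable]: "f \<in> borel_measurable borel" "F \<in> borel_measurable borel"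
      using contf F by (auto intro: borel_measurable_continuous_onI)
    have q: "q > 0" using p by linarith
    define IL where "IL = (\<integral>\<^sup>+x. ennreal (\<bar>f x\<bar> powr q * infdist x E powr (Q - n)) \<partial>lborel)"
    define JR where "JR = (\<integral>\<^sup>+x. ennreal (norm (F x) powr p * infdist x E powr \<beta>) \<partial>lborel)"
    obtain x0 where x0: "x0 \<in> E" using E by auto
    obtain R0 where R0: "0 < R0" "{y. f y \<noteq> 0} \<subseteq> ball x0 R0" using supp bounded_subset_ballD by blast
    have supp_ball: "dist x0 y < R0" if "f y \<noteq> 0" for y using that R0(2) by (auto simp: subset_iff)
    have wfin: "(\<integral>\<^sup>+y. ?w y * indicator (ball x0 R0) y \<partial>lborel) < \<infinity>"
      using wball[OF R0(1), of x0] x0 R0(1) n by (simp add: le_less_trans)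
    have fin: "emeasure (density lborel ?w) {y. f y \<noteq> 0} < \<infinity>"
    proof -
      have "emeasure (density lborel ?w) {y. f y \<noteq> 0} \<le> (\<integral>\<^sup>+y. ?w y * indicator (ball x0 R0) y \<partial>lborel)"
        using supp_ball by (subst emeasure_density) (auto intro!: nn_integral_mono simp: indicator_def)
      then show ?thesis using wfin by (rule le_less_trans)
    qed
    have "compact (closure {y. f y \<noteq> 0})" using supp by (simp add: compact_closure)
    then have "bounded (f ` closure {y. f y \<noteq> 0})"
      by (intro compact_imp_bounded compact_continuous_image continuous_on_subset[OF contf]) auto
    then obtain b where b: "\<And>y. y \<in> closure {y. f y \<noteq> 0} \<Longrightarrow> \<bar>f y\<bar> \<le> b" unfolding bounded_iff by auto
    have b': "\<bar>f y\<bar> powr q \<le> \<bar>b\<bar> powr q * indicator (ball x0 R0) y" for y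
    proof (cases "f y = 0")
      case False
      then have "y \<in> closure {y. f y \<noteq> 0}" "y \<in> ball x0 R0"
        using closure_subset[of "{y. f y \<noteq> 0}"] supp_ball by auto
      then show ?thesis using b[of y] q by (auto intro!: powr_mono2)
    qed auto
    have "IL \<le> (\<integral>\<^sup>+y. ennreal (\<bar>b\<bar> powr q) * (?w y * indicator (ball x0 R0) y) \<partial>lborel)"
      unfolding IL_def
    proof (intro nn_integral_mono)
      fix y
      have "\<bar>f y\<bar> powr q * infdist y E powr (Q - n) \<le> \<bar>b\<bar> powr q * indicator (ball x0 R0) y * infdist y E powr (Q - n)"
        by (intro mult_right_mono b') auto
      then have "ennreal (\<bar>f y\<bar> powr q * infdist y E powr (Q - n)) \<le> ennreal (\<bar>b\<bar> powr q * indicator (ball x0 R0) y * infdist y E powr (Q - n))"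
        by (rule ennreal_leI)
      also have "\<dots> = ennreal (\<bar>b\<bar> powr q) * (?w y * indicator (ball x0 R0) y)"
        by (auto simp: indicator_def ennreal_mult)
      finally show "ennreal (\<bar>f y\<bar> powr q * infdist y E powr (Q - n)) \<le> ennreal (\<bar>b\<bar> powr q) * (?w y * indicator (ball x0 R0) y)" .
    qed
    also have "\<dots> = ennreal (\<bar>b\<bar> powr q) * (\<integral>\<^sup>+y. ?w y * indicator (ball x0 R0) y \<partial>lborel)"
    proof (rule nn_integral_cmult)
      have [measurable]: "ball x0 R0 \<in> sets borel" by simp
      show "(\<lambda>y. ?w y * indicator (ball x0 R0) y) \<in> borel_measurable lborel" by measurable
    qed
    also have "\<dots> < \<infinity>" using wfin by (simp add: ennreal_mult_less_top)
    finally obtain I where I: "IL = ennreal I" "0 \<le> I" by (cases IL) auto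
    have "ennreal_powr IL (1 / q) \<le> ennreal (C1 * \<gamma>) * ennreal_powr JR (1 / p)"
    proof (cases "I = 0 \<or> JR = \<infinity>")
      case True
      then show ?thesis
      proof
        assume "I = 0"
        then show ?thesis using I by (simp add: ennreal_powr_def)
      next
        assume "JR = \<infinity>"
        then show ?thesis using C1 ex(1) by (simp add: ennreal_powr_def ennreal_mult_top)
      qed
    next
      case False
      then have Ip: "I > 0" using I by auto
      obtain J where J: "JR = ennreal J" "0 \<le> J" using False by (cases JR) auto
      have level: "\<exists>h0>0. \<forall>h t. 0 < h \<longrightarrow> h < h0 \<longrightarrow> 0 \<le> t \<longrightarrow>
         (\<integral>\<^sup>+y. ennreal (norm (F y) / h) * indicator {y. s < \<bar>f y\<bar> \<and> \<bar>f y\<bar> < s + h} y * ?v y \<partial>lborel) \<le> ennreal t \<longrightarrow>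
         (\<integral>\<^sup>+y. ?w y * indicator {y. s + \<sigma> \<le> \<bar>f y\<bar>} y \<partial>lborel) \<le> ennreal ((C1 * t) powr q1)" if s: "0 < s" "0 < \<sigma>" for s \<sigma>
        by (rule level_set_estimate[OF df F supp _ _ ex(2) C1 iso s]) measurable
      define S where "S = (\<integral>\<^sup>+s. ennreal (\<gamma> * s powr (\<gamma> - 1) * measure (density lborel ?w) {y. s < \<bar>f y\<bar>} powr (1 / q1)) * indicator {0<..} s \<partial>lborel)"
      define T where "T = (\<integral>\<^sup>+y. ennreal (\<gamma> * \<bar>f y\<bar> powr (\<gamma> - 1) * norm (F y)) * ?v y \<partial>lborel)"
      have ST: "S \<le> ennreal C1 * T"
        unfolding S_def T_def by (rule weighted_coarea_bound[OF _ _ _ _ ex(2) C1 ex(1) fin level]) auto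
      have IS: "ennreal I \<le> S * ennreal (I powr (1 - 1 / q1))"
        unfolding S_def
      proof (rule layer_cake_bound[OF _ _ ex(2) ex(1) fin _ I(2)])
        show "(\<integral>\<^sup>+y. ennreal (\<bar>f y\<bar> powr (\<gamma> * q1)) * ?w y \<partial>lborel) = ennreal I"
          unfolding I(1)[symmetric] IL_def ex(4) by (intro nn_integral_cong) (simp add: ennreal_mult)
      qed auto
      have T_le: "T \<le> ennreal \<gamma> * ennreal (I powr ((p - 1) / p) * J powr (1 / p))"
      proof -
        have "T = (\<integral>\<^sup>+y. ennreal \<gamma> * ennreal ((\<bar>f y\<bar> powr q * infdist y E powr (Q - n)) powr ((p - 1) / p) * (norm (F y) powr p * infdist y E powr \<beta>) powr (1 / p)) \<partial>lborel)"
          unfolding T_def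
        proof (intro nn_integral_cong)
          fix y
          let ?d = "infdist y E"
          have "(\<bar>f y\<bar> powr q * ?d powr (Q - n)) powr ((p - 1) / p) * (norm (F y) powr p * ?d powr \<beta>) powr (1 / p)
             = \<bar>f y\<bar> powr (q * ((p - 1) / p)) * norm (F y) powr (p * (1 / p)) * (?d powr ((Q - n) * ((p - 1) / p)) * ?d powr (\<beta> * (1 / p)))"
            by (simp only: powr_mult powr_powr powr_ge_zero mult_ac)
          also have "q * ((p - 1) / p) = \<gamma> - 1" by (simp add: \<gamma>_def)
          also have "norm (F y) powr (p * (1 / p)) = norm (F y)" using p by simp
          also have "?d powr ((Q - n) * ((p - 1) / p)) * ?d powr (\<beta> * (1 / p)) = ?d powr \<beta>1"
            by (simp add: powr_add[symmetric] \<beta>1_def)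
          finally have eq: "(\<bar>f y\<bar> powr q * ?d powr (Q - n)) powr ((p - 1) / p) * (norm (F y) powr p * ?d powr \<beta>) powr (1 / p)
             = \<bar>f y\<bar> powr (\<gamma> - 1) * norm (F y) * ?d powr \<beta>1" .
          show "ennreal (\<gamma> * \<bar>f y\<bar> powr (\<gamma> - 1) * norm (F y)) * ?v y
            = ennreal \<gamma> * ennreal ((\<bar>f y\<bar> powr q * ?d powr (Q - n)) powr ((p - 1) / p) * (norm (F y) powr p * ?d powr \<beta>) powr (1 / p))"
            unfolding eq using ex(1) by (simp add: ennreal_mult''[symmetric] ennreal_mult'[symmetric] mult_ac)
        qed
        also have "\<dots> = ennreal \<gamma> * (\<integral>\<^sup>+y. ennreal ((\<bar>f y\<bar> powr q * infdist y E powr (Q - n)) powr ((p - 1) / p) * (norm (F y) powr p * infdist y E powr \<beta>) powr (1 / p)) \<partial>lborel)"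
          by (rule nn_integral_cmult) measurable
        also have "\<dots> \<le> ennreal \<gamma> * ennreal (I powr ((p - 1) / p) * J powr (1 / p))"
        proof (intro mult_left_mono nn_integral_Holder)
          show "(p - 1) / p + 1 / p = 1" using p by (simp add: field_simps)
          show "(\<integral>\<^sup>+x. ennreal (\<bar>f x\<bar> powr q * infdist x E powr (Q - n)) \<partial>lborel) \<le> ennreal I" using I by (simp add: IL_def)
          show "(\<integral>\<^sup>+x. ennreal (norm (F x) powr p * infdist x E powr \<beta>) \<partial>lborel) \<le> ennreal J" using J by (simp add: JR_def)
        qed (use p I J in auto)
        finally show ?thesis .
      qed
      have "ennreal I \<le> ennreal C1 * (ennreal \<gamma> * ennreal (I powr ((p - 1) / p) * J powr (1 / p))) * ennreal (I powr (1 - 1 / q1))"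
        using IS ST T_le by (meson mult_left_mono mult_right_mono order_trans zero_le)
      also have "\<dots> = ennreal (C1 * (\<gamma> * (I powr ((p - 1) / p) * J powr (1 / p))) * I powr (1 - 1 / q1))"
        using C1 ex(1) by (simp add: ennreal_mult''[symmetric] ennreal_mult'[symmetric])
      finally have "I \<le> C1 * (\<gamma> * (I powr ((p - 1) / p) * J powr (1 / p))) * I powr (1 - 1 / q1)"
        using C1 ex(1) by (subst (asm) ennreal_le_iff) auto
      also have "\<dots> = C1 * \<gamma> * J powr (1 / p) * (I powr ((p - 1) / p) * I powr (1 - 1 / q1))" by (simp add: mult_ac)
      also have "I powr ((p - 1) / p) * I powr (1 - 1 / q1) = I powr (1 - 1 / q)"
        unfolding ex(6) using p by (simp add: powr_add[symmetric] diff_divide_distrib)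
      finally have le: "I powr (1 / q) * I powr (1 - 1 / q) \<le> C1 * \<gamma> * J powr (1 / p) * I powr (1 - 1 / q)"
        using Ip by (simp add: powr_add[symmetric])
      have "I powr (1 - 1 / q) > 0" using Ip by simp
      with le have "I powr (1 / q) \<le> C1 * \<gamma> * J powr (1 / p)" by (rule mult_right_le_imp_le)
      then have "ennreal (I powr (1 / q)) \<le> ennreal (C1 * \<gamma> * J powr (1 / p))" by (rule ennreal_leI)
      also have "\<dots> = ennreal (C1 * \<gamma>) * ennreal (J powr (1 / p))" using C1 ex(1) by (intro ennreal_mult) auto
      finally show ?thesis using I J by (simp add: ennreal_powr_def)
    qed
    then show "ennreal_powr (\<integral>\<^sup>+x. ennreal (\<bar>f x\<bar> powr q * infdist x E powr (q / p * (n - p + \<beta>) - n)) \<partial>lborel) (1 / q)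
      \<le> ennreal (C1 * \<gamma>) * ennreal_powr (\<integral>\<^sup>+x. ennreal (norm (F x) powr p * infdist x E powr \<beta>) \<partial>lborel) (1 / p)"
      by (simp add: IL_def JR_def Q_def)
  qed
qed

lemma test_function_gradient:
  fixes f :: "'a::euclidean_space \<Rightarrow> real"
  assumes "test_function f"
  shows "GDERIV f x :> gradient f x" "continuous_on UNIV (gradient f)" "bounded {x. f x \<noteq> 0}"
proof -
  have ck: "Ck (Suc 0) f" and comp: "compact (closure {x. f x \<noteq> 0})" using assms unfolding test_function_def by blast+
  then have diff: "f differentiable (at x)" and cont: "\<And>b. b \<in> Basis \<Longrightarrow> continuous_on UNIV (\<lambda>x. frechet_derivative f (at x) b)" for x
    by auto
  define g where "g x = (\<Sum>b\<in>Basis. frechet_derivative f (at x) b *\<^sub>R b)" for x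
  have g: "GDERIV f x :> g x" for x
  proof -
    have D: "(f has_derivative frechet_derivative f (at x)) (at x)" using diff by (simp add: frechet_derivative_works)
    then interpret bl: bounded_linear "frechet_derivative f (at x)" by (rule has_derivative_bounded_linear)
    have "frechet_derivative f (at x) h = h \<bullet> g x" for h
    proof -
      have "frechet_derivative f (at x) h = frechet_derivative f (at x) (\<Sum>b\<in>Basis. (h \<bullet> b) *\<^sub>R b)" by (simp add: euclidean_representation)
      also have "\<dots> = h \<bullet> g x" by (simp add: bl.sum bl.scaleR g_def inner_sum_right mult.commute)
      finally show ?thesis .
    qed
    then have "frechet_derivative f (at x) = (\<lambda>h. h \<bullet> g x)" by auto
    then show ?thesis using D by (simp add: gderiv_def)
  qed
  have "gradient f x = g x" for x
    unfolding gradient_def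
  proof (rule the_equality)
    show "GDERIV f x :> g x" by (rule g)
  next
    fix D assume "GDERIV f x :> D"
    then have "(\<lambda>h. h \<bullet> D) = (\<lambda>h. h \<bullet> g x)" using g[of x] unfolding gderiv_def by (rule has_derivative_unique)
    then show "D = g x" by (metis inner_commute vector_eq_ldot)
  qed
  then have eq: "gradient f = g" by auto
  show "GDERIV f x :> gradient f x" using g by (simp add: eq)
  show "continuous_on UNIV (gradient f)" unfolding eq g_def by (intro continuous_intros cont)
  show "bounded {x. f x \<noteq> 0}" using comp compact_imp_bounded bounded_subset closure_subset by blast
qed

theorem theorem5p1:
  fixes E :: "(real ^ 'n) set" and n p q \<beta> :: real
  assumes n_def: "n = real CARD('n)"
    and n_ge_2: "CARD('n) \<ge> 2"
    and "closed E" and "E \<noteq> {}" and "porous E"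
    and "1 \<le> p" and "p \<le> q" and "p < n" and "q \<le> n * p / (n - p)"
    and "assouad_dim E < q / p * (n - p + \<beta>)"
    and "assouad_dim E < n - 1 \<or>
         \<beta> \<le> (p - 1) * (q * p + n * p - n * q) / (q * p + p - q)"
  shows "\<exists>C>0. \<forall>f :: real ^ 'n \<Rightarrow> real. test_function f \<longrightarrow>
    ennreal_powr
      (\<integral>\<^sup>+x. ennreal (\<bar>f x\<bar> powr q * infdist x E powr (q / p * (n - p + \<beta>) - n)) \<partial>lborel) (1 / q)
    \<le> ennreal C * ennreal_powr
      (\<integral>\<^sup>+x. ennreal (norm (gradient f x) powr p * infdist x E powr \<beta>) \<partial>lborel) (1 / p)"
proof -
  (* One exponent has to lie below both bounds when the first alternative holds. *)
  define t where "t = (if assouad_dim E < n - 1 then min (q / p * (n - p + \<beta>)) (n - 1) else q / p * (n - p + \<beta>))"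
  have "assouad_dim E < t" using assms(10) by (auto simp: t_def)
  then obtain \<nu> C0 where \<nu>: "0 \<le> \<nu>" "\<nu> < t" and C0: "0 < C0"
    and vol: "\<And>x r R. 0 < r \<Longrightarrow> r \<le> R \<Longrightarrow> emeasure lborel {y \<in> ball x R. infdist y E < r}
       \<le> ennreal (C0 * r powr (real DIM(real ^ 'n) - \<nu>) * R powr \<nu>)"
    by (rule assouad_neighbourhood_volume[OF assms(3,4)]) (assumption | rule that)+
  have n: "n = real DIM(real ^ 'n)" using n_def by simp
  have \<nu>Q: "\<nu> < q / p * (n - p + \<beta>)" using \<nu>(2) by (auto simp: t_def split: if_splits)
  have alt: "\<nu> < n - 1 \<or> \<beta> \<le> (p - 1) * (q * p + n * p - n * q) / (q * p + p - q)"
    using assms(11) \<nu>(2) by (auto simp: t_def)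
  obtain C where "0 < C" and C: "\<forall>f F. (\<forall>y. GDERIV f y :> F y) \<longrightarrow> continuous_on UNIV F \<longrightarrow> bounded {y. f y \<noteq> 0} \<longrightarrow>
    ennreal_powr (\<integral>\<^sup>+x. ennreal (\<bar>f x\<bar> powr q * infdist x E powr (q / p * (n - p + \<beta>) - n)) \<partial>lborel) (1 / q)
    \<le> ennreal C * ennreal_powr (\<integral>\<^sup>+x. ennreal (norm (F x :: real ^ 'n) powr p * infdist x E powr \<beta>) \<partial>lborel) (1 / p)"
    using hardy_sobolev_C1[OF n assms(3,4) porous_closed_null[OF assms(3,5)] assms(6-9) \<nu>Q C0 vol alt] by auto
  show ?thesis
  proof (intro exI[of _ C] conjI allI impI)
    fix f :: "real ^ 'n \<Rightarrow> real" assume f: "test_function f"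
    show "ennreal_powr (\<integral>\<^sup>+x. ennreal (\<bar>f x\<bar> powr q * infdist x E powr (q / p * (n - p + \<beta>) - n)) \<partial>lborel) (1 / q)
      \<le> ennreal C * ennreal_powr (\<integral>\<^sup>+x. ennreal (norm (gradient f x) powr p * infdist x E powr \<beta>) \<partial>lborel) (1 / p)"
      using test_function_gradient[OF f] by (intro C[rule_format]) auto
  qed (rule \<open>0 < C\<close>)
qed

end
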